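(* Let $d \in \mathbb{N}$. There exists a constant $C_d > 0$ such that for every analytic trigonometric polynomial $g$ on $\mathbb{T}^d$ one has $$ \| S_{\mathbb{T}^d}(g) \|_{L^1(\mathbb{T}^d)} \le C_d \| g \|_{L\log^d L(\mathbb{T}^d)}. $$ Moreover, the exponent $d$ in the Orlicz space $L\log^d L(\mathbb{T}^d)$ cannot be improved: if $r > 0$ is such that there is a constant $C > 0$ with $\| S_{\mathbb{T}^d}(g) \|_{L^1(\mathbb{T}^d)} \le C \| g \|_{L\log^r L(\mathbb{T}^d)}$ for every analytic trigonometric polynomial $g$ on $\mathbb{T}^d$, then $r \ge d$.
   Context: $\mathbb{N} = \{1,2,\dots\}$, $\mathbb{N}_0 = \mathbb{N}\cup\{0\}$, $\mathbb{T} = \mathbb{R}/\mathbb{Z}$ with Lebesgue measure, and $\widehat{f}(n) = \int_{\mathbb{T}^d} f(x) e^{-i2\pi n\cdot x}\,dx$ for $n \in \mathbb{Z}^d$. A trigonometric polynomial on $\mathbb{T}^d$ is an integrable function $f$ with $\operatorname{supp}(\widehat{f})$ finite; it is analytic if $\operatorname{supp}(\widehat{f}) \subset \mathbb{N}_0^d$. Littlewood-Paley projections on $\mathbb{T}$: for $k \in \mathbb{N}$, $$\Delta_k(f)(x) = \sum_{n=2^{k-1}}^{2^k-1} \widehat{f}(n) e^{i2\pi nx}, \qquad \Delta_{-k}(f)(x) = \sum_{n=-2^k+1}^{-2^{k-1}} \widehat{f}(n) e^{i2\pi nx},$$ and $\Delta_0(f)(x) = \widehat{f}(0)$. For $k_1,\dots,k_d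 \in \mathbb{Z}$, $\Delta_{k_1,\dots,k_d} = \Delta_{k_1}\otimes\cdots\otimes\Delta_{k_d}$, where $\Delta_{k_j}$ acts on the $j$-th variable. The $d$-parameter Littlewood-Paley square function is $$ S_{\mathbb{T}^d}(f)(x) = \Big( \sum_{k_1,\dots,k_d\in\mathbb{Z}} |\Delta_{k_1,\dots,k_d}(f)(x)|^2 \Big)^{1/2}. $$ Orlicz spaces: for $r > 0$, $L\log^r L(\mathbb{T}^d)$ is the space of measurable $f$ on $\mathbb{T}^d$ with $\int_{\mathbb{T}^d} |f(x)| \log^r(1+|f(x)|)\,dx < \infty$, and $$ \| f \|_{L\log^r L(\mathbb{T}^d)} = \inf\Big\{ \lambda > 0 : \int_{\mathbb{T}^d} \frac{|f(x)|}{\lambda} \log^r\Big(1 + \frac{|f(x)|}{\lambda}\Big) dx \le 1 \Big\}. $$ *)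

theory Defs
  imports "HOL-Analysis.Analysis"
begin

text \<open>
  The circle \<open>\<real>/\<int>\<close> is represented by its fundamental domain \<open>[0,1)\<close> and the \<open>d\<close>-dimensional torus
  by the product of \<open>d\<close> copies of it, so a function on the torus is a function
  \<open>f :: (nat \<Rightarrow> real) \<Rightarrow> complex\<close> of which only the values on \<open>[0,1)\<^sup>d\<close> matter. Points and frequency
  vectors are extensional functions on \<open>{..<d}\<close> (coordinates are numbered from 0).
\<close>

definition circle :: "real measure" where
  "circle = restrict_space lborel {0..<1}"

definition torus :: "nat \<Rightarrow> (nat \<Rightarrow> real) measure" where
  "torus d = PiM {..<d} (\<lambda>_. circle)"

definition int_vectors :: "nat \<Rightarrow> (nat \<Rightarrow> int) set" where
  "int_vectors d = ({..<d} \<rightarrow>\<^sub>E UNIV)"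

definition character :: "nat \<Rightarrow> (nat \<Rightarrow> int) \<Rightarrow> (nat \<Rightarrow> real) \<Rightarrow> complex" where
  "character d n x = cis (2 * pi * (\<Sum>j<d. of_int (n j) * x j))"

definition fourier :: "nat \<Rightarrow> ((nat \<Rightarrow> real) \<Rightarrow> complex) \<Rightarrow> (nat \<Rightarrow> int) \<Rightarrow> complex" where
  "fourier d f n = (LINT x|torus d. f x * cnj (character d n x))"

definition fourier_supp :: "nat \<Rightarrow> ((nat \<Rightarrow> real) \<Rightarrow> complex) \<Rightarrow> (nat \<Rightarrow> int) set" where
  "fourier_supp d f = {n \<in> int_vectors d. fourier d f n \<noteq> 0}"

definition trig_poly :: "nat \<Rightarrow> ((nat \<Rightarrow> real) \<Rightarrow> complex) \<Rightarrow> bool" where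
  "trig_poly d f \<longleftrightarrow> integrable (torus d) f \<and> finite (fourier_supp d f)"

definition analytic_trig_poly :: "nat \<Rightarrow> ((nat \<Rightarrow> real) \<Rightarrow> complex) \<Rightarrow> bool" where
  "analytic_trig_poly d f \<longleftrightarrow>
     trig_poly d f \<and> fourier_supp d f \<subseteq> {n. \<forall>j<d. 0 \<le> n j}"

definition dyadic_block :: "int \<Rightarrow> int set" where
  "dyadic_block k =
     (if k = 0 then {0}
      else if k > 0 then {2 ^ (nat k - 1) .. 2 ^ nat k - 1}
      else {- (2 ^ nat (- k)) + 1 .. - (2 ^ (nat (- k) - 1))})"

text \<open>
  The one-variable projections are Fourier multipliers with symbol the indicator of
  \<open>dyadic_block k\<close>; their tensor product is the Fourier multiplier with symbol the indicator of the
  product of the blocks. Lemma \<open>LP_tensor\<close> below checks this on elementary tensors.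
\<close>

definition LP :: "nat \<Rightarrow> (nat \<Rightarrow> int) \<Rightarrow> ((nat \<Rightarrow> real) \<Rightarrow> complex) \<Rightarrow> (nat \<Rightarrow> real) \<Rightarrow> complex" where
  "LP d k f x =
     (\<Sum>n \<in> (\<Pi>\<^sub>E j\<in>{..<d}. dyadic_block (k j)). fourier d f n * character d n x)"

text \<open>
  For a trigonometric polynomial only finitely many terms of the series are non-zero
  (lemma \<open>finite_LP_nonzero\<close>), so the real-valued sum is not subject to the default value 0
  of non-summable families.
\<close>

definition LP_square :: "nat \<Rightarrow> ((nat \<Rightarrow> real) \<Rightarrow> complex) \<Rightarrow> (nat \<Rightarrow> real) \<Rightarrow> real" where
  "LP_square d f x = sqrt (\<Sum>\<^sub>\<infinity>k\<in>int_vectors d. (cmod (LP d k f x))\<^sup>2)"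

text \<open>
  Both norms take values in \<open>[0,\<infinity>]\<close>; in particular, the Orlicz norm is \<open>\<infinity>\<close> if no
  admissible \<open>c\<close> exists.
\<close>

definition L1_norm :: "nat \<Rightarrow> ((nat \<Rightarrow> real) \<Rightarrow> real) \<Rightarrow> ennreal" where
  "L1_norm d h = (\<integral>\<^sup>+ x. ennreal \<bar>h x\<bar> \<partial>torus d)"

definition LlogL_norm :: "nat \<Rightarrow> real \<Rightarrow> ((nat \<Rightarrow> real) \<Rightarrow> complex) \<Rightarrow> ennreal" where
  "LlogL_norm d r f =
     Inf {ennreal c | c. c > 0 \<and>
       (\<integral>\<^sup>+ x. ennreal (cmod (f x) / c * ln (1 + cmod (f x) / c) powr r) \<partial>torus d) \<le> 1}"

text \<open>
  The one-variable coefficients and projections, used only to justify the definition of \<open>LP\<close>.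
\<close>

definition fourier1 :: "(real \<Rightarrow> complex) \<Rightarrow> int \<Rightarrow> complex" where
  "fourier1 f n = (LINT t|circle. f t * cis (- (2 * pi * of_int n * t)))"

definition LP1 :: "int \<Rightarrow> (real \<Rightarrow> complex) \<Rightarrow> real \<Rightarrow> complex" where
  "LP1 k f t = (\<Sum>n\<in>dyadic_block k. fourier1 f n * cis (2 * pi * of_int n * t))"

lemma finite_dyadic_block: "finite (dyadic_block k)"
  by (simp add: dyadic_block_def)

lemma cis_sum: "finite A \<Longrightarrow> cis (\<Sum>i\<in>A. f i) = (\<Prod>i\<in>A. cis (f i))"
  by (induction A rule: finite_induct) (simp_all flip: cis_mult)

lemma character_prod: "character d n x = (\<Prod>j<d. cis (2 * pi * of_int (n j) * x j))"
  by (simp add: character_def cis_sum sum_distrib_left mult.assoc)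

lemma product_sigma_finite_circle: "product_sigma_finite (\<lambda>_. circle)"
proof -
  have "sigma_finite_measure circle"
    unfolding circle_def
    by (rule sigma_finite_measure_restrict_space) (auto intro: sigma_finite_lborel)
  then show ?thesis by (simp add: product_sigma_finite_def)
qed

lemma fourier_tensor:
  assumes "\<And>j. j < d \<Longrightarrow> integrable circle (f j)"
  shows "fourier d (\<lambda>x. \<Prod>j<d. f j (x j)) n = (\<Prod>j<d. fourier1 (f j) (n j))"
proof -
  interpret product_sigma_finite "\<lambda>_::nat. circle" by (rule product_sigma_finite_circle)
  have int: "integrable circle (\<lambda>t. f j t * cis (- (2 * pi * of_int (n j) * t)))" if "j < d" for j
  proof (rule Bochner_Integration.integrable_bound[OF assms[OF that]])
    have "(\<lambda>t. cis (- (2 * pi * of_int (n j) * t))) \<in> borel_measurable borel"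
      by (intro borel_measurable_continuous_onI continuous_intros)
    then have "(\<lambda>t. cis (- (2 * pi * of_int (n j) * t))) \<in> borel_measurable circle"
      unfolding circle_def by (intro measurable_restrict_space1) simp
    then show "(\<lambda>t. f j t * cis (- (2 * pi * of_int (n j) * t))) \<in> borel_measurable circle"
      using assms[OF that] by (intro borel_measurable_times) auto
  qed (simp add: norm_mult)
  have "fourier d (\<lambda>x. \<Prod>j<d. f j (x j)) n =
      (LINT x|torus d. (\<Prod>j<d. f j (x j) * cis (- (2 * pi * of_int (n j) * x j))))"
    by (simp add: fourier_def character_prod prod.distrib cis_cnj)
  also have "\<dots> = (\<Prod>j<d. fourier1 (f j) (n j))"
    unfolding torus_def fourier1_def by (rule product_integral_prod) (use int in auto)
  finally show ?thesis .
qed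

lemma LP_tensor:
  assumes "\<And>j. j < d \<Longrightarrow> integrable circle (f j)"
  shows "LP d k (\<lambda>x. \<Prod>j<d. f j (x j)) x = (\<Prod>j<d. LP1 (k j) (f j) (x j))"
proof -
  have "LP d k (\<lambda>x. \<Prod>j<d. f j (x j)) x =
      (\<Sum>n \<in> (\<Pi>\<^sub>E j\<in>{..<d}. dyadic_block (k j)).
         \<Prod>j<d. fourier1 (f j) (n j) * cis (2 * pi * of_int (n j) * x j))"
    using assms by (simp add: LP_def fourier_tensor character_prod prod.distrib)
  also have "\<dots> = (\<Prod>j<d. LP1 (k j) (f j) (x j))"
    unfolding LP1_def by (rule prod_sum_PiE[symmetric]) (auto simp: finite_dyadic_block)
  finally show ?thesis .
qed

lemma dyadic_block_bound:
  assumes "m \<in> dyadic_block k"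
  shows "\<bar>k\<bar> \<le> \<bar>m\<bar> + 1"
proof -
  have *: "int (nat i - 1) < 2 ^ (nat i - 1)" if "i > 0" for i :: int
    using of_nat_less_two_power[of "nat i - 1"] by simp
  show ?thesis
    using assms *[of k] *[of "- k"] by (auto simp: dyadic_block_def split: if_splits)
qed

lemma finite_LP_nonzero:
  assumes "trig_poly d f"
  shows "finite {k \<in> int_vectors d. LP d k f x \<noteq> 0}"
proof (rule finite_subset)
  define S where "S = fourier_supp d f"
  show "{k \<in> int_vectors d. LP d k f x \<noteq> 0} \<subseteq>
      (\<Union>n\<in>S. \<Pi>\<^sub>E j\<in>{..<d}. {- (\<bar>n j\<bar> + 1) .. \<bar>n j\<bar> + 1})"
  proof safe
    fix k assume k: "k \<in> int_vectors d" "LP d k f x \<noteq> 0"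
    then obtain n where n: "n \<in> (\<Pi>\<^sub>E j\<in>{..<d}. dyadic_block (k j))" "fourier d f n \<noteq> 0"
      unfolding LP_def by (metis (no_types, lifting) mult_zero_left sum.neutral)
    then have "n \<in> S"
      by (auto simp: S_def fourier_supp_def int_vectors_def PiE_iff)
    moreover have "k j \<in> {- (\<bar>n j\<bar> + 1) .. \<bar>n j\<bar> + 1}" if "j < d" for j
    proof -
      have "\<bar>k j\<bar> \<le> \<bar>n j\<bar> + 1"
        using n(1) that by (intro dyadic_block_bound) (auto simp: PiE_iff)
      then show ?thesis unfolding atLeastAtMost_iff by linarith
    qed
    then have "k \<in> (\<Pi>\<^sub>E j\<in>{..<d}. {- (\<bar>n j\<bar> + 1) .. \<bar>n j\<bar> + 1})"
      using k(1) unfolding int_vectors_def PiE_iff by blast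
    ultimately show "k \<in> (\<Union>n\<in>S. \<Pi>\<^sub>E j\<in>{..<d}. {- (\<bar>n j\<bar> + 1) .. \<bar>n j\<bar> + 1})"
      by blast
  qed
  show "finite (\<Union>n\<in>S. \<Pi>\<^sub>E j\<in>{..<d}. {- (\<bar>n j\<bar> + 1) .. \<bar>n j\<bar> + 1})"
    using assms by (auto simp: S_def trig_poly_def intro!: finite_PiE)
qed

end

theory Submission
  imports Defs "HOL-Complex_Analysis.Complex_Analysis" "HOL-Computational_Algebra.Fundamental_Theorem_Algebra"
begin

text \<open>
  The upper bound treats one variable at a time. With \<open>\<Psi>\<^sub>m x = x ln\<^sup>m x\<close>, evaluated at
  \<open>sqrt (A\<^sup>2 + |\<cdot>|\<^sup>2)\<close> for a large constant \<open>A\<close>, one shows \<open>\<integral> \<Psi>\<^sub>m (S f) \<le> C \<integral> \<Psi>\<^sub>m\<^sub>+\<^sub>1 f\<close> for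
  analytic polynomials \<open>f\<close> in one variable with values in a finite-dimensional Hilbert space;
  Fubini's theorem and induction over the variables then lose one logarithm per variable.

  In one variable, \<open>\<Delta>\<^sub>k f\<close> is obtained from the increment \<open>G\<^sub>k\<close> of the Poisson extension of \<open>f\<close>
  between the radii \<open>2 powr (- 2 / 2\<^sup>k)\<close> and \<open>2 powr (- 1 / 2\<^sup>k)\<close> by a multiplier that is monotone
  on the \<open>k\<close>-th block, hence by a superposition of Riesz projections. The sequence \<open>(G\<^sub>k)\<close> is
  bounded by \<open>f\<close> without any loss because \<open>f\<close> is analytic: its square function is dominated by an
  area integral, which is controlled by Green's formula for \<open>\<Psi>\<^sub>m\<close> and by the Poisson maximal
  function of a root of \<open>\<Psi>\<^sub>m (|f|)\<close>, a subharmonic function in \<open>L\<^sup>2\<close>. The logarithm is lost in the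
  vector-valued Riesz projections, for which an explicit superharmonic function of Burkholder type
  is available.

  Sharpness is tested on tensor products of \<open>D\<^sub>N\<^sup>2 / N\<close>, where \<open>D\<^sub>N\<close> is the analytic Dirichlet kernel:
  their modulus is the Fejer kernel, but by Hardy's inequality the block of the upper half of
  the spectrum has \<open>L\<^sup>1\<close> norm of order \<open>ln N\<close> in each variable.
\<close>

section \<open>Green's formula on a cylinder\<close>

text \<open>After one variable the square function is the norm of a vector of polynomials in the
  remaining ones. Each one-variable estimate must therefore hold for Hilbert space valued
  polynomials with constants that do not see the dimension, and it must compare integrals so that
  Fubini applies; this favours pointwise arguments with explicit functions. A sharp frequency cut
  costs a logarithm, and an area or maximal bound could cost more. Analyticity prevents the further
  loss at two places. For harmonic f, Cauchy-Schwarz only shows that x = sqrt (A^2 + |f|^2) is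
  subharmonic; the Cauchy-Riemann equations halve the gradient bound, and then x times its Laplacian
  dominates the squared height derivative of f. Moreover the square root of |f| is still
  subharmonic, so the maximal function acts in L^2, where it is bounded, instead of near L^1. The
  shift A keeps x smooth at the zeros of f and makes ln x large compared with m, which settles the
  signs of the lower-order terms.\<close>

lemma concave_bdd_below_deriv_nonneg:
  fixes A :: "real \<Rightarrow> real"
  assumes A: "\<And>x. (A has_real_derivative A' x) (at x)"
    and A': "\<And>x. (A' has_real_derivative A'' x) (at x)"
    and le: "\<And>x. A'' x \<le> 0"
    and bd: "\<And>x. 0 \<le> x \<Longrightarrow> B \<le> A x"
  shows "0 \<le> A' x"
proof (rule ccontr)
  assume neg: "\<not> 0 \<le> A' x"
  have mono: "A' z \<le> A' y" if "y \<le> z" for y z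
    using that DERIV_nonpos_imp_nonincreasing[of y z A'] A' le by blast
  have lin: "A y \<le> A x + A' x * (y - x)" if "x \<le> y" for y
  proof -
    have "A y - A' x * y \<le> A x - A' x * x"
    proof (rule DERIV_nonpos_imp_nonincreasing[of x y "\<lambda>y. A y - A' x * y"])
      fix z assume "x \<le> z" "z \<le> y"
      then show "\<exists>d. ((\<lambda>y. A y - A' x * y) has_real_derivative d) (at z) \<and> d \<le> 0"
        by (intro exI[of _ "A' z - A' x"] conjI)
          (auto intro!: derivative_eq_intros A mono)
    qed (use that in auto)
    then show ?thesis by (simp add: algebra_simps)
  qed
  \<comment> \<open>Here the tangent at \<open>x\<close> has dropped to at most
    \<open>B - 1\<close>, below the assumed bound; the maximum with 0 keeps \<open>y\<close> where
    that bound is assumed.\<close>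
  define y where "y = max (max x 0) (x + (A x - B + 1) / (- A' x))"
  have "(A x - B + 1) / (- A' x) \<le> y - x" by (simp add: y_def)
  then have "A x - B + 1 \<le> (y - x) * (- A' x)"
    using neg by (subst (asm) pos_divide_le_eq) auto
  moreover have "A y \<le> A x + A' x * (y - x)" by (rule lin) (simp add: y_def)
  moreover have "B \<le> A y" by (rule bd) (simp add: y_def)
  ultimately show False by (simp add: algebra_simps)
qed

text \<open>Bundles a function on the cylinder with its pure partial derivatives up to order two,
  the ones that enter the Laplacian. The height ranges over all reals so that derivatives at height
  0 are two-sided; the endpoint conditions cancel the boundary terms in \<open>t\<close> and survive
  composition.\<close>

definition cylinder_smooth ::
  "(real \<Rightarrow> real \<Rightarrow> real) \<Rightarrow> (real \<Rightarrow> real \<Rightarrow> real) \<Rightarrow> (real \<Rightarrow> real \<Rightarrow> real) \<Rightarrow>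
   (real \<Rightarrow> real \<Rightarrow> real) \<Rightarrow> (real \<Rightarrow> real \<Rightarrow> real) \<Rightarrow> bool" where
  "cylinder_smooth V Va Vaa Vt Vtt \<longleftrightarrow>
     (\<forall>\<tau> t. ((\<lambda>\<tau>. V \<tau> t) has_real_derivative Va \<tau> t) (at \<tau>)) \<and>
     (\<forall>\<tau> t. ((\<lambda>\<tau>. Va \<tau> t) has_real_derivative Vaa \<tau> t) (at \<tau>)) \<and>
     (\<forall>\<tau> t. ((\<lambda>t. V \<tau> t) has_real_derivative Vt \<tau> t) (at t)) \<and>
     (\<forall>\<tau> t. ((\<lambda>t. Vt \<tau> t) has_real_derivative Vtt \<tau> t) (at t)) \<and>
     continuous_on UNIV (\<lambda>z. V (fst z) (snd z)) \<and>
     continuous_on UNIV (\<lambda>z. Va (fst z) (snd z)) \<and>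
     continuous_on UNIV (\<lambda>z. Vaa (fst z) (snd z)) \<and>
     continuous_on UNIV (\<lambda>z. Vt (fst z) (snd z)) \<and>
     continuous_on UNIV (\<lambda>z. Vtt (fst z) (snd z)) \<and>
     (\<forall>\<tau>. V \<tau> 1 = V \<tau> 0 \<and> Vt \<tau> 1 = Vt \<tau> 0)"

lemma continuous_on_curry_snd:
  fixes V :: "real \<Rightarrow> real \<Rightarrow> 'a::topological_space"
  assumes "continuous_on UNIV (\<lambda>z. V (fst z) (snd z))"
  shows "continuous_on S (V \<tau>)"
proof -
  have "continuous_on S ((\<lambda>z. V (fst z) (snd z)) \<circ> (\<lambda>t. (\<tau>, t)))"
    by (intro continuous_on_compose continuous_intros continuous_on_subset[OF assms]) auto
  then show ?thesis by (simp add: o_def)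
qed

lemma continuous_on_curry_fst:
  fixes V :: "real \<Rightarrow> real \<Rightarrow> 'a::topological_space"
  assumes "continuous_on UNIV (\<lambda>z. V (fst z) (snd z))"
  shows "continuous_on S (\<lambda>\<tau>. V \<tau> t)"
proof -
  have "continuous_on S ((\<lambda>z. V (fst z) (snd z)) \<circ> (\<lambda>\<tau>. (\<tau>, t)))"
    by (intro continuous_on_compose continuous_intros continuous_on_subset[OF assms]) auto
  then show ?thesis by (simp add: o_def)
qed

lemma DERIV_integral_parameter:
  fixes V :: "real \<Rightarrow> real \<Rightarrow> real"
  assumes "\<And>\<tau> t. ((\<lambda>\<tau>. V \<tau> t) has_real_derivative Va \<tau> t) (at \<tau>)"
    and "continuous_on UNIV (\<lambda>z. V (fst z) (snd z))"
    and "continuous_on UNIV (\<lambda>z. Va (fst z) (snd z))"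
  shows "((\<lambda>\<tau>. integral {0..1} (V \<tau>)) has_real_derivative integral {0..1} (Va \<tau>)) (at \<tau>)"
proof -
  have "((\<lambda>\<tau>. integral (cbox 0 1) (V \<tau>)) has_field_derivative integral (cbox 0 1) (Va \<tau>))
          (at \<tau> within UNIV)"
  proof (rule leibniz_rule_field_derivative)
    show "V x integrable_on cbox 0 1" for x
      using continuous_on_curry_snd[OF assms(2)] by (intro integrable_continuous)
    show "continuous_on (UNIV \<times> cbox 0 1) (\<lambda>(x, t). Va x t)"
      using continuous_on_subset[OF assms(3)] by (simp add: case_prod_beta')
  qed (use assms(1) in auto)
  then show ?thesis by simp
qed

lemma integral_partial_snd_zero:
  assumes "\<And>t. (f has_real_derivative f' t) (at t)" "f 1 = f 0"
  shows "integral {0..1} f' = 0"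
proof -
  have "(f' has_integral (f 1 - f 0)) {0..1}"
    by (rule fundamental_theorem_of_calculus)
      (use assms(1) in \<open>auto simp flip: has_real_derivative_iff_has_vector_derivative
        intro: has_field_derivative_at_within\<close>)
  then show ?thesis using assms(2) by (simp add: integral_unique)
qed

text \<open>Periodicity makes \<open>Vtt\<close> integrate to zero over a circle, so the second
  derivative of the circle mean is the mean of the full Laplacian.\<close>

lemma cylinder_smooth_mean:
  assumes V: "cylinder_smooth V Va Vaa Vt Vtt"
  shows "((\<lambda>\<tau>. integral {0..1} (V \<tau>)) has_real_derivative integral {0..1} (Va \<tau>)) (at \<tau>)"
    and "((\<lambda>\<tau>. integral {0..1} (Va \<tau>)) has_real_derivative
           integral {0..1} (\<lambda>t. Vaa \<tau> t + Vtt \<tau> t)) (at \<tau>)"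
proof -
  note V' = V[unfolded cylinder_smooth_def]
  show "((\<lambda>\<tau>. integral {0..1} (V \<tau>)) has_real_derivative integral {0..1} (Va \<tau>)) (at \<tau>)"
    by (rule DERIV_integral_parameter) (use V' in blast)+
  have i: "Vaa \<tau> integrable_on {0..1}" "Vtt \<tau> integrable_on {0..1}"
    using V' by (auto intro!: integrable_continuous_interval continuous_on_curry_snd)
  have "integral {0..1} (\<lambda>t. Vaa \<tau> t + Vtt \<tau> t) = integral {0..1} (Vaa \<tau>)"
    using i integral_partial_snd_zero[of "Vt \<tau>" "Vtt \<tau>"] V'
    by (subst Henstock_Kurzweil_Integration.integral_add) auto
  moreover have "((\<lambda>\<tau>. integral {0..1} (Va \<tau>)) has_real_derivative integral {0..1} (Vaa \<tau>)) (at \<tau>)"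
    by (rule DERIV_integral_parameter) (use V' in blast)+
  ultimately show "((\<lambda>\<tau>. integral {0..1} (Va \<tau>)) has_real_derivative
           integral {0..1} (\<lambda>t. Vaa \<tau> t + Vtt \<tau> t)) (at \<tau>)" by simp
qed

text \<open>The circle mean of a superharmonic function is concave in the height; being bounded
  below, it can only increase.\<close>

lemma integral_Laplacian_nonpos:
  assumes V: "cylinder_smooth V Va Vaa Vt Vtt"
    and le: "\<And>\<tau> t. Vaa \<tau> t + Vtt \<tau> t \<le> 0"
    and bd: "\<And>\<tau> t. 0 \<le> \<tau> \<Longrightarrow> B \<le> V \<tau> t"
    and "0 \<le> \<tau>"
  shows "integral {0..1} (V 0) \<le> integral {0..1} (V \<tau>)"
proof (rule DERIV_nonneg_imp_nondecreasing[of 0 \<tau>])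
  fix x
  note V' = V[unfolded cylinder_smooth_def]
  have int: "f x integrable_on {0..1}" if "continuous_on UNIV (\<lambda>z. f (fst z) (snd z))"
    for f :: "real \<Rightarrow> real \<Rightarrow> real" and x
    using that by (intro integrable_continuous_interval continuous_on_curry_snd)
  have Lint: "(\<lambda>t. Vaa \<tau> t + Vtt \<tau> t) integrable_on {0..1}" for \<tau>
    by (rule Henstock_Kurzweil_Integration.integrable_add[OF int[of Vaa] int[of Vtt]])
      (use V' in \<open>blast, blast\<close>)
  have "0 \<le> integral {0..1} (Va x)"
  proof (rule concave_bdd_below_deriv_nonneg[OF cylinder_smooth_mean[OF V]])
    fix \<tau> :: real
    have "integral {0..1} (\<lambda>t. Vaa \<tau> t + Vtt \<tau> t) \<le> integral {0..1} (\<lambda>t::real. 0::real)"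
      by (rule Henstock_Kurzweil_Integration.integral_le[OF Lint integrable_0 le])
    then show "integral {0..1} (\<lambda>t. Vaa \<tau> t + Vtt \<tau> t) \<le> 0" by simp
    assume "0 \<le> \<tau>"
    have "integral {0..1} (\<lambda>t::real. B) \<le> integral {0..1} (V \<tau>)"
      by (intro integral_le int bd \<open>0 \<le> \<tau>\<close>) (use V' in auto)
    then show "B \<le> integral {0..1} (V \<tau>)" by simp
  qed
  then show "\<exists>y. ((\<lambda>\<tau>. integral {0..1} (V \<tau>)) has_real_derivative y) (at x) \<and> 0 \<le> y"
    using cylinder_smooth_mean[OF V] by blast
qed (use assms in auto)

text \<open>The height is the Green function of the half-cylinder with pole at infinity. With
  \<open>A\<close> the circle mean, \<open>\<tau> A'' = (\<tau> A' - A)'\<close>, and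
  \<open>A' \<le> 0\<close> because \<open>A\<close> is convex and bounded above for
  \<open>\<tau> \<ge> 0\<close>.\<close>

lemma integral_Laplacian_weighted:
  assumes V: "cylinder_smooth V Va Vaa Vt Vtt"
    and ge: "\<And>\<tau> t. 0 \<le> Vaa \<tau> t + Vtt \<tau> t"
    and bd: "\<And>\<tau> t. 0 \<le> \<tau> \<Longrightarrow> V \<tau> t \<le> B"
    and pos: "\<And>\<tau> t. 0 \<le> V \<tau> t"
    and "0 \<le> T"
  shows "integral {0..T} (\<lambda>\<tau>. \<tau> * integral {0..1} (\<lambda>t. Vaa \<tau> t + Vtt \<tau> t)) \<le> integral {0..1} (V 0)"
    (is "integral _ ?f \<le> _")
proof -
  note V' = V[unfolded cylinder_smooth_def]
  have int: "f x integrable_on {0..1}" if "continuous_on UNIV (\<lambda>z. f (fst z) (snd z))"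
    for f :: "real \<Rightarrow> real \<Rightarrow> real" and x
    using that by (intro integrable_continuous_interval continuous_on_curry_snd)
  have Lint: "(\<lambda>t. Vaa \<tau> t + Vtt \<tau> t) integrable_on {0..1}" for \<tau>
    by (rule Henstock_Kurzweil_Integration.integrable_add[OF int[of Vaa] int[of Vtt]])
      (use V' in \<open>blast, blast\<close>)
  define A A1 A2 where "A = (\<lambda>\<tau>. integral {0..1} (V \<tau>))" and "A1 = (\<lambda>\<tau>. integral {0..1} (Va \<tau>))"
    and "A2 = (\<lambda>\<tau>. integral {0..1} (\<lambda>t. Vaa \<tau> t + Vtt \<tau> t))"
  have d: "(A has_real_derivative A1 x) (at x)" "(A1 has_real_derivative A2 x) (at x)" for x
    using cylinder_smooth_mean[OF V] by (simp_all add: A_def A1_def A2_def)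
  have A1: "0 \<le> - A1 T"
  proof (rule concave_bdd_below_deriv_nonneg[of "\<lambda>x. - A x" "\<lambda>x. - A1 x" "\<lambda>x. - A2 x" "-B"])
    show "((\<lambda>x. - A x) has_real_derivative - A1 x) (at x)" for x by (rule DERIV_minus[OF d(1)])
    show "((\<lambda>x. - A1 x) has_real_derivative - A2 x) (at x)" for x by (rule DERIV_minus[OF d(2)])
    fix \<tau> :: real
    have "integral {0..1} (\<lambda>t::real. 0::real) \<le> A2 \<tau>" unfolding A2_def
      by (rule Henstock_Kurzweil_Integration.integral_le[OF integrable_0 Lint ge])
    then show "- A2 \<tau> \<le> 0" by simp
    assume "0 \<le> \<tau>"
    have "A \<tau> \<le> integral {0..1} (\<lambda>t::real. B)" unfolding A_def
      by (intro integral_le int bd \<open>0 \<le> \<tau>\<close>) (use V' in auto)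
    then show "- B \<le> - A \<tau>" by simp
  qed
  have AT: "0 \<le> A T"
    unfolding A_def by (intro Henstock_Kurzweil_Integration.integral_nonneg int pos) (use V' in auto)
  have "((\<lambda>\<tau>. \<tau> * A1 \<tau> - A \<tau>) has_real_derivative \<tau> * A2 \<tau>) (at \<tau> within {0..T})" for \<tau>
  proof -
    have "((\<lambda>\<tau>. \<tau> * A1 \<tau> - A \<tau>) has_real_derivative (1 * A1 \<tau> + A2 \<tau> * \<tau>) - A1 \<tau>) (at \<tau>)"
      by (intro DERIV_diff DERIV_mult d DERIV_ident)
    then show ?thesis by (simp add: has_field_derivative_at_within mult.commute)
  qed
  then have "((\<lambda>\<tau>. \<tau> * A2 \<tau>) has_integral ((T * A1 T - A T) - (0 * A1 0 - A 0))) {0..T}"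
    by (intro fundamental_theorem_of_calculus[OF \<open>0 \<le> T\<close>])
      (simp add: has_real_derivative_iff_has_vector_derivative)
  then have "integral {0..T} (\<lambda>\<tau>. \<tau> * A2 \<tau>) = T * A1 T - A T + A 0"
    by (simp add: integral_unique)
  moreover have "T * A1 T \<le> 0"
    using \<open>0 \<le> T\<close> A1 by (intro mult_nonneg_nonpos) auto
  ultimately have "integral {0..T} (\<lambda>\<tau>. \<tau> * A2 \<tau>) \<le> A 0"
    using AT by linarith
  then show ?thesis by (simp add: A2_def A_def)
qed

section \<open>A Burkholder function for the Riesz projection\<close>

text \<open>
  With \<open>s = x + y\<close>, the function \<open>U = burkholder m x y\<close> satisfies \<open>dU = \<alpha> d(y\<^sup>2 - x\<^sup>2) - \<beta> dx\<close>, and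
  \<open>\<alpha>' = - \<kappa> / (2 s\<^sup>2)\<close>, \<open>\<beta>' = \<kappa> / s\<close>. Therefore its second differential is
  \<open>\<alpha> d\<^sup>2(y\<^sup>2 - x\<^sup>2) - \<beta> d\<^sup>2x - \<kappa> y (ds / s)\<^sup>2\<close>, and superharmonicity follows from the signs of
  \<open>\<alpha>\<close>, \<open>\<beta>\<close>, \<open>\<kappa>\<close>.
\<close>

definition burkholder :: "nat \<Rightarrow> real \<Rightarrow> real \<Rightarrow> real" where
  "burkholder m x y = y * ln (x + y) ^ m - x * ln (x + y) ^ (m + 1) / (real m + 1)"

definition burkholder_\<alpha> :: "nat \<Rightarrow> real \<Rightarrow> real" where
  "burkholder_\<alpha> m s = (ln s ^ m + m * ln s ^ (m - 1)) / (2 * s)"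

definition burkholder_\<beta> :: "nat \<Rightarrow> real \<Rightarrow> real" where
  "burkholder_\<beta> m s = ln s ^ (m + 1) / (real m + 1) - m * ln s ^ (m - 1)"

definition burkholder_\<kappa> :: "nat \<Rightarrow> real \<Rightarrow> real" where
  "burkholder_\<kappa> m s = ln s ^ m - real m * real (m - 1) * ln s ^ (m - 1 - 1)"

lemma DERIV_ln_power:
  assumes "(f has_real_derivative f') (at r)" "0 < f r"
  shows "((\<lambda>r. ln (f r) ^ m) has_real_derivative m * ln (f r) ^ (m - 1) * (f' / f r)) (at r)"
  using assms by (auto intro!: derivative_eq_intros)

lemma DERIV_burkholder_\<alpha>:
  assumes f: "(f has_real_derivative f') (at r)" and pos: "0 < f r"
  shows "((\<lambda>r. burkholder_\<alpha> m (f r)) has_real_derivative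
           - burkholder_\<kappa> m (f r) / (2 * (f r)\<^sup>2) * f') (at r)"
proof -
  have "((\<lambda>r. (ln (f r) ^ m + m * ln (f r) ^ (m - 1)) / (2 * f r)) has_real_derivative
      ((m * ln (f r) ^ (m - 1) * (f' / f r) + m * (real (m - 1) * ln (f r) ^ (m - 1 - 1) * (f' / f r)))
          * (2 * f r) - (ln (f r) ^ m + m * ln (f r) ^ (m - 1)) * (2 * f')) / ((2 * f r) * (2 * f r))) (at r)"
    using pos by (intro DERIV_divide DERIV_add DERIV_cmult DERIV_ln_power f) auto
  then show ?thesis
    unfolding burkholder_\<alpha>_def
    by (rule DERIV_cong) (use pos in \<open>simp add: burkholder_\<kappa>_def field_simps power2_eq_square\<close>)
qed

lemma DERIV_burkholder_\<beta>:
  assumes f: "(f has_real_derivative f') (at r)" and pos: "0 < f r"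
  shows "((\<lambda>r. burkholder_\<beta> m (f r)) has_real_derivative burkholder_\<kappa> m (f r) / f r * f') (at r)"
proof -
  have "((\<lambda>r. ln (f r) ^ (m + 1) / (real m + 1) - m * ln (f r) ^ (m - 1)) has_real_derivative
      (real (m + 1) * ln (f r) ^ (m + 1 - 1) * (f' / f r)) / (real m + 1)
        - m * (real (m - 1) * ln (f r) ^ (m - 1 - 1) * (f' / f r))) (at r)"
    using pos by (intro DERIV_diff DERIV_cdivide DERIV_cmult DERIV_ln_power f) auto
  moreover have "real (m + 1) * ln (f r) ^ (m + 1 - 1) * (f' / f r) / (real m + 1) = ln (f r) ^ m * (f' / f r)"
    by (simp add: divide_simps)
  ultimately have "((\<lambda>r. ln (f r) ^ (m + 1) / (real m + 1) - m * ln (f r) ^ (m - 1)) has_real_derivative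
      ln (f r) ^ m * (f' / f r) - m * (real (m - 1) * ln (f r) ^ (m - 1 - 1) * (f' / f r))) (at r)"
    by simp
  then show ?thesis
    unfolding burkholder_\<beta>_def
    by (rule DERIV_cong) (simp add: burkholder_\<kappa>_def algebra_simps diff_divide_distrib)
qed

lemma DERIV_burkholder:
  assumes x: "(x has_real_derivative x') (at r)" and y: "(y has_real_derivative y') (at r)"
    and pos: "0 < x r + y r"
  shows "((\<lambda>r. burkholder m (x r) (y r)) has_real_derivative
           burkholder_\<alpha> m (x r + y r) * (2 * y r * y' - 2 * x r * x')
           - burkholder_\<beta> m (x r + y r) * x') (at r)"
proof -
  define s where "s = x r + y r"
  have s: "((\<lambda>r. x r + y r) has_real_derivative x' + y') (at r)"
    by (intro DERIV_add x y)
  have "((\<lambda>r. y r * ln (x r + y r) ^ m - x r * ln (x r + y r) ^ (m + 1) / (real m + 1)) has_real_derivative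
     (y' * ln s ^ m + (real m * ln s ^ (m - 1) * ((x' + y') / s)) * y r)
     - (x' * ln s ^ (m + 1) + (real (m + 1) * ln s ^ (m + 1 - 1) * ((x' + y') / s)) * x r) / (real m + 1)) (at r)"
    unfolding s_def
    using pos by (intro DERIV_diff DERIV_cdivide DERIV_mult' DERIV_mult DERIV_ln_power s x y) auto
  moreover have "(y' * ln s ^ m + (real m * ln s ^ (m - 1) * ((x' + y') / s)) * y r)
     - (x' * ln s ^ (m + 1) + (real (m + 1) * ln s ^ (m + 1 - 1) * ((x' + y') / s)) * x r) / (real m + 1) =
     burkholder_\<alpha> m s * (2 * y r * y' - 2 * x r * x') - burkholder_\<beta> m s * x'"
  proof -
    define A B C where "A = ln s ^ m" "B = ln s ^ (m - 1)" "C = ln s ^ (m + 1)"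
    have y: "y r = s - x r" by (simp add: s_def)
    have c: "(1 + real m) * X / (real m + 1) = X" for X by (simp add: add.commute)
    have "s \<noteq> 0" using pos s_def by simp
    then have e1: "y' * A + real m * B * ((x' + y') / s) * y r - (x' * C + real (m + 1) * A * ((x' + y') / s) * x r) / (real m + 1)
      = y' * A + real m * B * ((x' + y') / s) * y r - x' * C / (real m + 1) - A * ((x' + y') / s) * x r"
      by (simp add: add_divide_distrib mult.assoc c)
    have "y' * A + real m * B * ((x' + y') / s) * y r - A * ((x' + y') / s) * x r =
        (A + real m * B) / (2 * s) * (2 * y r * y' - 2 * x r * x') + real m * B * x'"
      using \<open>s \<noteq> 0\<close> unfolding y by (simp add: field_simps)
    then have e2: "y' * A + real m * B * ((x' + y') / s) * y r - x' * C / (real m + 1) - A * ((x' + y') / s) * x r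
      = (A + real m * B) / (2 * s) * (2 * y r * y' - 2 * x r * x') - (C / (real m + 1) - real m * B) * x'"
      by (simp add: algebra_simps)
    from trans[OF e1 e2] show ?thesis
      by (simp only: A_B_C_def burkholder_\<alpha>_def burkholder_\<beta>_def add_diff_cancel_right')
  qed
  ultimately show ?thesis unfolding burkholder_def s_def by simp
qed

lemma DERIV_burkholder':
  assumes x: "(x has_real_derivative x1 r) (at r)" and y: "(y has_real_derivative y1 r) (at r)"
    and x1: "(x1 has_real_derivative x2) (at r)" and y1: "(y1 has_real_derivative y2) (at r)"
    and pos: "0 < x r + y r"
  shows "((\<lambda>r. burkholder_\<alpha> m (x r + y r) * (2 * y r * y1 r - 2 * x r * x1 r)
           - burkholder_\<beta> m (x r + y r) * x1 r) has_real_derivative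
           burkholder_\<alpha> m (x r + y r) * (2 * (y r * y2 + (y1 r)\<^sup>2) - 2 * (x r * x2 + (x1 r)\<^sup>2))
           - burkholder_\<beta> m (x r + y r) * x2
           - burkholder_\<kappa> m (x r + y r) * y r * ((x1 r + y1 r) / (x r + y r))\<^sup>2) (at r)"
proof -
  define s where "s = x r + y r"
  have s: "((\<lambda>r. x r + y r) has_real_derivative x1 r + y1 r) (at r)"
    by (intro DERIV_add x y)
  have q: "((\<lambda>r. 2 * y r * y1 r - 2 * x r * x1 r) has_real_derivative
      2 * (y r * y2 + (y1 r)\<^sup>2) - 2 * (x r * x2 + (x1 r)\<^sup>2)) (at r)"
    by (auto intro!: derivative_eq_intros x y x1 y1 simp: algebra_simps power2_eq_square)
  define K where "K = burkholder_\<kappa> m s"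
  have "((\<lambda>r. burkholder_\<alpha> m (x r + y r) * (2 * y r * y1 r - 2 * x r * x1 r)
           - burkholder_\<beta> m (x r + y r) * x1 r) has_real_derivative
       (- K / (2 * s\<^sup>2) * (x1 r + y1 r) * (2 * y r * y1 r - 2 * x r * x1 r) +
        (2 * (y r * y2 + (y1 r)\<^sup>2) - 2 * (x r * x2 + (x1 r)\<^sup>2)) * burkholder_\<alpha> m s) -
       (K / s * (x1 r + y1 r) * x1 r + x2 * burkholder_\<beta> m s)) (at r)"
    unfolding s_def K_def using pos
    by (intro DERIV_diff DERIV_mult DERIV_burkholder_\<alpha> DERIV_burkholder_\<beta> s q x1)
  \<comment> \<open>With \<open>s = x + y\<close> one has \<open>y y' - x x' + s x' = y s'\<close>;
    this is where the derivatives of \<alpha> and \<beta> merge into a square.\<close>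
  moreover have "- K / (2 * s\<^sup>2) * (x1 r + y1 r) * (2 * y r * y1 r - 2 * x r * x1 r)
      - K / s * (x1 r + y1 r) * x1 r = - K * y r * ((x1 r + y1 r) / s)\<^sup>2"
  proof -
    have y: "y r = s - x r" by (simp add: s_def)
    have "s \<noteq> 0" using pos s_def by simp
    then show ?thesis unfolding y by (simp add: field_simps power2_eq_square)
  qed
  ultimately show ?thesis
    by (elim DERIV_cong) (simp add: s_def K_def algebra_simps)
qed

lemma cylinder_smooth_sqrt:
  assumes P: "cylinder_smooth P Pa Paa Pt Ptt" and pos: "\<And>\<tau> t. 0 < P \<tau> t"
  shows "cylinder_smooth (\<lambda>\<tau> t. sqrt (P \<tau> t)) (\<lambda>\<tau> t. Pa \<tau> t / (2 * sqrt (P \<tau> t)))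
           (\<lambda>\<tau> t. Paa \<tau> t / (2 * sqrt (P \<tau> t)) - (Pa \<tau> t)\<^sup>2 / (4 * (sqrt (P \<tau> t)) ^ 3))
           (\<lambda>\<tau> t. Pt \<tau> t / (2 * sqrt (P \<tau> t)))
           (\<lambda>\<tau> t. Ptt \<tau> t / (2 * sqrt (P \<tau> t)) - (Pt \<tau> t)\<^sup>2 / (4 * (sqrt (P \<tau> t)) ^ 3))"
proof -
  have 1: "((\<lambda>r. sqrt (f r)) has_real_derivative f1 / (2 * sqrt (f r))) (at r)"
    if "(f has_real_derivative f1) (at r)" "0 < f r" for f f1 and r :: real
    using that by (auto intro!: derivative_eq_intros simp: field_simps)
  have 2: "((\<lambda>r. f1 r / (2 * sqrt (f r))) has_real_derivative
       f2 / (2 * sqrt (f r)) - (f1 r)\<^sup>2 / (4 * (sqrt (f r)) ^ 3)) (at r)"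
    if f: "(f has_real_derivative f1 r) (at r)" "(f1 has_real_derivative f2) (at r)" "0 < f r" for f f1 f2 and r :: real
  proof -
    have "((\<lambda>r. f1 r / (2 * sqrt (f r))) has_real_derivative
      (f2 * (2 * sqrt (f r)) - f1 r * (2 * (f1 r / (2 * sqrt (f r))))) / ((2 * sqrt (f r)) * (2 * sqrt (f r)))) (at r)"
      using f by (intro DERIV_divide DERIV_cmult 1) auto
    then show ?thesis
      by (rule DERIV_cong) (use f in \<open>simp add: field_simps power2_eq_square power3_eq_cube\<close>)
  qed
  have nz: "P \<tau> t \<noteq> 0" for \<tau> t using pos[of \<tau> t] by auto
  note P' = P[unfolded cylinder_smooth_def]
  show ?thesis
    unfolding cylinder_smooth_def
    by (intro conjI allI 1 2 continuous_intros) (use P' in \<open>simp_all add: nz pos\<close>)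
qed

text \<open>The second part of \<open>sub\<close> says that the Laplacian of \<open>y^2\<close> is
  at most that of \<open>x^2\<close>, a differential subordination; it is weighted by \<alpha>, the
  subharmonicity of \<open>x\<close> by \<beta>. The lower bound on \<open>x\<close> gives
  \<open>ln s \<ge> m + 1\<close>, enough for \<alpha>, \<beta> and \<kappa> to be
  nonnegative.\<close>

lemma burkholder_superharmonic:
  assumes x: "cylinder_smooth x xa xaa xt xtt" and y: "cylinder_smooth y ya yaa yt ytt"
    and pos: "\<And>\<tau> t. exp (m + 1) \<le> x \<tau> t" "\<And>\<tau> t. 0 < y \<tau> t"
    and sub: "\<And>\<tau> t. 0 \<le> xaa \<tau> t + xtt \<tau> t"
     "\<And>\<tau> t. y \<tau> t * (yaa \<tau> t + ytt \<tau> t) + (ya \<tau> t)\<^sup>2 + (yt \<tau> t)\<^sup>2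
         \<le> x \<tau> t * (xaa \<tau> t + xtt \<tau> t) + (xa \<tau> t)\<^sup>2 + (xt \<tau> t)\<^sup>2"
    and bd: "\<And>\<tau> t. 0 \<le> \<tau> \<Longrightarrow> x \<tau> t \<le> R"  "\<And>\<tau> t. 0 \<le> \<tau> \<Longrightarrow> y \<tau> t \<le> R"
    and "0 \<le> \<tau>"
  shows "integral {0..1} (\<lambda>t. burkholder m (x 0 t) (y 0 t)) \<le>
         integral {0..1} (\<lambda>t. burkholder m (x \<tau> t) (y \<tau> t))"
proof -
  have x0: "0 < x \<tau> t" for \<tau> t using pos(1)[of \<tau> t] by (meson exp_gt_zero less_le_trans)
  have s0: "0 < x \<tau> t + y \<tau> t" for \<tau> t using x0[of \<tau> t] pos(2)[of \<tau> t] by simp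
  define U2 where "U2 = (\<lambda>x xa xaa y ya yaa (\<tau>::real) (t::real).
           burkholder_\<alpha> m (x \<tau> t + y \<tau> t) * (2 * (y \<tau> t * yaa \<tau> t + (ya \<tau> t)\<^sup>2) - 2 * (x \<tau> t * xaa \<tau> t + (xa \<tau> t)\<^sup>2))
           - burkholder_\<beta> m (x \<tau> t + y \<tau> t) * xaa \<tau> t
           - burkholder_\<kappa> m (x \<tau> t + y \<tau> t) * y \<tau> t * ((xa \<tau> t + ya \<tau> t) / (x \<tau> t + y \<tau> t))\<^sup>2)"
  define U1 where "U1 = (\<lambda>x xa y ya (\<tau>::real) (t::real).
           burkholder_\<alpha> m (x \<tau> t + y \<tau> t) * (2 * y \<tau> t * ya \<tau> t - 2 * x \<tau> t * xa \<tau> t)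
           - burkholder_\<beta> m (x \<tau> t + y \<tau> t) * xa \<tau> t)"
  note x' = x[unfolded cylinder_smooth_def] and y' = y[unfolded cylinder_smooth_def]
  have nz: "x \<tau> t + y \<tau> t \<noteq> 0" "2 * x \<tau> t + 2 * y \<tau> t \<noteq> 0" for \<tau> t
    using s0[of \<tau> t] by linarith+
  have cx: "continuous_on UNIV (\<lambda>z. x (fst z) (snd z))"
    and cy: "continuous_on UNIV (\<lambda>z. y (fst z) (snd z))"
    using x' y' by blast+
  have cU: "continuous_on UNIV (\<lambda>z. burkholder m (x (fst z) (snd z)) (y (fst z) (snd z)))"
    unfolding burkholder_def by (intro continuous_intros cx cy) (simp_all add: nz)
  have c\<alpha>: "continuous_on UNIV (\<lambda>z. burkholder_\<alpha> m (x (fst z) (snd z) + y (fst z) (snd z)))"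
    unfolding burkholder_\<alpha>_def by (intro continuous_intros cx cy) (simp_all add: nz)
  have c\<beta>: "continuous_on UNIV (\<lambda>z. burkholder_\<beta> m (x (fst z) (snd z) + y (fst z) (snd z)))"
    unfolding burkholder_\<beta>_def by (intro continuous_intros cx cy) (simp_all add: nz)
  have c\<kappa>: "continuous_on UNIV (\<lambda>z. burkholder_\<kappa> m (x (fst z) (snd z) + y (fst z) (snd z)))"
    unfolding burkholder_\<kappa>_def by (intro continuous_intros cx cy) (simp_all add: nz)
  have cU1: "continuous_on UNIV (\<lambda>z. U1 x x1 y y1 (fst z) (snd z))"
    if "continuous_on UNIV (\<lambda>z. x1 (fst z) (snd z))" "continuous_on UNIV (\<lambda>z. y1 (fst z) (snd z))"
    for x1 y1
    unfolding U1_def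
    by (intro continuous_on_diff continuous_on_mult continuous_on_const cx cy c\<alpha> c\<beta> that)
  have cU2: "continuous_on UNIV (\<lambda>z. U2 x x1 x2 y y1 y2 (fst z) (snd z))"
    if "continuous_on UNIV (\<lambda>z. x1 (fst z) (snd z))" "continuous_on UNIV (\<lambda>z. y1 (fst z) (snd z))"
      "continuous_on UNIV (\<lambda>z. x2 (fst z) (snd z))" "continuous_on UNIV (\<lambda>z. y2 (fst z) (snd z))"
    for x1 y1 x2 y2
    unfolding U2_def
    by (intro continuous_on_diff continuous_on_mult continuous_on_const continuous_on_add
        continuous_on_divide continuous_on_power cx cy c\<alpha> c\<beta> c\<kappa> that) (simp add: nz)
  have "cylinder_smooth (\<lambda>\<tau> t. burkholder m (x \<tau> t) (y \<tau> t)) (U1 x xa y ya) (U2 x xa xaa y ya yaa)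
      (U1 x xt y yt) (U2 x xt xtt y yt ytt)"
    unfolding cylinder_smooth_def
  proof (intro conjI allI cU cU1 cU2)
    fix \<tau> t
    show "((\<lambda>\<tau>. burkholder m (x \<tau> t) (y \<tau> t)) has_real_derivative U1 x xa y ya \<tau> t) (at \<tau>)"
      unfolding U1_def by (rule DERIV_burkholder) (use x' y' s0 in blast)+
    show "((\<lambda>\<tau>. U1 x xa y ya \<tau> t) has_real_derivative U2 x xa xaa y ya yaa \<tau> t) (at \<tau>)"
      unfolding U1_def U2_def by (rule DERIV_burkholder') (use x' y' s0 in blast)+
    show "((\<lambda>t. burkholder m (x \<tau> t) (y \<tau> t)) has_real_derivative U1 x xt y yt \<tau> t) (at t)"
      unfolding U1_def by (rule DERIV_burkholder) (use x' y' s0 in blast)+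
    show "(U1 x xt y yt \<tau> has_real_derivative U2 x xt xtt y yt ytt \<tau> t) (at t)"
      unfolding U1_def U2_def by (rule DERIV_burkholder') (use x' y' s0 in blast)+
    have "x \<tau> 1 = x \<tau> 0" "y \<tau> 1 = y \<tau> 0" "xt \<tau> 1 = xt \<tau> 0" "yt \<tau> 1 = yt \<tau> 0"
      using x' y' by blast+
    then show "burkholder m (x \<tau> 1) (y \<tau> 1) = burkholder m (x \<tau> 0) (y \<tau> 0)"
      "U1 x xt y yt \<tau> 1 = U1 x xt y yt \<tau> 0" by (simp_all add: U1_def)
  qed (use x' y' in blast)+
  then show ?thesis
  proof (rule integral_Laplacian_nonpos[OF _ _ _ \<open>0 \<le> \<tau>\<close>])
    fix \<tau> t :: real
    define s where "s = x \<tau> t + y \<tau> t"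
    have "exp (m + 1) \<le> s" using pos(1)[of \<tau> t] pos(2)[of \<tau> t] by (simp add: s_def)
    then have L: "real m + 1 \<le> ln s"
      using s0[of \<tau> t] by (simp add: ln_ge_iff s_def add.commute)
    have L0: "0 \<le> ln s" using L by simp
    have \<alpha>: "0 \<le> burkholder_\<alpha> m s"
      using L0 s0[of \<tau> t] by (auto simp: burkholder_\<alpha>_def s_def)
    have \<beta>: "0 \<le> burkholder_\<beta> m s"
    proof (cases m)
      case (Suc n)
      have "real m * real (m + 1) \<le> ln s * ln s" using L by (intro mult_mono) auto
      then have "ln s ^ n * (real m * real (m + 1)) \<le> ln s ^ n * (ln s * ln s)"
        by (intro mult_left_mono) (use L0 in auto)
      then show ?thesis using Suc by (simp add: burkholder_\<beta>_def field_simps)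
    qed (use L0 in \<open>simp add: burkholder_\<beta>_def\<close>)
    have \<kappa>: "0 \<le> burkholder_\<kappa> m s"
    proof (cases "m \<ge> 2")
      case True
      then obtain n where n: "m = n + 2" by (metis add.commute le_iff_add)
      have "real m * real (m - 1) \<le> ln s * ln s" using L by (intro mult_mono) auto
      then have "real m * real (m - 1) * ln s ^ n \<le> (ln s * ln s) * ln s ^ n"
        by (intro mult_right_mono) (use L0 in auto)
      then show ?thesis using n by (simp add: burkholder_\<kappa>_def power2_eq_square field_simps power_add)
    next
      case False
      then have "m = 0 \<or> m = 1" by auto
      then show ?thesis using L0 by (auto simp: burkholder_\<kappa>_def)
    qed
    have "U2 x xa xaa y ya yaa \<tau> t + U2 x xt xtt y yt ytt \<tau> t =
      2 * burkholder_\<alpha> m s * ((y \<tau> t * (yaa \<tau> t + ytt \<tau> t) + (ya \<tau> t)\<^sup>2 + (yt \<tau> t)\<^sup>2)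
         - (x \<tau> t * (xaa \<tau> t + xtt \<tau> t) + (xa \<tau> t)\<^sup>2 + (xt \<tau> t)\<^sup>2))
      - burkholder_\<beta> m s * (xaa \<tau> t + xtt \<tau> t)
      - burkholder_\<kappa> m s * (y \<tau> t * (((xa \<tau> t + ya \<tau> t) / s)\<^sup>2 + ((xt \<tau> t + yt \<tau> t) / s)\<^sup>2))"
      unfolding U2_def s_def[symmetric] by (simp add: algebra_simps)
    also have "\<dots> \<le> 0 - 0 - 0"
      using sub[of \<tau> t] \<alpha> \<beta> \<kappa> less_imp_le[OF pos(2)[of \<tau> t]]
      by (intro diff_mono mult_nonneg_nonneg mult_nonneg_nonpos sub(1)) auto
    finally show "U2 x xa xaa y ya yaa \<tau> t + U2 x xt xtt y yt ytt \<tau> t \<le> 0" by simp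
  next
    \<comment> \<open>The upper bound \<open>R\<close> controls the negative term of
      \<open>burkholder\<close> crudely; some lower bound is what keeps the circle mean from
      decreasing.\<close>
    fix \<tau> t :: real assume "0 \<le> \<tau>"
    have "exp (m + 1) \<le> x \<tau> t + y \<tau> t" using pos(1)[of \<tau> t] pos(2)[of \<tau> t] by simp
    then have L: "real m + 1 \<le> ln (x \<tau> t + y \<tau> t)"
      using s0[of \<tau> t] by (simp add: ln_ge_iff add.commute)
    have L2: "ln (x \<tau> t + y \<tau> t) \<le> ln (2 * R)"
      using bd[OF \<open>0 \<le> \<tau>\<close>, of t] s0[of \<tau> t] by (intro ln_mono) auto
    have "x \<tau> t * ln (x \<tau> t + y \<tau> t) ^ (m + 1) / (real m + 1) \<le> R * ln (2 * R) ^ (m + 1) / (real m + 1)"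
      using bd[OF \<open>0 \<le> \<tau>\<close>, of t] L L2 x0[of \<tau> t] by (intro divide_right_mono mult_mono power_mono) auto
    moreover have "0 \<le> y \<tau> t * ln (x \<tau> t + y \<tau> t) ^ m"
      using L pos(2)[of \<tau> t] by auto
    ultimately show "- (R * ln (2 * R) ^ (m + 1) / (real m + 1)) \<le> burkholder m (x \<tau> t) (y \<tau> t)"
      by (simp add: burkholder_def)
  qed
qed


text \<open>The terminal condition far up the cylinder, where \<open>x\<close> and \<open>y\<close>
  are close to constants with \<open>y \<le> 2 x\<close>: the logarithm is at least
  \<open>2 (m + 1)\<close>, so the negative term wins.\<close>

lemma burkholder_nonpos:
  assumes "exp (2 * (real m + 1)) \<le> x" "0 < y" "y \<le> 2 * x"
  shows "burkholder m x y \<le> 0"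
proof -
  have "0 < x" using assms(1) by (meson exp_gt_zero less_le_trans)
  have L: "2 * (real m + 1) \<le> ln (x + y)"
    using assms \<open>0 < x\<close> by (simp add: ln_ge_iff)
  then have L0: "0 \<le> ln (x + y)" by (meson add_nonneg_nonneg mult_nonneg_nonneg of_nat_0_le_iff order_trans zero_le_numeral zero_le_one)
  have "y * ln (x + y) ^ m \<le> (2 * x) * ln (x + y) ^ m"
    using assms L0 by (intro mult_right_mono) auto
  also have "\<dots> = x * (2 * (real m + 1) * ln (x + y) ^ m) / (real m + 1)"
    by (simp add: field_simps)
  also have "\<dots> \<le> x * (ln (x + y) * ln (x + y) ^ m) / (real m + 1)"
    using L L0 \<open>0 < x\<close> by (intro divide_right_mono mult_left_mono mult_right_mono) auto
  finally show ?thesis by (simp add: burkholder_def)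
qed

text \<open>The function \<open>\<Psi>\<^sub>m\<close> of the overview, without the root.\<close>

definition llog :: "nat \<Rightarrow> real \<Rightarrow> real" where
  "llog m x = x * ln x ^ m"

text \<open>For \<open>y \<le> x^2\<close> the sum \<open>x + y\<close> is at most
  \<open>x^3\<close>, which gives the factor \<open>3 ^ (m + 1)\<close>. Otherwise
  \<open>x < sqrt y\<close> while \<open>ln (x + y) \<le> sqrt y / 2\<close>, and the term with
  \<open>y / 2\<close> absorbs everything. The threshold 64 makes
  \<open>4 * sqrt z \<le> z / 2\<close> for \<open>z = sqrt y\<close>.\<close>

lemma burkholder_Young:
  fixes x y :: real
  assumes x: "64 \<le> x" and y: "0 < y"
  shows "x * ln (x + y) ^ (m + 1) \<le> y * ln (x + y) ^ m / 2 + 3 ^ (m + 1) * llog (m + 1) x"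
proof (cases "y \<le> x\<^sup>2")
  case True
  have "x + y \<le> x ^ 3"
  proof -
    have "1 * x \<le> x * x" by (rule mult_right_mono) (use x in auto)
    then have "x + y \<le> x * x + x * x"
      using True by (simp add: power2_eq_square)
    also have "\<dots> = 2 * (x * x)" by simp
    also have "\<dots> \<le> x * (x * x)" using x by (intro mult_right_mono) auto
    finally show ?thesis by (simp add: power3_eq_cube mult.assoc)
  qed
  then have "ln (x + y) \<le> ln (x ^ 3)" using x y by (intro ln_mono) auto
  then have "ln (x + y) \<le> 3 * ln x" using x by (simp add: ln_realpow)
  moreover have L0: "0 \<le> ln (x + y)" using x y by (intro ln_ge_zero) auto
  ultimately have "ln (x + y) ^ (m + 1) \<le> (3 * ln x) ^ (m + 1)" by (intro power_mono)
  then have "x * ln (x + y) ^ (m + 1) \<le> 3 ^ (m + 1) * llog (m + 1) x"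
    using x by (simp add: llog_def power_mult_distrib mult_ac)
  moreover have "0 \<le> y * ln (x + y) ^ m / 2" using y L0 by simp
  ultimately show ?thesis by linarith
next
  case False
  define z where "z = sqrt y"
  have z2: "z * z = y" using y by (simp add: z_def)
  have "x * x < z * z" using False z2 by (simp add: power2_eq_square)
  then have "x < z" using y by (metis real_sqrt_ge_0_iff less_imp_le mult_mono not_less x z_def order_trans zero_le_numeral)
  then have z: "64 < z" using x by simp
  have L0: "0 \<le> ln (x + y)" using x y by (intro ln_ge_zero) auto
  have "ln (x + y) \<le> ln (2 * (z * z))"
  proof (rule ln_mono)
    have "1 * z \<le> z * z" by (rule mult_right_mono) (use z in auto)
    then have "x \<le> z * z" using \<open>x < z\<close> by simp
    then show "x + y \<le> 2 * (z * z)" using z2 by simp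
  qed (use x y in auto)
  also have "\<dots> = ln 2 + 4 * ln (sqrt z)"
    using z by (simp add: ln_mult ln_sqrt)
  also have "\<dots> \<le> 1 + 4 * (sqrt z - 1)"
    using ln_le_minus_one[of "2::real"] ln_le_minus_one[of "sqrt z"] z by simp
  also have "\<dots> \<le> 4 * sqrt z" by simp
  also have "\<dots> \<le> z / 2"
  proof -
    have "sqrt 64 \<le> sqrt z" using z by (intro real_sqrt_le_mono) simp
    then have "8 * sqrt z \<le> sqrt z * sqrt z" by (intro mult_right_mono) (use z in auto)
    then show ?thesis using z by simp
  qed
  finally have "x * ln (x + y) \<le> z * (z / 2)"
    using \<open>x < z\<close> x L0 z by (intro mult_mono) auto
  then have "x * ln (x + y) \<le> y / 2" using z2 by simp
  then have "x * ln (x + y) * ln (x + y) ^ m \<le> y / 2 * ln (x + y) ^ m"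
    by (intro mult_right_mono) (use L0 in auto)
  moreover have "0 \<le> llog (m + 1) x" using x by (auto simp: llog_def)
  then have "0 \<le> 3 ^ (m + 1) * llog (m + 1) x" by simp
  ultimately have "x * ln (x + y) * ln (x + y) ^ m \<le> y / 2 * ln (x + y) ^ m + 3 ^ (m + 1) * llog (m + 1) x"
    by linarith
  then show ?thesis by (simp add: mult.assoc)
qed

text \<open>Superharmonicity compares height 0 with a height where \<open>burkholder\<close> is
  nonpositive, so its integral at height 0 is nonpositive as well. \<open>burkholder_Young\<close>
  then absorbs half of the left side, which doubles the constant.\<close>

lemma burkholder_integral_bound:
  assumes x: "cylinder_smooth x xa xaa xt xtt" and y: "cylinder_smooth y ya yaa yt ytt"
    and pos: "\<And>\<tau> t. exp (2 * (real m + 1)) \<le> x \<tau> t" "\<And>\<tau> t. 64 \<le> x \<tau> t" "\<And>\<tau> t. 0 < y \<tau> t"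
    and sub: "\<And>\<tau> t. 0 \<le> xaa \<tau> t + xtt \<tau> t"
     "\<And>\<tau> t. y \<tau> t * (yaa \<tau> t + ytt \<tau> t) + (ya \<tau> t)\<^sup>2 + (yt \<tau> t)\<^sup>2
         \<le> x \<tau> t * (xaa \<tau> t + xtt \<tau> t) + (xa \<tau> t)\<^sup>2 + (xt \<tau> t)\<^sup>2"
    and bd: "\<And>\<tau> t. 0 \<le> \<tau> \<Longrightarrow> x \<tau> t \<le> R"  "\<And>\<tau> t. 0 \<le> \<tau> \<Longrightarrow> y \<tau> t \<le> R"
    and "0 \<le> \<tau>" and yx: "\<And>t. y \<tau> t \<le> 2 * x \<tau> t"
  shows "integral {0..1} (\<lambda>t. y 0 t * ln (x 0 t + y 0 t) ^ m) \<le>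
         2 * 3 ^ (m + 1) * integral {0..1} (\<lambda>t. llog (m + 1) (x 0 t))"
proof -
  have x0: "0 < x \<tau> t" for \<tau> t using pos(2)[of \<tau> t] by simp
  have nz: "x \<tau> t + y \<tau> t \<noteq> 0" "x \<tau> t \<noteq> 0" for \<tau> t using x0[of \<tau> t] pos(3)[of \<tau> t] by linarith+
  have cx: "continuous_on {0..1} (x \<tau>)" and cy: "continuous_on {0..1} (y \<tau>)" for \<tau>
    using x y unfolding cylinder_smooth_def by (blast intro: continuous_on_curry_snd)+
  have pos1: "exp (real (m + 1)) \<le> x \<tau> t" for \<tau> t
  proof -
    have "exp (real (m + 1)) \<le> exp (2 * (real m + 1))" by simp
    then show ?thesis using pos(1)[of \<tau> t] by linarith
  qed
  have int: "(\<lambda>t. burkholder m (x \<tau> t) (y \<tau> t)) integrable_on {0..1}"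
    "(\<lambda>t. y \<tau> t * ln (x \<tau> t + y \<tau> t) ^ m) integrable_on {0..1}"
    "(\<lambda>t. llog (m + 1) (x \<tau> t)) integrable_on {0..1}" for \<tau>
    unfolding burkholder_def llog_def
    by (intro integrable_continuous_interval continuous_intros cx cy; simp add: nz)+
  define F G where "F = integral {0..1} (\<lambda>t. y 0 t * ln (x 0 t + y 0 t) ^ m)"
    and "G = integral {0..1} (\<lambda>t. llog (m + 1) (x 0 t))"
  have "integral {0..1} (\<lambda>t. burkholder m (x 0 t) (y 0 t)) \<le>
         integral {0..1} (\<lambda>t. burkholder m (x \<tau> t) (y \<tau> t))"
    by (rule burkholder_superharmonic[OF x y pos1 pos(3) sub bd \<open>0 \<le> \<tau>\<close>])
  also have "\<dots> \<le> integral {0..1} (\<lambda>t::real. 0::real)"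
    by (rule Henstock_Kurzweil_Integration.integral_le[OF int(1) integrable_0])
      (rule burkholder_nonpos[OF pos(1) pos(3) yx])
  also have "\<dots> = 0" by simp
  finally have 1: "integral {0..1} (\<lambda>t. burkholder m (x 0 t) (y 0 t)) \<le> 0" .
  have int': "(\<lambda>t. y 0 t * ln (x 0 t + y 0 t) ^ m - (y 0 t * ln (x 0 t + y 0 t) ^ m / 2 + 3 ^ (m + 1) * llog (m + 1) (x 0 t))) integrable_on {0..1}"
    unfolding llog_def by (intro integrable_continuous_interval continuous_intros cx cy; simp add: nz)
  have "integral {0..1} (\<lambda>t. y 0 t * ln (x 0 t + y 0 t) ^ m - (y 0 t * ln (x 0 t + y 0 t) ^ m / 2 + 3 ^ (m + 1) * llog (m + 1) (x 0 t)))
     \<le> integral {0..1} (\<lambda>t. burkholder m (x 0 t) (y 0 t))"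
  proof (rule Henstock_Kurzweil_Integration.integral_le[OF int' int(1)])
    fix t :: real
    have L0: "0 \<le> ln (x 0 t + y 0 t)" using pos(2,3)[of 0 t] by (intro ln_ge_zero) simp
    have "x 0 t * ln (x 0 t + y 0 t) ^ (m + 1) / (real m + 1) \<le> x 0 t * ln (x 0 t + y 0 t) ^ (m + 1) / 1"
      using x0[of 0 t] L0 by (intro divide_left_mono) auto
    also have "\<dots> \<le> y 0 t * ln (x 0 t + y 0 t) ^ m / 2 + 3 ^ (m + 1) * llog (m + 1) (x 0 t)"
      using burkholder_Young[OF pos(2,3)] by simp
    finally show "y 0 t * ln (x 0 t + y 0 t) ^ m - (y 0 t * ln (x 0 t + y 0 t) ^ m / 2 + 3 ^ (m + 1) * llog (m + 1) (x 0 t))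
      \<le> burkholder m (x 0 t) (y 0 t)"
      by (simp add: burkholder_def)
  qed
  moreover have "integral {0..1} (\<lambda>t. y 0 t * ln (x 0 t + y 0 t) ^ m - (y 0 t * ln (x 0 t + y 0 t) ^ m / 2 + 3 ^ (m + 1) * llog (m + 1) (x 0 t)))
     = F - (F / 2 + 3 ^ (m + 1) * G)"
    unfolding F_def G_def
    by (intro integral_unique has_integral_diff has_integral_add has_integral_divide has_integral_mult_right integrable_integral int)
  ultimately have "F \<le> 2 * 3 ^ (m + 1) * G" using 1 by linarith
  then show ?thesis by (simp add: F_def G_def)
qed

section \<open>Green's formula for \<open>llog\<close> of a subharmonic function\<close>

lemma DERIV_llog:
  assumes "(f has_real_derivative f') (at r)" "0 < f r"
  shows "((\<lambda>r. llog m (f r)) has_real_derivative (ln (f r) ^ m + m * ln (f r) ^ (m - 1)) * f') (at r)"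
proof -
  have "((\<lambda>r. f r * ln (f r) ^ m) has_real_derivative
      f' * ln (f r) ^ m + (m * ln (f r) ^ (m - 1) * (f' / f r)) * f r) (at r)"
    by (intro DERIV_mult DERIV_ln_power assms)
  then show ?thesis unfolding llog_def
    by (rule DERIV_cong) (use assms in \<open>simp add: algebra_simps\<close>)
qed

lemma DERIV_llog':
  assumes f: "(f has_real_derivative f1 r) (at r)" and f1: "(f1 has_real_derivative f2) (at r)" and "0 < f r"
  shows "((\<lambda>r. (ln (f r) ^ m + m * ln (f r) ^ (m - 1)) * f1 r) has_real_derivative
     (ln (f r) ^ m + m * ln (f r) ^ (m - 1)) * f2 +
     (m * ln (f r) ^ (m - 1) + m * (real (m - 1) * ln (f r) ^ (m - 1 - 1))) / f r * (f1 r)\<^sup>2) (at r)"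
proof -
  have "((\<lambda>r. (ln (f r) ^ m + m * ln (f r) ^ (m - 1)) * f1 r) has_real_derivative
     (m * ln (f r) ^ (m - 1) * (f1 r / f r) + m * (real (m - 1) * ln (f r) ^ (m - 1 - 1) * (f1 r / f r))) * f1 r
     + f2 * (ln (f r) ^ m + m * ln (f r) ^ (m - 1))) (at r)"
    by (intro DERIV_mult DERIV_add DERIV_cmult DERIV_ln_power assms)
  then show ?thesis
    by (rule DERIV_cong) (use assms in \<open>simp add: field_simps power2_eq_square\<close>)
qed

text \<open>By the chain rule the Laplacian of \<open>llog m x\<close> is at least
  \<open>ln x ^ m\<close> times that of \<open>x\<close>, since \<open>x \<ge> 1\<close> makes the
  remaining terms nonnegative. The function \<open>h\<close> stands for a quantity dominated by
  \<open>x\<close> times its Laplacian, later the squared height derivative.\<close>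

lemma llog_weighted_energy:
  assumes x: "cylinder_smooth x xa xaa xt xtt"
    and pos: "\<And>\<tau> t. 1 \<le> x \<tau> t"
    and bd: "\<And>\<tau> t. 0 \<le> \<tau> \<Longrightarrow> x \<tau> t \<le> R"
    and h: "continuous_on UNIV (\<lambda>z. h (fst z) (snd z))"
      "\<And>\<tau> t. 0 \<le> h \<tau> t" "\<And>\<tau> t. h \<tau> t \<le> x \<tau> t * (xaa \<tau> t + xtt \<tau> t)"
    and "0 \<le> T"
  shows "integral {0..1} (\<lambda>t. integral {0..T} (\<lambda>\<tau>. \<tau> * (h \<tau> t * ln (x \<tau> t) ^ m / x \<tau> t)))
         \<le> integral {0..1} (\<lambda>t. llog m (x 0 t))"
proof -
  have nz: "x \<tau> t \<noteq> 0" "0 < x \<tau> t" for \<tau> t using pos[of \<tau> t] by auto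
  note x' = x[unfolded cylinder_smooth_def]
  define V1 where "V1 = (\<lambda>x1 \<tau> t. (ln (x \<tau> t) ^ m + m * ln (x \<tau> t) ^ (m - 1)) * (x1 \<tau> t :: real))"
  define V2 where "V2 = (\<lambda>x1 x2 \<tau> t. (ln (x \<tau> t) ^ m + m * ln (x \<tau> t) ^ (m - 1)) * (x2 \<tau> t :: real) +
     (m * ln (x \<tau> t) ^ (m - 1) + m * (real (m - 1) * ln (x \<tau> t) ^ (m - 1 - 1))) / x \<tau> t * (x1 \<tau> t)\<^sup>2)"
  have cx: "continuous_on UNIV (\<lambda>z. x (fst z) (snd z))" using x' by blast
  have cl: "continuous_on UNIV (\<lambda>z. ln (x (fst z) (snd z)) ^ k)" for k
    by (intro continuous_intros cx) (simp_all add: nz)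
  have cV: "continuous_on UNIV (\<lambda>z. llog m (x (fst z) (snd z)))"
    unfolding llog_def by (intro continuous_on_mult cx cl)
  have cV1: "continuous_on UNIV (\<lambda>z. V1 x1 (fst z) (snd z))"
    if "continuous_on UNIV (\<lambda>z. x1 (fst z) (snd z))" for x1
    unfolding V1_def by (intro continuous_on_mult continuous_on_add continuous_on_const cx cl that)
  have cV2: "continuous_on UNIV (\<lambda>z. V2 x1 x2 (fst z) (snd z))"
    if "continuous_on UNIV (\<lambda>z. x1 (fst z) (snd z))" "continuous_on UNIV (\<lambda>z. x2 (fst z) (snd z))" for x1 x2
    unfolding V2_def
    by (intro continuous_on_mult continuous_on_add continuous_on_const continuous_on_divide
        continuous_on_power cx cl that) (simp add: nz)
  have V: "cylinder_smooth (\<lambda>\<tau> t. llog m (x \<tau> t)) (V1 xa) (V2 xa xaa) (V1 xt) (V2 xt xtt)"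
    unfolding cylinder_smooth_def
  proof (intro conjI allI cV cV1 cV2)
    fix \<tau> t
    show "((\<lambda>\<tau>. llog m (x \<tau> t)) has_real_derivative V1 xa \<tau> t) (at \<tau>)"
      unfolding V1_def by (rule DERIV_llog) (use x' nz in blast)+
    show "((\<lambda>\<tau>. V1 xa \<tau> t) has_real_derivative V2 xa xaa \<tau> t) (at \<tau>)"
      unfolding V1_def V2_def by (rule DERIV_llog') (use x' nz in blast)+
    show "((\<lambda>t. llog m (x \<tau> t)) has_real_derivative V1 xt \<tau> t) (at t)"
      unfolding V1_def by (rule DERIV_llog) (use x' nz in blast)+
    show "(V1 xt \<tau> has_real_derivative V2 xt xtt \<tau> t) (at t)"
      unfolding V1_def V2_def by (rule DERIV_llog') (use x' nz in blast)+
    have "x \<tau> 1 = x \<tau> 0" "xt \<tau> 1 = xt \<tau> 0"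
      using x' by blast+
    then show "llog m (x \<tau> 1) = llog m (x \<tau> 0)"
      "V1 xt \<tau> 1 = V1 xt \<tau> 0" by (simp_all add: V1_def)
  qed (use x' in blast)+
  have L0: "0 \<le> ln (x \<tau> t)" for \<tau> t using pos[of \<tau> t] by simp
  have xL: "0 \<le> xaa \<tau> t + xtt \<tau> t" for \<tau> t
    using order_trans[OF h(2,3)[of \<tau> t]] nz[of \<tau> t] by (simp add: zero_le_mult_iff)
  have Lap: "h \<tau> t * ln (x \<tau> t) ^ m / x \<tau> t \<le> V2 xa xaa \<tau> t + V2 xt xtt \<tau> t" for \<tau> t
  proof -
    have "h \<tau> t * ln (x \<tau> t) ^ m / x \<tau> t \<le> (x \<tau> t * (xaa \<tau> t + xtt \<tau> t)) * ln (x \<tau> t) ^ m / x \<tau> t"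
      using nz[of \<tau> t] L0[of \<tau> t] by (intro divide_right_mono mult_right_mono h) auto
    also have "\<dots> = ln (x \<tau> t) ^ m * (xaa \<tau> t + xtt \<tau> t)" using nz[of \<tau> t] by simp
    also have "\<dots> \<le> (ln (x \<tau> t) ^ m + m * ln (x \<tau> t) ^ (m - 1)) * (xaa \<tau> t + xtt \<tau> t)"
      using L0[of \<tau> t] xL[of \<tau> t] by (intro mult_right_mono) auto
    also have "\<dots> \<le> (ln (x \<tau> t) ^ m + m * ln (x \<tau> t) ^ (m - 1)) * (xaa \<tau> t + xtt \<tau> t)
      + (m * ln (x \<tau> t) ^ (m - 1) + m * (real (m - 1) * ln (x \<tau> t) ^ (m - 1 - 1))) / x \<tau> t * ((xa \<tau> t)\<^sup>2 + (xt \<tau> t)\<^sup>2)"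
      using L0[of \<tau> t] nz[of \<tau> t] by simp
    also have "\<dots> = V2 xa xaa \<tau> t + V2 xt xtt \<tau> t"
      unfolding V2_def by (simp only: distrib_left) 
    finally show ?thesis .
  qed
  have hL0: "0 \<le> h \<tau> t * ln (x \<tau> t) ^ m / x \<tau> t" for \<tau> t
    using h(2)[of \<tau> t] L0[of \<tau> t] nz[of \<tau> t] by simp
  have ch: "continuous_on UNIV (\<lambda>z. h (fst z) (snd z) * ln (x (fst z) (snd z)) ^ m / x (fst z) (snd z))"
    by (intro continuous_on_mult continuous_on_divide h cx cl) (simp add: nz)
  have c\<tau>h: "continuous_on UNIV (\<lambda>z. fst z * (h (fst z) (snd z) * ln (x (fst z) (snd z)) ^ m / x (fst z) (snd z)))"
    by (intro continuous_on_mult[OF _ ch] continuous_intros)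
  have cL: "continuous_on UNIV (\<lambda>z. V2 xa xaa (fst z) (snd z) + V2 xt xtt (fst z) (snd z))"
    by (intro continuous_on_add cV2) (use x' in blast)+
  \<comment> \<open>The height integral is stated on the inside because it is later used pointwise
    in \<open>t\<close>; Green's formula has it outside.\<close>
  have "integral {0..1} (\<lambda>t. integral {0..T} (\<lambda>\<tau>. \<tau> * (h \<tau> t * ln (x \<tau> t) ^ m / x \<tau> t)))
     = integral {0..T} (\<lambda>\<tau>. integral {0..1} (\<lambda>t. \<tau> * (h \<tau> t * ln (x \<tau> t) ^ m / x \<tau> t)))"
    using integral_swap_continuous[of 0 0 T 1 "\<lambda>\<tau> t. \<tau> * (h \<tau> t * ln (x \<tau> t) ^ m / x \<tau> t)"]
      continuous_on_subset[OF c\<tau>h] by (simp add: case_prod_beta')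
  also have "\<dots> = integral {0..T} (\<lambda>\<tau>. \<tau> * integral {0..1} (\<lambda>t. h \<tau> t * ln (x \<tau> t) ^ m / x \<tau> t))"
    by (simp only: integral_mult_right)
  also have "\<dots> \<le> integral {0..T} (\<lambda>\<tau>. \<tau> * integral {0..1} (\<lambda>t. V2 xa xaa \<tau> t + V2 xt xtt \<tau> t))"
  proof (rule Henstock_Kurzweil_Integration.integral_le)
    have *: "continuous_on {0..T} (\<lambda>\<tau>. integral {0..1} (F \<tau>))"
      if "continuous_on UNIV (\<lambda>z. F (fst z) (snd z))" for F :: "real \<Rightarrow> real \<Rightarrow> real"
    proof -
      have "continuous_on {0..T} (\<lambda>\<tau>. integral (cbox 0 1) (F \<tau>))"
        by (rule integral_continuous_on_param) (use continuous_on_subset[OF that] in \<open>simp add: case_prod_beta'\<close>)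
      then show ?thesis by simp
    qed
    show "(\<lambda>\<tau>. \<tau> * integral {0..1} (\<lambda>t. h \<tau> t * ln (x \<tau> t) ^ m / x \<tau> t)) integrable_on {0..T}"
      by (intro integrable_continuous_interval continuous_on_mult continuous_on_id * ch)
    show "(\<lambda>\<tau>. \<tau> * integral {0..1} (\<lambda>t. V2 xa xaa \<tau> t + V2 xt xtt \<tau> t)) integrable_on {0..T}"
      by (intro integrable_continuous_interval continuous_on_mult continuous_on_id * cL)
    fix \<tau> assume "\<tau> \<in> {0..T}"
    have i: "F \<tau> integrable_on {0..1}" if "continuous_on UNIV (\<lambda>z. F (fst z) (snd z))" for F :: "real \<Rightarrow> real \<Rightarrow> real"
      by (intro integrable_continuous_interval continuous_on_curry_snd[OF that])
    show "\<tau> * integral {0..1} (\<lambda>t. h \<tau> t * ln (x \<tau> t) ^ m / x \<tau> t)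
      \<le> \<tau> * integral {0..1} (\<lambda>t. V2 xa xaa \<tau> t + V2 xt xtt \<tau> t)"
      using \<open>\<tau> \<in> {0..T}\<close>
      by (intro mult_left_mono Henstock_Kurzweil_Integration.integral_le[OF i[OF ch] i[OF cL] Lap]) auto
  qed
  also have "\<dots> \<le> integral {0..1} (\<lambda>t. llog m (x 0 t))"
  proof (rule integral_Laplacian_weighted[OF V _ _ _ \<open>0 \<le> T\<close>])
    show "0 \<le> V2 xa xaa \<tau> t + V2 xt xtt \<tau> t" for \<tau> t using order_trans[OF hL0 Lap] .
    show "llog m (x \<tau> t) \<le> llog m R" if "0 \<le> \<tau>" for \<tau> t
    proof -
      have "1 \<le> R" "x \<tau> t \<le> R" using bd[OF that, of t] pos[of \<tau> t] by auto
      then show ?thesis using pos[of \<tau> t] L0[of \<tau> t] nz[of \<tau> t]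
        unfolding llog_def by (intro mult_mono power_mono ln_mono) auto
    qed
    show "0 \<le> llog m (x \<tau> t)" for \<tau> t using pos[of \<tau> t] by (simp add: llog_def)
  qed
  finally show ?thesis .
qed

section \<open>The Poisson kernel and its maximal function\<close>

definition poisson :: "real \<Rightarrow> real \<Rightarrow> real" where
  "poisson s t = (1 - s\<^sup>2) / (cmod (1 - of_real s * cis (2 * pi * t)))\<^sup>2"

lemma cmod_one_minus_cis_ge:
  assumes "0 \<le> s"
  shows "1 - s \<le> cmod (1 - of_real s * cis \<theta>)"
proof -
  have "cmod 1 - cmod (of_real s * cis \<theta>) \<le> cmod (1 - of_real s * cis \<theta>)"
    by (rule norm_triangle_ineq2)
  then show ?thesis using assms by (simp add: norm_mult)
qed

lemma one_minus_cis_nonzero: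
  assumes "0 \<le> s" "s < 1"
  shows "1 - of_real s * cis \<theta> \<noteq> 0"
  using cmod_one_minus_cis_ge[OF assms(1), of \<theta>] assms by auto

lemma poisson_pos: "0 \<le> s \<Longrightarrow> s < 1 \<Longrightarrow> 0 < poisson s t"
  using one_minus_cis_nonzero[of s "2 * pi * t"] by (simp add: poisson_def power_less_one_iff)

lemma poisson_minus: "poisson s (- t) = poisson s t"
proof -
  have "1 - of_real s * cis (2 * pi * - t) = cnj (1 - of_real s * cis (2 * pi * t))"
    by (simp add: cis_cnj)
  then show ?thesis by (metis complex_mod_cnj poisson_def)
qed

lemma continuous_on_poisson:
  assumes "0 \<le> s" "s < 1" "continuous_on S f"
  shows "continuous_on S (\<lambda>x. poisson s (f x))"
  unfolding poisson_def
  by (intro continuous_intros assms(3)) (use one_minus_cis_nonzero[OF assms(1,2)] in simp)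

lemma borel_measurable_poisson:
  assumes "0 \<le> s" "s < 1"
  shows "poisson s \<in> borel_measurable borel"
  by (intro borel_measurable_continuous_onI continuous_on_poisson[OF assms] continuous_on_id)

text \<open>Since \<open>\<rho> - r \<le> 1 - r \<le> |1 - r e|\<close>, passing from
  \<open>r\<close> to \<open>\<rho>\<close> at most doubles the distance in the denominator, hence a
  factor 4; the numerators contribute at most \<open>2 A\<close>.\<close>

lemma poisson_le_poisson:
  assumes "0 \<le> r" "r \<le> \<rho>" "\<rho> < 1" and A: "1 - r \<le> A * (1 - \<rho>)"
  shows "poisson r t \<le> 8 * A * poisson \<rho> t"
proof -
  define e where "e = cis (2 * pi * t)"
  define a b where "a = cmod (1 - of_real r * e)" and "b = cmod (1 - of_real \<rho> * e)"
  have a: "1 - r \<le> a" and b: "1 - \<rho> \<le> b" "0 < b" "0 < a"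
    using cmod_one_minus_cis_ge[of r "2 * pi * t"] cmod_one_minus_cis_ge[of \<rho> "2 * pi * t"] assms
    by (auto simp: a_def b_def e_def)
  have "b = cmod ((1 - of_real r * e) - of_real (\<rho> - r) * e)"
    by (simp add: b_def algebra_simps)
  also have "\<dots> \<le> a + cmod (of_real (\<rho> - r) * e)"
    unfolding a_def by (rule norm_triangle_ineq4)
  also have "\<dots> = a + (\<rho> - r)"
    using assms by (simp only: norm_mult norm_of_real) (simp add: e_def)
  finally have ba: "b \<le> 2 * a" using a assms by linarith
  then have ba2: "b\<^sup>2 \<le> 4 * a\<^sup>2"
    using power_mono[OF ba, of 2] b by (simp add: power_mult_distrib)
  have A0: "0 \<le> A" using A assms by (smt (verit) mult_nonneg_nonneg mult_nonpos_nonneg zero_le_mult_iff)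
  have "1 - r\<^sup>2 = (1 + r) * (1 - r)" by (simp add: power2_eq_square algebra_simps)
  also have "\<dots> \<le> 2 * (1 - r)" using assms by (intro mult_right_mono) auto
  also have "\<dots> \<le> 2 * (A * (1 - \<rho>))" using A by simp
  also have "\<dots> \<le> 2 * A * ((1 + \<rho>) * (1 - \<rho>))"
    using A0 assms mult_right_mono[of 1 "1 + \<rho>" "1 - \<rho>"] by (simp add: mult_left_mono mult.assoc)
  also have "\<dots> = 2 * A * (1 - \<rho>\<^sup>2)" by (simp add: power2_eq_square algebra_simps)
  finally have num: "1 - r\<^sup>2 \<le> 2 * A * (1 - \<rho>\<^sup>2)" .
  have "poisson r t = (1 - r\<^sup>2) / a\<^sup>2" by (simp add: poisson_def a_def e_def)
  also have "\<dots> \<le> (2 * A * (1 - \<rho>\<^sup>2)) / a\<^sup>2" using num by (intro divide_right_mono) auto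
  also have "\<dots> \<le> (2 * A * (1 - \<rho>\<^sup>2)) / (b\<^sup>2 / 4)"
  proof (rule divide_left_mono)
    show "b\<^sup>2 / 4 \<le> a\<^sup>2" using ba2 by simp
    show "0 \<le> 2 * A * (1 - \<rho>\<^sup>2)" using A0 assms by (simp add: power_le_one_iff abs_square_le_1)
    show "0 < a\<^sup>2 * (b\<^sup>2 / 4)" using b by simp
  qed
  also have "\<dots> = 8 * A * poisson \<rho> t" by (simp add: poisson_def b_def e_def)
  finally show ?thesis .
qed

text \<open>Cauchy's formula at \<open>w = s cis (2 \<pi> t)\<close> for \<open>h\<close> times
  \<open>(1 - |w|^2) / (1 - cnj w u)\<close>: this factor is 1 at \<open>u = w\<close>, and on the
  unit circle it turns the Cauchy kernel into the Poisson kernel. On the boundary only continuity is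
  asked of \<open>h\<close>, because the square roots used later may have zeros on the
  circle.\<close>

lemma poisson_formula:
  assumes cont: "continuous_on (cball 0 1) h" and hol: "h holomorphic_on ball 0 1"
    and s: "0 \<le> s" "s < 1"
  shows "((\<lambda>y. of_real (poisson s (t - y)) * h (cis (2 * pi * y))) has_integral h (of_real s * cis (2 * pi * t))) {0..1}"
proof -
  define w where "w = of_real s * cis (2 * pi * t)"
  have nw: "cmod w = s" using s by (simp add: w_def norm_mult)
  have nz: "1 - cnj w * u \<noteq> 0" if "cmod u \<le> 1" for u
  proof
    assume "1 - cnj w * u = 0"
    then have "cmod (cnj w * u) = 1" by simp
    then have "s * cmod u = 1" by (simp add: norm_mult nw)
    moreover have "s * cmod u \<le> s * 1" using that s by (intro mult_left_mono) auto
    ultimately show False using s by simp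
  qed
  define H where "H = (\<lambda>u. h u * (1 - of_real (s\<^sup>2)) / (1 - cnj w * u))"
  have C: "((\<lambda>u. H u / (u - w)) has_contour_integral (2 * of_real pi * \<i> * H w)) (circlepath 0 1)"
  proof (rule Cauchy_integral_circlepath)
    show "continuous_on (cball 0 1) H"
      unfolding H_def by (intro continuous_intros cont) (use nz in auto)
    show "H holomorphic_on ball 0 1"
      unfolding H_def by (intro holomorphic_intros hol) (use nz in auto)
    show "cmod (w - 0) < 1" using nw s by simp
  qed
  have Hw: "H w = h w"
  proof -
    have "cnj w * w = of_real (s\<^sup>2)" using nw
      by (metis complex_norm_square mult.commute of_real_power)
    moreover have "1 - cnj w * w \<noteq> 0" using nz[of w] nw s by simp
    ultimately show ?thesis by (simp add: H_def)
  qed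
  have "((\<lambda>y. H (cis (2 * pi * y)) / (cis (2 * pi * y) - w) * (2 * of_real pi * \<i> * cis (2 * pi * y)))
      has_integral (2 * of_real pi * \<i> * h w)) {0..1}"
    unfolding Hw[symmetric]
    by (rule has_integral_eq[OF _ C[unfolded has_contour_integral_def]])
      (simp add: vector_derivative_circlepath01, simp add: circlepath cis_conv_exp mult_ac)
  then have "((\<lambda>y. 1 / (2 * of_real pi * \<i>) * (H (cis (2 * pi * y)) / (cis (2 * pi * y) - w) * (2 * of_real pi * \<i> * cis (2 * pi * y))))
      has_integral (1 / (2 * of_real pi * \<i>) * (2 * of_real pi * \<i> * h w))) {0..1}"
    by (rule has_integral_mult_right)
  then have "((\<lambda>y. of_real (poisson s (t - y)) * h (cis (2 * pi * y))) has_integral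
      (1 / (2 * of_real pi * \<i>) * (2 * of_real pi * \<i> * h w))) {0..1}"
  proof (rule has_integral_eq[rotated])
    fix y :: real
    define u where "u = cis (2 * pi * y)"
    have nu: "cmod u = 1" "u \<noteq> 0" by (simp_all add: u_def)
    have uu: "u * cnj u = 1" using nu by (metis complex_norm_square mult_1_right one_power2 of_real_1 power_one)
    have "cis (2 * pi * (t - y)) = cis (2 * pi * t) * cnj u"
      by (simp add: u_def cis_cnj cis_mult algebra_simps)
    then have "1 - of_real s * cis (2 * pi * (t - y)) = cnj u * (u - w)"
      using uu by (simp add: w_def algebra_simps)
    then have "cmod (1 - of_real s * cis (2 * pi * (t - y))) = cmod (u - w)"
      using nu by (simp add: norm_mult)
    then have n1: "of_real ((cmod (1 - of_real s * cis (2 * pi * (t - y))))\<^sup>2) = (u - w) * cnj (u - w)"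
      by (simp only: complex_norm_square)
    have n2: "u * ((u - w) * cnj (u - w)) = (u - w) * (1 - cnj w * u)"
      using uu by (simp add: algebra_simps)
    have "of_real (poisson s (t - y)) = (1 - of_real (s\<^sup>2)) / ((u - w) * cnj (u - w))"
      unfolding poisson_def by (simp only: n1 of_real_divide of_real_diff of_real_1)
    also have "\<dots> = (1 - of_real (s\<^sup>2)) * u / (u * ((u - w) * cnj (u - w)))"
      using nu by simp
    finally have P: "of_real (poisson s (t - y)) = (1 - of_real (s\<^sup>2)) * u / ((u - w) * (1 - cnj w * u))"
      by (simp only: n2)
    show "1 / (2 * of_real pi * \<i>) * (H (cis (2 * pi * y)) / (cis (2 * pi * y) - w) * (2 * of_real pi * \<i> * cis (2 * pi * y)))
       = of_real (poisson s (t - y)) * h (cis (2 * pi * y))"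
    proof -
      have c: "1 / c * (X / Y * (c * z)) = X * z / Y" if "c \<noteq> 0" for c X Y z :: complex
        using that by simp
      have "1 / (2 * of_real pi * \<i>) * (H u / (u - w) * (2 * of_real pi * \<i> * u)) = H u * u / (u - w)"
        by (rule c) simp
      also have "\<dots> = of_real (poisson s (t - y)) * h u"
        unfolding P H_def by (simp add: mult_ac)
      finally show ?thesis unfolding u_def .
    qed
  qed
  then show ?thesis by (simp add: w_def)
qed

lemma poisson_integral:
  assumes "0 \<le> s" "s < 1"
  shows "((\<lambda>y. poisson s (t - y)) has_integral 1) {0..1}"
proof -
  have "((\<lambda>y. of_real (poisson s (t - y)) * (1::complex)) has_integral 1) {0..1}"
    by (rule poisson_formula[OF _ _ assms, of "\<lambda>_. 1"]) auto
  from has_integral_Re[OF this] show ?thesis by simp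
qed

text \<open>The Poisson kernel is the real part of the Herglotz kernel
  \<open>(1 + c w) / (1 - c w)\<close>, which has no pole in the closed disc, so
  \<open>poisson_formula\<close> applies to it.\<close>

lemma poisson_convolution:
  assumes r: "0 \<le> r" "r < 1" and s: "0 \<le> s" "s < 1"
  shows "((\<lambda>y. poisson r (t - y) * poisson s (y - x)) has_integral poisson (r * s) (t - x)) {0..1}"
proof -
  define c where "c = of_real s * cis (- (2 * pi * x))"
  define h where "h = (\<lambda>w. (1 + c * w) / (1 - c * w))"
  have nc: "cmod c = s" using s by (simp add: c_def norm_mult)
  have nz: "1 - c * u \<noteq> 0" if "cmod u \<le> 1" for u
  proof
    assume "1 - c * u = 0"
    then have "cmod (c * u) = 1" by simp
    then have "s * cmod u = 1" by (simp add: norm_mult nc)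
    moreover have "s * cmod u \<le> s * 1" using that s by (intro mult_left_mono) auto
    ultimately show False using s by simp
  qed
  have Re_h: "Re (h w) = (1 - (s * cmod w)\<^sup>2) / (cmod (1 - c * w))\<^sup>2" for w
  proof -
    have "h w = (1 + c * w) * cnj (1 - c * w) / of_real ((cmod (1 - c * w))\<^sup>2)"
      unfolding h_def by (rule complex_div_cnj)
    then have "Re (h w) = Re ((1 + c * w) * cnj (1 - c * w)) / (cmod (1 - c * w))\<^sup>2"
      by (metis Re_divide_of_real)
    moreover have "Re ((1 + c * w) * cnj (1 - c * w)) = 1 - (cmod (c * w))\<^sup>2"
      by (simp add: cmod_power2 algebra_simps) (simp add: power2_eq_square algebra_simps)
    ultimately show ?thesis by (simp add: norm_mult nc)
  qed
  have "((\<lambda>y. of_real (poisson r (t - y)) * h (cis (2 * pi * y))) has_integral h (of_real r * cis (2 * pi * t))) {0..1}"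
  proof (rule poisson_formula[OF _ _ r])
    show "continuous_on (cball 0 1) h"
      unfolding h_def by (intro continuous_intros) (use nz in auto)
    show "h holomorphic_on ball 0 1"
      unfolding h_def by (intro holomorphic_intros) (use nz in auto)
  qed
  from has_integral_Re[OF this]
  have "((\<lambda>y. poisson r (t - y) * Re (h (cis (2 * pi * y)))) has_integral Re (h (of_real r * cis (2 * pi * t)))) {0..1}"
    by simp
  moreover have "Re (h (cis (2 * pi * y))) = poisson s (y - x)" for y
  proof -
    have "c * cis (2 * pi * y) = of_real s * cis (2 * pi * (y - x))"
      by (simp add: c_def cis_mult mult.assoc algebra_simps)
    then show ?thesis by (simp add: Re_h poisson_def)
  qed
  moreover have "Re (h (of_real r * cis (2 * pi * t))) = poisson (r * s) (t - x)"
  proof -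
    have e1: "c * (of_real r * cis (2 * pi * t)) = of_real (r * s) * cis (2 * pi * (t - x))"
      by (simp add: c_def cis_mult mult_ac algebra_simps)
    have e2: "s * cmod (of_real r * cis (2 * pi * t)) = r * s" using r by (simp add: norm_mult)
    show ?thesis by (simp only: Re_h poisson_def e1 e2)
  qed
  ultimately show ?thesis by simp
qed

section \<open>Poisson averages on the measure space of the circle\<close>

lemma nn_integral_circle:
  assumes F: "continuous_on UNIV F" "\<And>x. 0 \<le> F x"
  shows "(\<integral>\<^sup>+y. ennreal (F y) \<partial>circle) = ennreal (integral {0..1} F)"
proof -
  have b: "F \<in> borel_measurable borel" by (rule borel_measurable_continuous_onI[OF F(1)])
  have "F integrable_on {0..1}"
    by (intro integrable_continuous_interval continuous_on_subset[OF F(1)]) auto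
  then have "(F has_integral integral {0..1} F) {0..1}" by (rule integrable_integral)
  then have "(F has_integral integral {0..1} F) {0..<1}"
  proof (rule has_integral_spike_set_eq[THEN iffD1, rotated -1])
    show "negligible {x \<in> {0..1} - {0..<1}. F x \<noteq> 0}"
      by (rule negligible_subset[of "{1}"]) auto
    have "{x \<in> {0..<1} - {0..1}. F x \<noteq> 0} = {}" by auto
    then show "negligible {x \<in> {0..<1} - {0..1}. F x \<noteq> 0}" by (metis negligible_empty)
  qed
  then have "(\<integral>\<^sup>+x. ennreal (F x) * indicator {0..<1} x \<partial>lborel) = ennreal (integral {0..1} F)"
    using F(2) by (intro nn_integral_has_integral_lebesgue') auto
  then show ?thesis
    unfolding circle_def by (subst nn_integral_restrict_space) (auto simp: b)
qed

lemma sets_circle [measurable_cong]: "sets circle = sets (restrict_space borel {0..<1})"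
  by (simp add: circle_def sets_restrict_space)

lemma measurable_circle: "f \<in> measurable borel M \<Longrightarrow> f \<in> measurable circle M"
  unfolding circle_def by (intro measurable_restrict_space1) simp

lemma emeasure_circle: "emeasure circle (space circle) = 1"
  using nn_integral_circle[of "\<lambda>_. 1"] by simp

interpretation circle: finite_measure circle
  by standard (simp add: emeasure_circle)

definition poisson_op :: "real \<Rightarrow> (real \<Rightarrow> ennreal) \<Rightarrow> real \<Rightarrow> ennreal" where
  "poisson_op s f t = (\<integral>\<^sup>+y. ennreal (poisson s (t - y)) * f y \<partial>circle)"

lemma measurable_poisson_diff:
  assumes "0 \<le> s" "s < 1"
  shows "(\<lambda>z. ennreal (poisson s (fst z - snd z))) \<in> borel_measurable (circle \<Otimes>\<^sub>M circle)"
proof -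
  have [measurable]: "poisson s \<in> borel_measurable borel" by (rule borel_measurable_poisson[OF assms])
  have [measurable]: "(\<lambda>x::real. x) \<in> borel_measurable circle" by (intro measurable_circle) simp
  have "fst \<in> borel_measurable (circle \<Otimes>\<^sub>M circle)" "snd \<in> borel_measurable (circle \<Otimes>\<^sub>M circle)"
    using measurable_compose[OF measurable_fst, of "\<lambda>x. x" circle borel]
      measurable_compose[OF measurable_snd, of "\<lambda>x. x" circle borel] by measurable
  then show ?thesis by measurable
qed

context
  fixes s :: real
  assumes s: "0 \<le> s" "s < 1"
begin

lemma measurable_poisson_kernel [measurable]:
  "(\<lambda>(t, y). ennreal (poisson s (t - y))) \<in> borel_measurable (circle \<Otimes>\<^sub>M circle)"
  using measurable_poisson_diff[OF s] by (simp add: case_prod_beta')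

lemma measurable_poisson_op [measurable]:
  assumes [measurable]: "f \<in> borel_measurable circle"
  shows "poisson_op s f \<in> borel_measurable circle"
  unfolding poisson_op_def by measurable

lemma poisson_op_symmetric:
  assumes [measurable]: "f \<in> borel_measurable circle" "g \<in> borel_measurable circle"
  shows "(\<integral>\<^sup>+t. g t * poisson_op s f t \<partial>circle) = (\<integral>\<^sup>+t. f t * poisson_op s g t \<partial>circle)"
proof -
  have P: "pair_sigma_finite circle circle" by standard
  have "(\<integral>\<^sup>+t. g t * poisson_op s f t \<partial>circle) =
      (\<integral>\<^sup>+t. (\<integral>\<^sup>+y. g t * (ennreal (poisson s (t - y)) * f y) \<partial>circle) \<partial>circle)"
    unfolding poisson_op_def by (intro nn_integral_cong nn_integral_cmult[symmetric]) measurable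
  also have "\<dots> = (\<integral>\<^sup>+y. (\<integral>\<^sup>+t. g t * (ennreal (poisson s (t - y)) * f y) \<partial>circle) \<partial>circle)"
    by (rule pair_sigma_finite.Fubini'[OF P, symmetric]) measurable
  also have "\<dots> = (\<integral>\<^sup>+y. (\<integral>\<^sup>+t. f y * (ennreal (poisson s (y - t)) * g t) \<partial>circle) \<partial>circle)"
    using poisson_minus[of s] by (intro nn_integral_cong) (metis (no_types) minus_diff_eq mult.commute mult.left_commute)
  also have "\<dots> = (\<integral>\<^sup>+t. f t * poisson_op s g t \<partial>circle)"
    unfolding poisson_op_def by (intro nn_integral_cong nn_integral_cmult) measurable
  finally show ?thesis .
qed

lemma nn_integral_poisson: "(\<integral>\<^sup>+y. ennreal (poisson s (t - y)) \<partial>circle) = 1"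
proof (subst nn_integral_circle)
  show "continuous_on UNIV (\<lambda>y. poisson s (t - y))"
    by (intro continuous_on_poisson[OF s] continuous_intros)
  show "ennreal (integral {0..1} (\<lambda>y. poisson s (t - y))) = 1"
    using poisson_integral[OF s] by (simp add: integral_unique)
qed (simp add: poisson_pos[OF s] less_imp_le)

end

lemma poisson_op_comp:
  assumes r: "0 \<le> r" "r < 1" and s: "0 \<le> s" "s < 1" and [measurable]: "f \<in> borel_measurable circle"
  shows "poisson_op r (poisson_op s f) t = poisson_op (r * s) f t"
proof -
  have P: "pair_sigma_finite circle circle" by standard
  note measurable_poisson_kernel[OF r, measurable] measurable_poisson_kernel[OF s, measurable]
  have [measurable]: "(\<lambda>y. ennreal (poisson r (t - y))) \<in> borel_measurable circle"
    using borel_measurable_poisson[OF r, measurable] by (intro measurable_circle) measurable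
  have "poisson_op r (poisson_op s f) t = (\<integral>\<^sup>+y. (\<integral>\<^sup>+x. ennreal (poisson r (t - y)) * (ennreal (poisson s (y - x)) * f x) \<partial>circle) \<partial>circle)"
    unfolding poisson_op_def by (intro nn_integral_cong nn_integral_cmult[symmetric]) measurable
  also have "\<dots> = (\<integral>\<^sup>+x. (\<integral>\<^sup>+y. ennreal (poisson r (t - y)) * (ennreal (poisson s (y - x)) * f x) \<partial>circle) \<partial>circle)"
    by (rule pair_sigma_finite.Fubini'[OF P, symmetric]) measurable
  also have "\<dots> = (\<integral>\<^sup>+x. (\<integral>\<^sup>+y. ennreal (poisson r (t - y) * poisson s (y - x)) * f x \<partial>circle) \<partial>circle)"
    using r s by (intro nn_integral_cong) (simp add: ennreal_mult poisson_pos less_imp_le mult.assoc)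
  also have "\<dots> = (\<integral>\<^sup>+x. (\<integral>\<^sup>+y. ennreal (poisson r (t - y) * poisson s (y - x)) \<partial>circle) * f x \<partial>circle)"
  proof (intro nn_integral_cong nn_integral_multc)
    show "(\<lambda>y. ennreal (poisson r (t - y) * poisson s (y - x))) \<in> borel_measurable circle" for x
      using borel_measurable_poisson[OF r, measurable] borel_measurable_poisson[OF s, measurable]
      by (intro measurable_circle) measurable
  qed
  also have "\<dots> = (\<integral>\<^sup>+x. ennreal (poisson (r * s) (t - x)) * f x \<partial>circle)"
  proof (intro nn_integral_cong arg_cong2[where f = "(*)"] refl)
    fix x
    have "(\<integral>\<^sup>+y. ennreal (poisson r (t - y) * poisson s (y - x)) \<partial>circle) = ennreal (integral {0..1} (\<lambda>y. poisson r (t - y) * poisson s (y - x)))"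
      by (intro nn_integral_circle continuous_on_mult continuous_on_poisson continuous_intros
          mult_nonneg_nonneg less_imp_le poisson_pos r s)
    then show "(\<integral>\<^sup>+y. ennreal (poisson r (t - y) * poisson s (y - x)) \<partial>circle) = ennreal (poisson (r * s) (t - x))"
      by (simp only: integral_unique[OF poisson_convolution[OF r s]])
  qed
  finally show ?thesis by (simp add: poisson_op_def)
qed

text \<open>If \<open>r \<le> s\<close> then \<open>1 - r s \<le> 2 (1 - r)\<close>, so the kernel
  of radius \<open>r s\<close> is dominated by a multiple of the one with the smaller
  radius.\<close>

lemma poisson_mult_le:
  assumes r: "0 \<le> r" "r < 1" and s: "0 \<le> s" "s < 1"
  shows "poisson (r * s) t \<le> 16 * (poisson r t + poisson s t)"
proof -
  have *: "poisson (r * s) t \<le> 8 * 2 * poisson r t" if "r \<le> s" "0 \<le> r" "r < 1" "0 \<le> s" "s < 1" for r s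
  proof (rule poisson_le_poisson)
    show "0 \<le> r * s" using that by simp
    show "r * s \<le> r" using that mult_left_mono[of s 1 r] by simp
    have "r * (1 - s) \<le> 1 * (1 - r)" using that by (intro mult_mono) auto
    then show "1 - r * s \<le> 2 * (1 - r)" by (simp add: algebra_simps)
  qed (use that in auto)
  have "0 \<le> poisson r t" "0 \<le> poisson s t" using assms by (simp_all add: poisson_pos less_imp_le)
  then show ?thesis using *[of r s] *[of s r] assms by (cases "r \<le> s") (auto simp: mult.commute)
qed

lemma poisson_op_mult_le:
  assumes r: "0 \<le> r" "r < 1" and s: "0 \<le> s" "s < 1" and [measurable]: "f \<in> borel_measurable circle"
  shows "poisson_op (r * s) f t \<le> 16 * (poisson_op r f t + poisson_op s f t)"
proof -
  have [measurable]: "(\<lambda>y. ennreal (poisson q (t - y))) \<in> borel_measurable circle" if "0 \<le> q" "q < 1" for q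
    using borel_measurable_poisson[OF that, measurable] by (intro measurable_circle) measurable
  have [measurable]: "(\<lambda>y. ennreal (poisson r (t - y))) \<in> borel_measurable circle" "(\<lambda>y. ennreal (poisson s (t - y))) \<in> borel_measurable circle"
    using r s by simp_all
  have "poisson_op (r * s) f t \<le> (\<integral>\<^sup>+y. 16 * (ennreal (poisson r (t - y)) * f y + ennreal (poisson s (t - y)) * f y) \<partial>circle)"
    unfolding poisson_op_def
  proof (intro nn_integral_mono)
    fix y
    have "ennreal (poisson (r * s) (t - y)) \<le> ennreal (16 * (poisson r (t - y) + poisson s (t - y)))"
      by (intro ennreal_leI poisson_mult_le r s)
    also have "\<dots> = 16 * (ennreal (poisson r (t - y)) + ennreal (poisson s (t - y)))"
      using r s by (simp add: ennreal_mult poisson_pos less_imp_le)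
    finally have "ennreal (poisson (r * s) (t - y)) * f y \<le> 16 * (ennreal (poisson r (t - y)) + ennreal (poisson s (t - y))) * f y"
      by (intro mult_right_mono) auto
    then show "ennreal (poisson (r * s) (t - y)) * f y \<le> 16 * (ennreal (poisson r (t - y)) * f y + ennreal (poisson s (t - y)) * f y)"
      by (simp add: algebra_simps)
  qed
  also have "\<dots> = 16 * (poisson_op r f t + poisson_op s f t)"
    unfolding poisson_op_def by (subst nn_integral_cmult) (simp_all add: nn_integral_add)
  finally show ?thesis .
qed

lemma ennreal_square_le_mult:
  fixes a c :: ennreal
  assumes "a\<^sup>2 \<le> c * a" "a < \<infinity>"
  shows "a \<le> c"
proof (cases "a = 0")
  case False
  then show ?thesis using assms ennreal_mult_le_mult_iff[of a a c]
    by (simp add: power2_eq_square mult.commute less_top)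
qed simp

lemma poisson_op_le_const:
  assumes s: "0 \<le> s" "s < 1" and f: "\<And>t. f t \<le> M"
  shows "poisson_op s f t \<le> M"
proof -
  have [measurable]: "(\<lambda>y. ennreal (poisson s (t - y))) \<in> borel_measurable circle"
    using borel_measurable_poisson[OF s, measurable] by (intro measurable_circle) measurable
  have "poisson_op s f t \<le> (\<integral>\<^sup>+y. ennreal (poisson s (t - y)) * M \<partial>circle)"
    unfolding poisson_op_def by (intro nn_integral_mono mult_left_mono f) auto
  also have "\<dots> = M" by (simp add: nn_integral_multc nn_integral_poisson[OF s])
  finally show ?thesis .
qed

text \<open>
  The maximal operator is linearised by choosing at each point the first radius that attains the
  maximum; \<open>T T\<^sup>*\<close> of the linearised operator is dominated by \<open>T + T\<^sup>*\<close> because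
  \<open>P\<^sub>r P\<^sub>s = P\<^sub>r\<^sub>s \<le> 16 (P\<^sub>r + P\<^sub>s)\<close>.
\<close>

lemma poisson_maximal:
  fixes \<rho> :: "nat \<Rightarrow> real" and K :: nat
  assumes \<rho>: "\<And>k. 0 \<le> \<rho> k" "\<And>k. \<rho> k < 1"
    and f [measurable]: "f \<in> borel_measurable circle" and M: "\<And>t. f t \<le> M" "M < \<infinity>"
  defines "N \<equiv> \<lambda>t. Max ((\<lambda>k. poisson_op (\<rho> k) f t) ` {..K})"
  shows "(\<integral>\<^sup>+t. (N t)\<^sup>2 \<partial>circle) \<le> 1024 * (\<integral>\<^sup>+t. (f t)\<^sup>2 \<partial>circle)"
proof -
  note [measurable] = measurable_poisson_op[OF \<rho>]
  define Pf where "Pf = (\<lambda>k t. poisson_op (\<rho> k) f t)"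
  have [measurable]: "Pf k \<in> borel_measurable circle" for k
    unfolding Pf_def by measurable
  have N: "N t = Max ((\<lambda>k. Pf k t) ` {..K})" for t by (simp add: N_def Pf_def)
  have [measurable]: "N \<in> borel_measurable circle"
    unfolding N by (intro borel_measurable_Max) auto
  define \<kappa> where "\<kappa> = (\<lambda>t. LEAST k. k \<le> K \<and> Pf k t = N t)"
  have [measurable]: "\<kappa> \<in> measurable circle (count_space UNIV)"
    unfolding \<kappa>_def by measurable
  have \<kappa>: "\<kappa> t \<le> K \<and> Pf (\<kappa> t) t = N t" for t
  proof -
    have "N t \<in> (\<lambda>k. Pf k t) ` {..K}" unfolding N by (intro Max_in) auto
    then have "\<exists>k. k \<le> K \<and> Pf k t = N t" by auto
    then show ?thesis unfolding \<kappa>_def by (rule LeastI_ex)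
  qed
  define g where "g = (\<lambda>k t. if \<kappa> t = k then N t else 0)"
  have [measurable]: "g k \<in> borel_measurable circle" for k
    unfolding g_def by measurable
  have sum_g: "(\<Sum>k\<le>K. g k t) = N t" for t
    using \<kappa>[of t] by (simp add: g_def)
  have NM: "N t \<le> M" for t
    using \<kappa>[of t] poisson_op_le_const[of "\<rho> (\<kappa> t)" f M t] \<rho> M(1) by (simp add: Pf_def)
  have gM: "g k t \<le> M" for k t using NM by (simp add: g_def)
  \<comment> \<open>For the linearised operator \<open>T\<close>, which averages at \<open>t\<close>
    with radius \<open>\<rho> (\<kappa> t)\<close> and satisfies \<open>T f = N\<close>, this is
    \<open>T\<^sup>*\<close> applied to \<open>N\<close>.\<close>
  define H where "H = (\<lambda>t. \<Sum>k\<le>K. poisson_op (\<rho> k) (g k) t)"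
  have [measurable]: "H \<in> borel_measurable circle" unfolding H_def by measurable
  have HM: "H t \<le> of_nat (Suc K) * M" for t
  proof -
    have "H t \<le> (\<Sum>k\<le>K. M)" unfolding H_def by (intro sum_mono poisson_op_le_const \<rho> gM)
    then show ?thesis by simp
  qed
  define a b where "a = (\<integral>\<^sup>+t. (N t)\<^sup>2 \<partial>circle)" and "b = (\<integral>\<^sup>+t. (H t)\<^sup>2 \<partial>circle)"
  \<comment> \<open>Finiteness of the two square integrals allows a factor to be cancelled at the
    end; it comes from the bound \<open>M\<close>.\<close>
  have fin: "(\<integral>\<^sup>+t. (F t)\<^sup>2 \<partial>circle) < \<infinity>" if F: "\<And>t. F t \<le> B" "B < \<infinity>" for F B
  proof -
    have "(\<integral>\<^sup>+t. (F t)\<^sup>2 \<partial>circle) \<le> (\<integral>\<^sup>+t. B\<^sup>2 \<partial>circle)"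
      by (intro nn_integral_mono power_mono_ennreal F)
    also have "\<dots> = B\<^sup>2" by (simp add: emeasure_circle)
    also have "\<dots> < \<infinity>" using F(2) by (simp add: power2_eq_square ennreal_mult_less_top)
    finally show ?thesis .
  qed
  have a_fin: "a < \<infinity>" unfolding a_def by (rule fin[OF NM M(2)])
  have b_fin: "b < \<infinity>" unfolding b_def
    by (rule fin[OF HM]) (use M(2) in \<open>simp add: ennreal_mult_less_top ennreal_of_nat_eq_real_of_nat\<close>)
  have "a = (\<integral>\<^sup>+t. f t * H t \<partial>circle)"
  proof -
    have "(N t)\<^sup>2 = (\<Sum>k\<le>K. g k t * Pf k t)" for t
    proof -
      have "(\<Sum>k\<le>K. g k t * Pf k t) = (\<Sum>k\<le>K. g k t * N t)"
        using \<kappa>[of t] by (intro sum.cong) (auto simp: g_def)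
      then show ?thesis by (simp add: sum_g sum_distrib_right[symmetric] power2_eq_square)
    qed
    then have "a = (\<Sum>k\<le>K. (\<integral>\<^sup>+t. g k t * Pf k t \<partial>circle))"
      unfolding a_def by (simp add: nn_integral_sum)
    also have "\<dots> = (\<Sum>k\<le>K. (\<integral>\<^sup>+t. f t * poisson_op (\<rho> k) (g k) t \<partial>circle))"
      unfolding Pf_def by (intro sum.cong refl poisson_op_symmetric \<rho>) measurable
    also have "\<dots> = (\<integral>\<^sup>+t. f t * H t \<partial>circle)"
      unfolding H_def sum_distrib_left by (intro nn_integral_sum[symmetric]) measurable
    finally show ?thesis .
  qed
  then have a2: "a\<^sup>2 \<le> (\<integral>\<^sup>+t. (f t)\<^sup>2 \<partial>circle) * b"
    unfolding b_def using Cauchy_Schwarz_nn_integral[of f circle H] by simp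
  have "b \<le> 32 * (\<integral>\<^sup>+t. N t * H t \<partial>circle)"
  proof -
    define Q where "Q = (\<lambda>j k. (\<integral>\<^sup>+t. g j t * poisson_op (\<rho> k) (g k) t \<partial>circle))"
    have "b = (\<integral>\<^sup>+t. (\<Sum>j\<le>K. \<Sum>k\<le>K. poisson_op (\<rho> j) (g j) t * poisson_op (\<rho> k) (g k) t) \<partial>circle)"
      unfolding b_def H_def by (simp add: power2_eq_square sum_product)
    also have "\<dots> = (\<Sum>j\<le>K. \<Sum>k\<le>K. (\<integral>\<^sup>+t. poisson_op (\<rho> k) (g k) t * poisson_op (\<rho> j) (g j) t \<partial>circle))"
      by (simp add: nn_integral_sum mult.commute)
    also have "\<dots> \<le> (\<Sum>j\<le>K. \<Sum>k\<le>K. 16 * (Q k j + Q j k))"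
    proof (intro sum_mono)
      fix j k
      have "(\<integral>\<^sup>+t. poisson_op (\<rho> k) (g k) t * poisson_op (\<rho> j) (g j) t \<partial>circle)
          = (\<integral>\<^sup>+t. g j t * poisson_op (\<rho> j) (poisson_op (\<rho> k) (g k)) t \<partial>circle)"
        by (intro poisson_op_symmetric \<rho>) measurable
      also have "\<dots> \<le> (\<integral>\<^sup>+t. 16 * (g j t * poisson_op (\<rho> j) (g k) t + g j t * poisson_op (\<rho> k) (g k) t) \<partial>circle)"
      proof (intro nn_integral_mono)
        fix t
        have "g j t * poisson_op (\<rho> j) (poisson_op (\<rho> k) (g k)) t
          \<le> g j t * (16 * (poisson_op (\<rho> j) (g k) t + poisson_op (\<rho> k) (g k) t))"
          unfolding poisson_op_comp[OF \<rho> \<rho> \<open>g k \<in> borel_measurable circle\<close>]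
          by (intro mult_left_mono poisson_op_mult_le \<rho>) measurable
        then show "g j t * poisson_op (\<rho> j) (poisson_op (\<rho> k) (g k)) t
          \<le> 16 * (g j t * poisson_op (\<rho> j) (g k) t + g j t * poisson_op (\<rho> k) (g k) t)"
          by (simp add: algebra_simps)
      qed
      also have "\<dots> = 16 * ((\<integral>\<^sup>+t. g j t * poisson_op (\<rho> j) (g k) t \<partial>circle) + Q j k)"
        unfolding Q_def by (subst nn_integral_cmult) (simp_all add: nn_integral_add)
      also have "(\<integral>\<^sup>+t. g j t * poisson_op (\<rho> j) (g k) t \<partial>circle) = Q k j"
        unfolding Q_def by (intro poisson_op_symmetric \<rho>) measurable
      finally show "(\<integral>\<^sup>+t. poisson_op (\<rho> k) (g k) t * poisson_op (\<rho> j) (g j) t \<partial>circle) \<le> 16 * (Q k j + Q j k)" .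
    qed
    also have "\<dots> = 16 * ((\<Sum>j\<le>K. \<Sum>k\<le>K. Q k j) + (\<Sum>j\<le>K. \<Sum>k\<le>K. Q j k))"
      by (simp add: sum.distrib sum_distrib_left distrib_left)
    also have "(\<Sum>j\<le>K. \<Sum>k\<le>K. Q k j) = (\<Sum>j\<le>K. \<Sum>k\<le>K. Q j k)" by (rule sum.swap)
    also have "16 * ((\<Sum>j\<le>K. \<Sum>k\<le>K. Q j k) + (\<Sum>j\<le>K. \<Sum>k\<le>K. Q j k)) = 32 * (\<Sum>j\<le>K. \<Sum>k\<le>K. Q j k)"
      by (simp flip: mult_2 add: mult.assoc[symmetric])
    also have "(\<Sum>j\<le>K. \<Sum>k\<le>K. Q j k) = (\<integral>\<^sup>+t. (\<Sum>j\<le>K. \<Sum>k\<le>K. g j t * poisson_op (\<rho> k) (g k) t) \<partial>circle)"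
      unfolding Q_def by (simp add: nn_integral_sum)
    also have "\<dots> = (\<integral>\<^sup>+t. N t * H t \<partial>circle)"
      unfolding H_def by (simp flip: sum_g add: sum_product)
    finally show ?thesis .
  qed
  then have "b\<^sup>2 \<le> (32 * (\<integral>\<^sup>+t. N t * H t \<partial>circle))\<^sup>2" by (rule power_mono_ennreal)
  also have "\<dots> = 1024 * (\<integral>\<^sup>+t. N t * H t \<partial>circle)\<^sup>2" by (simp add: power_mult_distrib)
  also have "\<dots> \<le> 1024 * (a * b)"
    unfolding a_def b_def by (intro mult_left_mono Cauchy_Schwarz_nn_integral) auto
  finally have "b \<le> 1024 * a"
    by (intro ennreal_square_le_mult[OF _ b_fin]) (simp add: mult.assoc)
  then have "a\<^sup>2 \<le> (\<integral>\<^sup>+t. (f t)\<^sup>2 \<partial>circle) * (1024 * a)"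
    by (intro order_trans[OF a2] mult_left_mono) auto
  then have "a \<le> 1024 * (\<integral>\<^sup>+t. (f t)\<^sup>2 \<partial>circle)"
    by (intro ennreal_square_le_mult[OF _ a_fin]) (simp add: mult_ac)
  then show ?thesis by (simp add: a_def)
qed

section \<open>Sub-mean value property of convex functions of a root\<close>

text \<open>The origin is included because a zero \<open>a\<close> on the unit circle makes
  \<open>1 - z / a\<close> vanish at a boundary point; continuity at 0 follows from
  \<open>|csqrt w| = sqrt |w|\<close>.\<close>

lemma continuous_on_csqrt_right_half:
  assumes f: "continuous_on S f" and "\<And>z. z \<in> S \<Longrightarrow> 0 < Re (f z) \<or> f z = 0"
  shows "continuous_on S (\<lambda>z. csqrt (f z))"
proof -
  have "continuous_on {w. 0 < Re w \<or> w = 0} csqrt"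
    unfolding continuous_on_eq_continuous_within
  proof
    fix w :: complex assume w: "w \<in> {w. 0 < Re w \<or> w = 0}"
    show "continuous (at w within {w. 0 < Re w \<or> w = 0}) csqrt"
    proof (cases "w = 0")
      case True
      have "((\<lambda>x::complex. sqrt (norm x)) \<longlongrightarrow> sqrt (norm (0::complex))) (at 0 within {w. 0 < Re w \<or> w = 0})"
        by (intro tendsto_intros)
      then have "((\<lambda>x. norm (csqrt x)) \<longlongrightarrow> 0) (at 0 within {w. 0 < Re w \<or> w = 0})" by simp
      then have "(csqrt \<longlongrightarrow> 0) (at 0 within {w. 0 < Re w \<or> w = 0})" by (rule tendsto_norm_zero_cancel)
      then show ?thesis using True by (simp add: continuous_within)
    next
      case False
      then have "w \<notin> \<real>\<^sub>\<le>\<^sub>0" using w by (auto simp: complex_nonpos_Reals_iff)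
      then show ?thesis by (rule continuous_within_csqrt)
    qed
  qed
  then show ?thesis
    by (rule continuous_on_compose2[OF _ f]) (use assms(2) in auto)
qed

text \<open>For \<open>|a| < 1\<close> the factor \<open>z - a\<close> is replaced by its reflection
  \<open>1 - cnj a * z\<close>, and
  \<open>|1 - cnj a * z|^2 - |z - a|^2 = (1 - |a|^2) (1 - |z|^2)\<close> compares the two. For
  \<open>|a| \<ge> 1\<close> the factor is \<open>- a (1 - z / a)\<close>, kept as it is. In both
  cases the values lie in the right half-plane or at 0, where the principal root is
  continuous.\<close>

lemma linear_factor_square_root:
  obtains k where "continuous_on (cball 0 1) k" "k holomorphic_on ball 0 1"
    "\<And>z. cmod z \<le> 1 \<Longrightarrow> cmod (z - a) \<le> (cmod (k z))\<^sup>2"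
    "\<And>z. cmod z = 1 \<Longrightarrow> cmod (z - a) = (cmod (k z))\<^sup>2"
proof (cases "cmod a < 1")
  case True
  define k where "k = (\<lambda>z. csqrt (1 - cnj a * z))"
  have pos: "0 < Re (1 - cnj a * z)" if "cmod z \<le> 1" for z
  proof -
    have "Re (cnj a * z) \<le> cmod (cnj a * z)" by (rule complex_Re_le_cmod)
    also have "\<dots> \<le> cmod a * 1" using that mult_left_mono[of "cmod z" 1 "cmod a"] by (simp add: norm_mult)
    finally show ?thesis using True by simp
  qed
  have id: "(cmod (1 - cnj a * z))\<^sup>2 - (cmod (z - a))\<^sup>2 = (1 - (cmod a)\<^sup>2) * (1 - (cmod z)\<^sup>2)" for z
    by (simp add: cmod_power2 algebra_simps) (simp add: power2_eq_square algebra_simps)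
  have k2: "(cmod (k z))\<^sup>2 = cmod (1 - cnj a * z)" for z by (simp add: k_def)
  show ?thesis
  proof
    show "continuous_on (cball 0 1) k"
      unfolding k_def by (intro continuous_on_csqrt_right_half continuous_intros) (use pos in auto)
    show "k holomorphic_on ball 0 1"
      unfolding k_def
    proof (intro holomorphic_intros)
      fix z :: complex assume "z \<in> ball 0 1"
      then have "0 < Re (1 - cnj a * z)" by (intro pos) auto
      then show "1 - cnj a * z \<notin> \<real>\<^sub>\<le>\<^sub>0" by (metis complex_nonpos_Reals_iff not_le)
    qed
    fix z :: complex
    show "cmod (z - a) \<le> (cmod (k z))\<^sup>2" if "cmod z \<le> 1"
    proof -
      have "0 \<le> (1 - (cmod a)\<^sup>2) * (1 - (cmod z)\<^sup>2)"
        using that True by (intro mult_nonneg_nonneg) (auto simp: power_le_one_iff)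
      then have "(cmod (z - a))\<^sup>2 \<le> (cmod (1 - cnj a * z))\<^sup>2" using id[of z] by linarith
      then show ?thesis unfolding k2 by (rule power2_le_imp_le) simp
    qed
    show "cmod (z - a) = (cmod (k z))\<^sup>2" if "cmod z = 1"
    proof -
      have "(cmod (z - a))\<^sup>2 = (cmod (1 - cnj a * z))\<^sup>2" using id[of z] that by simp
      then show ?thesis unfolding k2 by (rule power2_eq_imp_eq) auto
    qed
  qed
next
  case False
  then have a: "1 \<le> cmod a" "a \<noteq> 0" by auto
  define k where "k = (\<lambda>z. csqrt (- a) * csqrt (1 - z / a))"
  have pos: "0 < Re (1 - z / a) \<or> 1 - z / a = 0" if "cmod z \<le> 1" for z
  proof -
    define v where "v = z / a"
    have v: "cmod v \<le> 1" using that a by (simp add: v_def norm_divide divide_le_eq)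
    have "Re v < 1 \<or> v = 1"
    proof (cases "Re v = 1")
      case True
      have "(Re v)\<^sup>2 + (Im v)\<^sup>2 \<le> 1" using v by (simp flip: cmod_power2 add: power_le_one_iff)
      then show ?thesis using True by (simp add: complex_eq_iff)
    next
      case False
      then show ?thesis using complex_Re_le_cmod[of v] v by linarith
    qed
    then show ?thesis by (auto simp: v_def)
  qed
  have pos': "0 < Re (1 - z / a)" if "cmod z < 1" for z
  proof -
    have "1 - z / a \<noteq> 0" using that a by auto
    then show ?thesis using pos[of z] that by auto
  qed
  have k2: "(cmod (k z))\<^sup>2 = cmod (z - a)" for z
  proof -
    have "(cmod (k z))\<^sup>2 = cmod (- a * (1 - z / a))"
      by (simp add: k_def norm_mult power_mult_distrib)
    also have "- a * (1 - z / a) = z - a" using a by (simp add: algebra_simps)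
    finally show ?thesis .
  qed
  show ?thesis
  proof
    show "continuous_on (cball 0 1) k"
      unfolding k_def by (intro continuous_on_csqrt_right_half continuous_intros) (use a pos in auto)
    show "k holomorphic_on ball 0 1"
      unfolding k_def by (intro holomorphic_intros) (use a pos' in \<open>force simp: complex_nonpos_Reals_iff\<close>)+
  qed (simp_all add: k2)
qed

text \<open>
  Reflecting the zeros inside the disc increases the modulus there, preserves it on the circle, and
  yields a function with a holomorphic square root.
\<close>

lemma poly_square_root_majorant:
  fixes p :: "complex poly"
  shows "\<exists>h. continuous_on (cball 0 1) h \<and> h holomorphic_on ball 0 1 \<and>
    (\<forall>z. cmod z \<le> 1 \<longrightarrow> cmod (poly p z) \<le> (cmod (h z))\<^sup>2) \<and>
    (\<forall>z. cmod z = 1 \<longrightarrow> cmod (poly p z) = (cmod (h z))\<^sup>2)"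
proof (induction "degree p" arbitrary: p)
  case 0
  then obtain c where p: "p = [:c:]" by (metis degree_eq_zeroE)
  show ?case by (rule exI[of _ "\<lambda>_. csqrt c"]) (simp add: p)
next
  case (Suc n)
  have "\<not> constant (poly p)" using Suc(2) by (simp add: constant_degree)
  then obtain a where "poly p a = 0" using fundamental_theorem_of_algebra by blast
  then obtain q where p: "p = [:- a, 1:] * q" by (auto simp: poly_eq_0_iff_dvd dvd_def)
  have "q \<noteq> 0" using Suc(2) p by auto
  then have "degree p = Suc (degree q)" unfolding p by (subst degree_mult_eq) auto
  then obtain h where h: "continuous_on (cball 0 1) h" "h holomorphic_on ball 0 1"
    "\<And>z. cmod z \<le> 1 \<Longrightarrow> cmod (poly q z) \<le> (cmod (h z))\<^sup>2"
    "\<And>z. cmod z = 1 \<Longrightarrow> cmod (poly q z) = (cmod (h z))\<^sup>2"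
    using Suc(1)[of q] Suc(2) by auto
  obtain k where k: "continuous_on (cball 0 1) k" "k holomorphic_on ball 0 1"
    "\<And>z. cmod z \<le> 1 \<Longrightarrow> cmod (z - a) \<le> (cmod (k z))\<^sup>2"
    "\<And>z. cmod z = 1 \<Longrightarrow> cmod (z - a) = (cmod (k z))\<^sup>2"
    using linear_factor_square_root by blast
  have e: "cmod (poly p z) = cmod (z - a) * cmod (poly q z)" for z
    by (simp add: p norm_mult[symmetric] algebra_simps)
  have e2: "(cmod (k z * h z))\<^sup>2 = (cmod (k z))\<^sup>2 * (cmod (h z))\<^sup>2" for z
    by (simp add: norm_mult power_mult_distrib)
  show ?case
  proof (intro exI[of _ "\<lambda>z. k z * h z"] conjI allI impI)
    show "continuous_on (cball 0 1) (\<lambda>z. k z * h z)" by (intro continuous_intros h k)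
    show "(\<lambda>z. k z * h z) holomorphic_on ball 0 1" by (intro holomorphic_intros h k)
    show "cmod (poly p z) \<le> (cmod (k z * h z))\<^sup>2" if "cmod z \<le> 1" for z
      unfolding e e2 using h(3)[OF that] k(3)[OF that] by (intro mult_mono) auto
    show "cmod (poly p z) = (cmod (k z * h z))\<^sup>2" if "cmod z = 1" for z
      unfolding e e2 using h(4)[OF that] k(4)[OF that] by simp
  qed
qed

text \<open>With \<open>h\<close> from \<open>poly_square_root_majorant\<close>, the modulus of
  \<open>h\<close> at the interior point is at most its Poisson average, and Jensen's inequality
  moves \<open>\<psi>\<close> inside; on the circle \<open>h^2\<close> and \<open>p\<close> have
  equal modulus, so nothing is lost there. Convexity of \<open>\<psi>\<close> is expressed by
  supporting lines, the form that Jensen's inequality uses.\<close>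

lemma poisson_submean_scalar:
  fixes p :: "complex poly" and \<psi> :: "real \<Rightarrow> real"
  assumes s: "0 \<le> s" "s < 1"
    and mono: "\<And>v w. 0 \<le> v \<Longrightarrow> v \<le> w \<Longrightarrow> \<psi> v \<le> \<psi> w"
    and tangent: "\<And>c. 0 \<le> c \<Longrightarrow> \<exists>D. \<forall>v\<ge>0. \<psi> c + D * (v - c) \<le> \<psi> v"
    and cont: "continuous_on {0..} \<psi>"
  shows "\<psi> (sqrt (cmod (poly p (of_real s * cis (2 * pi * t)))))
     \<le> integral {0..1} (\<lambda>y. poisson s (t - y) * \<psi> (sqrt (cmod (poly p (cis (2 * pi * y))))))"
proof -
  obtain h where h: "continuous_on (cball 0 1) h" "h holomorphic_on ball 0 1"
    "\<And>z. cmod z \<le> 1 \<Longrightarrow> cmod (poly p z) \<le> (cmod (h z))\<^sup>2"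
    "\<And>z. cmod z = 1 \<Longrightarrow> cmod (poly p z) = (cmod (h z))\<^sup>2"
    using poly_square_root_majorant[of p] by blast
  define z0 where "z0 = of_real s * cis (2 * pi * t)"
  define P where "P = (\<lambda>y. poisson s (t - y))"
  define H where "H = (\<lambda>y. cmod (h (cis (2 * pi * y))))"
  have P0: "0 \<le> P y" for y using s by (simp add: P_def poisson_pos less_imp_le)
  have cP: "continuous_on S P" for S
    unfolding P_def by (intro continuous_on_poisson s continuous_intros)
  have chc: "continuous_on {0..1} (\<lambda>y. h (cis (2 * pi * y)))"
    by (rule continuous_on_compose2[OF h(1)]) (auto intro!: continuous_intros)
  then have cH: "continuous_on {0..1} H"
    unfolding H_def by (intro continuous_on_norm)
  have c\<psi>H: "continuous_on {0..1} (\<lambda>y. \<psi> (H y))"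
    by (rule continuous_on_compose2[OF cont cH]) (auto simp: H_def)
  have int1: "((\<lambda>y. of_real (P y) * h (cis (2 * pi * y))) has_integral h z0) {0..1}"
    unfolding P_def z0_def by (rule poisson_formula[OF h(1,2) s])
  define c where "c = integral {0..1} (\<lambda>y. P y * H y)"
  have iPH: "(\<lambda>y. P y * H y) integrable_on {0..1}"
    by (intro integrable_continuous_interval continuous_on_mult cP cH)
  have "cmod (h z0) = cmod (integral {0..1} (\<lambda>y. of_real (P y) * h (cis (2 * pi * y))))"
    using int1 by (simp add: integral_unique)
  also have "\<dots> \<le> c"
    unfolding c_def
  proof (rule integral_norm_bound_integral)
    show "(\<lambda>y. of_real (P y) * h (cis (2 * pi * y))) integrable_on {0..1}" using int1 by blast
    show "(\<lambda>y. P y * H y) integrable_on {0..1}" by (rule iPH)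
    show "cmod (of_real (P y) * h (cis (2 * pi * y))) \<le> P y * H y" for y
      using P0[of y] by (simp add: norm_mult H_def)
  qed
  finally have hc: "cmod (h z0) \<le> c" .
  have c0: "0 \<le> c" using hc norm_ge_zero order_trans by blast
  obtain D where D: "\<And>v. 0 \<le> v \<Longrightarrow> \<psi> c + D * (v - c) \<le> \<psi> v" using tangent[OF c0] by blast
  have "cmod z0 \<le> 1" using s by (simp add: z0_def norm_mult)
  then have "sqrt (cmod (poly p z0)) \<le> cmod (h z0)"
    using h(3) by (intro real_le_lsqrt) auto
  then have "\<psi> (sqrt (cmod (poly p z0))) \<le> \<psi> c"
    using hc by (intro mono) auto
  also have "\<psi> c = integral {0..1} (\<lambda>y. P y * (\<psi> c + D * (H y - c)))"
  proof -
    have I1: "(P has_integral 1) {0..1}" unfolding P_def by (rule poisson_integral[OF s])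
    have "((\<lambda>y. P y * (\<psi> c - D * c) + D * (P y * H y)) has_integral (1 * (\<psi> c - D * c) + D * c)) {0..1}"
      unfolding c_def
      by (intro has_integral_add has_integral_mult_left has_integral_mult_right I1 integrable_integral iPH)
    then have "((\<lambda>y. P y * (\<psi> c + D * (H y - c))) has_integral \<psi> c) {0..1}"
      by (simp add: algebra_simps)
    then show ?thesis by (simp add: integral_unique)
  qed
  also have "\<dots> \<le> integral {0..1} (\<lambda>y. P y * \<psi> (H y))"
  proof (rule Henstock_Kurzweil_Integration.integral_le)
    show "(\<lambda>y. P y * (\<psi> c + D * (H y - c))) integrable_on {0..1}"
      by (intro integrable_continuous_interval continuous_intros cP cH)
    show "(\<lambda>y. P y * \<psi> (H y)) integrable_on {0..1}"
      by (intro integrable_continuous_interval continuous_on_mult cP c\<psi>H)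
    show "P y * (\<psi> c + D * (H y - c)) \<le> P y * \<psi> (H y)" for y
      by (intro mult_left_mono D P0) (simp add: H_def)
  qed
  also have "(\<lambda>y. P y * \<psi> (H y)) = (\<lambda>y. poisson s (t - y) * \<psi> (sqrt (cmod (poly p (cis (2 * pi * y))))))"
    by (simp add: P_def H_def h(4))
  finally show ?thesis by (simp add: z0_def)
qed

text \<open>
  At a given point the norm of a vector is its inner product with a unit vector; keeping this unit
  vector fixed reduces the vector-valued case to the scalar one.
\<close>

lemma poisson_submean:
  fixes p :: "'i \<Rightarrow> complex poly" and \<psi> :: "real \<Rightarrow> real"
  assumes s: "0 \<le> s" "s < 1"
    and mono: "\<And>v w. 0 \<le> v \<Longrightarrow> v \<le> w \<Longrightarrow> \<psi> v \<le> \<psi> w"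
    and tangent: "\<And>c. 0 \<le> c \<Longrightarrow> \<exists>D. \<forall>v\<ge>0. \<psi> c + D * (v - c) \<le> \<psi> v"
    and cont: "continuous_on {0..} \<psi>"
    and F: "\<And>z. F z = L2_set (\<lambda>i. cmod (poly (p i) z)) I" and F0: "F (of_real s * cis (2 * pi * t)) \<noteq> 0"
  shows "\<psi> (sqrt (F (of_real s * cis (2 * pi * t))))
     \<le> integral {0..1} (\<lambda>y. poisson s (t - y) * \<psi> (sqrt (F (cis (2 * pi * y)))))"
proof -
  define z0 where "z0 = of_real s * cis (2 * pi * t)"
  define v where "v = (\<lambda>i. cnj (poly (p i) z0) / of_real (F z0))"
  define q where "q = (\<Sum>i\<in>I. smult (v i) (p i))"
  have F_nn: "0 \<le> F z" for z by (simp add: F L2_set_nonneg)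
  have F0: "F z0 \<noteq> 0" using F0 by (simp add: z0_def)
  have F2: "(F z)\<^sup>2 = (\<Sum>i\<in>I. (cmod (poly (p i) z))\<^sup>2)" for z
    by (simp add: F L2_set_def sum_nonneg)
  have q: "poly q z = (\<Sum>i\<in>I. v i * poly (p i) z)" for z by (simp add: q_def poly_sum)
  have q0: "poly q z0 = of_real (F z0)"
  proof -
    have "poly q z0 = (\<Sum>i\<in>I. of_real ((cmod (poly (p i) z0))\<^sup>2)) / of_real (F z0)"
      unfolding q sum_divide_distrib v_def times_divide_eq_left
      by (simp only: complex_norm_square mult.commute)
    also have "\<dots> = of_real ((F z0)\<^sup>2) / of_real (F z0)" by (simp add: F2)
    finally show ?thesis using F0 by (simp add: power2_eq_square)
  qed
  have "L2_set (\<lambda>i. cmod (v i)) I = 1"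
  proof -
    have "L2_set (\<lambda>i. cmod (v i)) I = L2_set (\<lambda>i. (1 / F z0) * cmod (poly (p i) z0)) I"
      using F_nn[of z0] by (intro L2_set_cong) (auto simp: v_def norm_divide)
    also have "\<dots> = 1" using F_nn[of z0] F0 by (subst L2_set_right_distrib[symmetric]) (simp_all flip: F)
    finally show ?thesis .
  qed
  then have qF: "cmod (poly q z) \<le> F z" for z
  proof -
    have "cmod (poly q z) \<le> (\<Sum>i\<in>I. \<bar>cmod (v i)\<bar> * \<bar>cmod (poly (p i) z)\<bar>)"
      unfolding q by (intro sum_norm_le) (simp add: norm_mult)
    also have "\<dots> \<le> L2_set (\<lambda>i. cmod (v i)) I * L2_set (\<lambda>i. cmod (poly (p i) z)) I"
      by (rule L2_set_mult_ineq)
    finally show ?thesis using \<open>L2_set (\<lambda>i. cmod (v i)) I = 1\<close> by (simp add: F)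
  qed
  have cF: "continuous_on {0..1} (\<lambda>y. F (cis (2 * pi * y)))"
    unfolding F L2_set_def by (intro continuous_intros)
  have c\<psi>: "continuous_on {0..1} (\<lambda>y. \<psi> (sqrt (G y)))" if "continuous_on {0..1} G" "\<And>y. 0 \<le> G y" for G :: "real \<Rightarrow> real"
    by (rule continuous_on_compose2[OF cont]) (use that in \<open>auto intro!: continuous_intros\<close>)
  have "\<psi> (sqrt (F z0)) = \<psi> (sqrt (cmod (poly q z0)))" using F_nn[of z0] by (simp add: q0)
  also have "\<dots> \<le> integral {0..1} (\<lambda>y. poisson s (t - y) * \<psi> (sqrt (cmod (poly q (cis (2 * pi * y))))))"
    unfolding z0_def by (rule poisson_submean_scalar[OF s mono tangent cont])
  also have "\<dots> \<le> integral {0..1} (\<lambda>y. poisson s (t - y) * \<psi> (sqrt (F (cis (2 * pi * y)))))"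
  proof (rule Henstock_Kurzweil_Integration.integral_le)
    show "(\<lambda>y. poisson s (t - y) * \<psi> (sqrt (cmod (poly q (cis (2 * pi * y)))))) integrable_on {0..1}"
      by (intro integrable_continuous_interval continuous_on_mult continuous_on_poisson s c\<psi> continuous_intros) auto
    show "(\<lambda>y. poisson s (t - y) * \<psi> (sqrt (F (cis (2 * pi * y))))) integrable_on {0..1}"
      by (intro integrable_continuous_interval continuous_on_mult continuous_on_poisson s c\<psi> cF continuous_intros F_nn)
    fix y
    show "poisson s (t - y) * \<psi> (sqrt (cmod (poly q (cis (2 * pi * y))))) \<le> poisson s (t - y) * \<psi> (sqrt (F (cis (2 * pi * y))))"
      by (intro mult_left_mono mono real_sqrt_le_mono qF) (use s in \<open>auto simp: poisson_pos less_imp_le\<close>)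
  qed
  finally show ?thesis by (simp add: z0_def)
qed

text \<open>
  The square of \<open>root_llog m A (sqrt x)\<close> is comparable to \<open>llog m x\<close>.
\<close>

definition root_llog :: "nat \<Rightarrow> real \<Rightarrow> real \<Rightarrow> real" where
  "root_llog m A v = v * ln (A + v) powr (m / 2)"

context
  fixes m :: nat and A :: real
  assumes A: "real m + 4 \<le> A"
begin

lemma root_llog_ln_ge_1: "- 1 \<le> v \<Longrightarrow> 1 \<le> ln (A + v)"
  using A exp_le by (subst ln_ge_iff) auto

lemma root_llog_square: "0 \<le> v \<Longrightarrow> (root_llog m A v)\<^sup>2 = v\<^sup>2 * ln (A + v) ^ m"
  using root_llog_ln_ge_1[of v]
  by (simp add: root_llog_def power_mult_distrib powr_power powr_realpow)

lemma root_llog_nonneg: "0 \<le> v \<Longrightarrow> 0 \<le> root_llog m A v"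
  by (simp add: root_llog_def)

lemma root_llog_mono: "0 \<le> v \<Longrightarrow> v \<le> w \<Longrightarrow> root_llog m A v \<le> root_llog m A w"
  unfolding root_llog_def
  using A root_llog_ln_ge_1[of v] by (intro mult_mono powr_mono2 ln_mono) auto

lemma continuous_on_root_llog: "continuous_on {0..} (root_llog m A)"
  unfolding root_llog_def
proof (intro continuous_intros ballI)
  fix x :: real assume "x \<in> {0..}"
  then show "A + x \<noteq> 0" "ln (A + x) \<noteq> 0" using root_llog_ln_ge_1[of x] A by auto
qed

text \<open>This is convexity in the form that \<open>poisson_submean\<close> asks for. With
  \<open>a = m / 2\<close> and \<open>L = ln (A + v) \<ge> 1\<close>, the second derivative is a
  nonnegative multiple of \<open>2 (A + v) L + v (a - 1) - v L\<close>, which is nonnegative because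
  \<open>A\<close> is large compared with \<open>a\<close>.\<close>

lemma root_llog_tangent:
  assumes c: "0 \<le> c"
  shows "\<exists>D. \<forall>v\<ge>0. root_llog m A c + D * (v - c) \<le> root_llog m A v"
proof -
  define a where "a = real m / 2"
  define f where "f = (\<lambda>v. v * ln (A + v) powr a)"
  define f1 where "f1 = (\<lambda>v. ln (A + v) powr a + v * (a * ln (A + v) powr (a - 1) / (A + v)))"
  define f2 where "f2 = (\<lambda>v. a * ln (A + v) powr (a - 1) / (A + v) +
     (a * ln (A + v) powr (a - 1) / (A + v)
      + v * ((a * ((a - 1) * ln (A + v) powr (a - 2) / (A + v)) * (A + v) - a * ln (A + v) powr (a - 1)) / ((A + v) * (A + v)))))"
  have p: "0 < A + v" "1 \<le> ln (A + v)" "1 < A + v" if "- 1 < v" for v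
    using that A root_llog_ln_ge_1[of v] by auto
  have dpow: "((\<lambda>v. ln (A + v) powr b) has_real_derivative b * ln (A + v) powr (b - 1) / (A + v)) (at v)"
    if "- 1 < v" for v b
    using p[OF that] by (auto intro!: derivative_eq_intros simp: field_simps)
  have d1: "(f has_real_derivative f1 v) (at v)" if v: "- 1 < v" for v
    unfolding f_def f1_def
    by (rule DERIV_cong[OF DERIV_mult[OF DERIV_ident dpow[OF v, of a]]]) (simp add: algebra_simps)
  have d2: "(f1 has_real_derivative f2 v) (at v)" if v: "- 1 < v" for v
  proof -
    have "((\<lambda>v. ln (A + v) powr a + v * ((a * ln (A + v) powr (a - 1)) / (A + v))) has_real_derivative
       a * ln (A + v) powr (a - 1) / (A + v) +
       (1 * (a * ln (A + v) powr (a - 1) / (A + v)) +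
        (a * ((a - 1) * ln (A + v) powr (a - 1 - 1) / (A + v)) * (A + v) - a * ln (A + v) powr (a - 1) * (0 + 1)) / ((A + v) * (A + v)) * v)) (at v)"
      using p[OF v] by (intro DERIV_add DERIV_mult DERIV_divide DERIV_cmult dpow DERIV_ident DERIV_const v) auto
    then show ?thesis unfolding f1_def f2_def by (rule DERIV_cong) (simp add: algebra_simps)
  qed
  have pos: "0 \<le> f2 v" if v: "- 1 < v" for v
  proof -
    define L where "L = ln (A + v)"
    have L: "1 \<le> L" using p[OF v] by (simp add: L_def)
    have B: "0 < A + v" using p[OF v] by simp
    have e: "L powr (a - 1) = L powr (a - 2) * L"
      using L by (simp add: powr_diff power2_eq_square field_simps)
    have "f2 v = a * L powr (a - 2) / (A + v)\<^sup>2 * (2 * (A + v) * L + v * (a - 1) - v * L)"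
    proof -
      have "a * (R * L) / B + (a * (R * L) / B + v * ((a * ((a - 1) * R / B) * B - a * (R * L)) / (B * B)))
        = a * R / B\<^sup>2 * (2 * B * L + v * (a - 1) - v * L)" if "B \<noteq> 0" for R B
        using that by (simp add: field_simps power2_eq_square)
      note gen = this
      have "A + v \<noteq> 0" using B by simp
      from gen[OF this, of "L powr (a - 2)"] show ?thesis
        unfolding f2_def L_def[symmetric] e .
    qed
    moreover have "0 \<le> 2 * (A + v) * L + v * (a - 1) - v * L"
    proof -
      have "2 * (A + v) * L + v * (a - 1) - v * L = (2 * A * L - L - a) + (v + 1) * (L - 1) + (v + 1) * a + 1"
        by (simp add: algebra_simps)
      moreover have "0 \<le> (v + 1) * (L - 1)" "0 \<le> (v + 1) * a" using v L by (simp_all add: a_def)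
      moreover have "2 * A * L - L - a \<ge> 0"
      proof -
        have "a \<le> (2 * A - 1) * 1" using A by (simp add: a_def)
        also have "\<dots> \<le> (2 * A - 1) * L" using A L by (intro mult_left_mono) auto
        finally show ?thesis by (simp add: algebra_simps)
      qed
      ultimately show ?thesis by linarith
    qed
    ultimately show ?thesis by (simp add: a_def)
  qed
  have "convex_on {-1<..} f"
    by (rule f''_ge0_imp_convex[of _ _ f1 f2]) (use d1 d2 pos in auto)
  then have "f1 c * (v - c) \<le> f v - f c" if "0 \<le> v" for v
    by (rule convex_on_imp_above_tangent)
      (use that c d1[of c] in \<open>auto simp: interior_open has_field_derivative_at_within\<close>)
  then show ?thesis
    by (intro exI[of _ "f1 c"]) (auto simp: root_llog_def f_def a_def algebra_simps)
qed

end

section \<open>Vector-valued harmonic functions\<close>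

text \<open>
  Harmonic functions on the half-cylinder \<open>\<tau> \<ge> 0\<close>, \<open>t \<in> \<real>/\<int>\<close>: the coordinate \<open>\<tau>\<close>
  corresponds to the radius \<open>exp (- 2 \<pi> \<tau>)\<close> in the unit disc.
\<close>

definition harmonic :: "int set \<Rightarrow> (int \<Rightarrow> complex) \<Rightarrow> real \<Rightarrow> real \<Rightarrow> complex" where
  "harmonic S c \<tau> t =
     (\<Sum>n\<in>S. c n * exp (of_real (- (2 * pi * \<bar>of_int n\<bar>)) * of_real \<tau> + \<i> * of_real (2 * pi * of_int n) * of_real t))"

text \<open>Derivatives act on the coefficients, so a derivative of a \<open>harmonic\<close> is
  again a \<open>harmonic\<close> and all smoothness reduces to two first-order rules.\<close>

definition coeff_\<tau> :: "(int \<Rightarrow> complex) \<Rightarrow> int \<Rightarrow> complex" where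
  "coeff_\<tau> c n = of_real (- (2 * pi * \<bar>of_int n\<bar>)) * c n"

definition coeff_t :: "(int \<Rightarrow> complex) \<Rightarrow> int \<Rightarrow> complex" where
  "coeff_t c n = \<i> * of_real (2 * pi * of_int n) * c n"

lemma harmonic_deriv_\<tau>:
  "((\<lambda>\<tau>. harmonic S c \<tau> t) has_vector_derivative harmonic S (coeff_\<tau> c) \<tau> t) (at \<tau>)"
proof -
  have "((\<lambda>x. a * exp (w * of_real x + v)) has_vector_derivative (w * a) * exp (w * of_real \<tau> + v)) (at \<tau>)" for a w v :: complex
  proof -
    have "((\<lambda>z. a * exp (w * z + v)) has_field_derivative (w * a) * exp (w * of_real \<tau> + v)) (at (of_real \<tau>))"
      by (auto intro!: derivative_eq_intros)
    then show ?thesis by (rule has_vector_derivative_real_field)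
  qed
  then show ?thesis
    unfolding harmonic_def coeff_\<tau>_def by (intro has_vector_derivative_sum)
qed

lemma harmonic_deriv_t:
  "((\<lambda>t. harmonic S c \<tau> t) has_vector_derivative harmonic S (coeff_t c) \<tau> t) (at t)"
proof -
  have "((\<lambda>x. a * exp (v + w * of_real x)) has_vector_derivative (w * a) * exp (v + w * of_real t)) (at t)" for a w v :: complex
  proof -
    have "((\<lambda>z. a * exp (v + w * z)) has_field_derivative (w * a) * exp (v + w * of_real t)) (at (of_real t))"
      by (auto intro!: derivative_eq_intros)
    then show ?thesis by (rule has_vector_derivative_real_field)
  qed
  then show ?thesis
    unfolding harmonic_def coeff_t_def by (intro has_vector_derivative_sum)
qed

lemma continuous_on_harmonic:
  assumes "continuous_on D f" "continuous_on D g"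
  shows "continuous_on D (\<lambda>z. harmonic S c (f z) (g z))"
  unfolding harmonic_def by (intro continuous_intros assms)

lemma harmonic_periodic: "harmonic S c \<tau> (t + 1) = harmonic S c \<tau> t"
proof -
  have "exp (v + \<i> * of_real (2 * pi * of_int n) * of_real (t + 1)) = exp (v + \<i> * of_real (2 * pi * of_int n) * of_real t)" for v and n :: int
  proof -
    have "v + \<i> * of_real (2 * pi * of_int n) * of_real (t + 1)
      = (v + \<i> * of_real (2 * pi * of_int n) * of_real t) + (2 * of_int n * of_real pi) * \<i>"
      by (simp add: algebra_simps)
    moreover have "exp ((2 * of_int n * of_real pi) * \<i>) = 1" by (auto simp: exp_eq_1)
    ultimately show ?thesis by (simp only: exp_add mult_1_right)
  qed
  then show ?thesis unfolding harmonic_def by (simp only:)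
qed

lemma harmonic_Laplace:
  "harmonic S (coeff_t (coeff_t c)) \<tau> t = - harmonic S (coeff_\<tau> (coeff_\<tau> c)) \<tau> t"
proof -
  have "coeff_t (coeff_t c) n = - coeff_\<tau> (coeff_\<tau> c) n" for n
  proof -
    have "coeff_t (coeff_t c) n = - (of_real ((2 * pi * of_int n) * (2 * pi * of_int n)) * c n)"
      by (simp add: coeff_t_def)
    also have "(2 * pi * of_int n) * (2 * pi * of_int n) = (2 * pi * \<bar>of_int n\<bar>) * (2 * pi * \<bar>of_int n\<bar>)"
      by (simp add: abs_mult_self_eq algebra_simps)
    finally show ?thesis by (simp add: coeff_\<tau>_def)
  qed
  then show ?thesis by (simp add: harmonic_def sum_negf)
qed

text \<open>The Cauchy-Riemann equations: with nonnegative frequencies the function is holomorphic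
  in \<open>t + i \<tau>\<close>.\<close>

lemma harmonic_analytic:
  assumes "\<And>n. n \<in> S \<Longrightarrow> 0 \<le> n"
  shows "harmonic S (coeff_t c) \<tau> t = - \<i> * harmonic S (coeff_\<tau> c) \<tau> t"
  unfolding harmonic_def sum_distrib_left
  by (intro sum.cong refl) (use assms in \<open>simp add: coeff_t_def coeff_\<tau>_def\<close>)

definition energy :: "real \<Rightarrow> 'i set \<Rightarrow> int set \<Rightarrow> ('i \<Rightarrow> int \<Rightarrow> complex) \<Rightarrow> real \<Rightarrow> real \<Rightarrow> real" where
  "energy A I S c \<tau> t = A + (\<Sum>i\<in>I. (cmod (harmonic S (c i) \<tau> t))\<^sup>2)"

text \<open>\<open>D\<close> is \<open>coeff_\<tau>\<close> or \<open>coeff_t\<close> and selects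
  the variable of differentiation; \<open>energy2\<close> is the corresponding pure second
  derivative.\<close>

definition energy1 where
  "energy1 D I S c \<tau> t = 2 * (\<Sum>i\<in>I. Re (harmonic S (c i) \<tau> t * cnj (harmonic S (D (c i)) \<tau> t)))"

definition energy2 where
  "energy2 D I S c \<tau> t = 2 * (\<Sum>i\<in>I. (cmod (harmonic S (D (c i)) \<tau> t))\<^sup>2 +
      Re (harmonic S (c i) \<tau> t * cnj (harmonic S (D (D (c i))) \<tau> t)))"

lemma cylinder_smooth_energy:
  "cylinder_smooth (energy A I S c) (energy1 coeff_\<tau> I S c) (energy2 coeff_\<tau> I S c)
     (energy1 coeff_t I S c) (energy2 coeff_t I S c)"
proof -
  have 1: "((\<lambda>r. (cmod (f r))\<^sup>2) has_real_derivative 2 * Re (f r * cnj f1)) (at r)"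
    if "(f has_vector_derivative f1) (at r)" for f f1 and r :: real
    unfolding cmod_power2 using that
    by (auto intro!: derivative_eq_intros simp: algebra_simps)
  have 2: "((\<lambda>r. Re (f r * cnj (g r))) has_real_derivative Re (f r * cnj g1) + Re (f1 * cnj (g r))) (at r)"
    if "(f has_vector_derivative f1) (at r)" "(g has_vector_derivative g1) (at r)" for f f1 g g1 and r :: real
    using that by (auto intro!: derivative_eq_intros simp: algebra_simps)
  have 3: "((\<lambda>r. 2 * (\<Sum>i\<in>I. Re (f i r * cnj (g i r)))) has_real_derivative
      2 * (\<Sum>i\<in>I. (cmod (g i r))\<^sup>2 + Re (f i r * cnj (g1 i)))) (at r)"
    if "\<And>i. (f i has_vector_derivative g i r) (at r)" "\<And>i. (g i has_vector_derivative g1 i) (at r)" for f g g1 and r :: real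
  proof (intro DERIV_cmult DERIV_sum)
    fix i
    have "Re (g i r * cnj (g i r)) = (cmod (g i r))\<^sup>2"
      by (simp add: cmod_power2) (simp add: power2_eq_square)
    then show "((\<lambda>r. Re (f i r * cnj (g i r))) has_real_derivative
      (cmod (g i r))\<^sup>2 + Re (f i r * cnj (g1 i))) (at r)"
      using 2[OF that(1)[of i] that(2)[of i]] by (simp only: add.commute)
  qed
  have 4: "((\<lambda>r. A + (\<Sum>i\<in>I. (cmod (f i r))\<^sup>2)) has_real_derivative
      2 * (\<Sum>i\<in>I. Re (f i r * cnj (f1 i)))) (at r)"
    if "\<And>i. (f i has_vector_derivative f1 i) (at r)" for f f1 and r :: real
  proof -
    have "((\<lambda>r. A + (\<Sum>i\<in>I. (cmod (f i r))\<^sup>2)) has_real_derivative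
      0 + (\<Sum>i\<in>I. 2 * Re (f i r * cnj (f1 i)))) (at r)"
      by (intro DERIV_add DERIV_const DERIV_sum 1 that)
    then show ?thesis by (simp add: sum_distrib_left)
  qed
  have per: "harmonic S c \<tau> 1 = harmonic S c \<tau> 0" for S c \<tau>
    using harmonic_periodic[of S c \<tau> 0] by simp
  show ?thesis
    unfolding cylinder_smooth_def energy_def energy1_def energy2_def
    by (intro conjI allI 4 3 harmonic_deriv_\<tau> harmonic_deriv_t continuous_on_add continuous_on_mult
        continuous_on_sum continuous_on_power continuous_on_norm continuous_on_Re continuous_on_cnj
        continuous_on_const continuous_on_harmonic continuous_on_fst continuous_on_snd continuous_on_id)
      (simp_all add: per)
qed

lemma energy_pos: "A \<le> energy A I S c \<tau> t"
  by (simp add: energy_def sum_nonneg)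

text \<open>Harmonicity cancels the second-order terms, leaving squared gradients only.\<close>

lemma energy_Laplacian:
  "energy2 coeff_\<tau> I S c \<tau> t + energy2 coeff_t I S c \<tau> t =
     2 * (\<Sum>i\<in>I. (cmod (harmonic S (coeff_\<tau> (c i)) \<tau> t))\<^sup>2 + (cmod (harmonic S (coeff_t (c i)) \<tau> t))\<^sup>2)"
proof -
  have e: "Re (x * cnj (- y)) = - Re (x * cnj y)" for x y by simp
  have "2 * (a + b) + 2 * (c + - b) = 2 * (a + c)" for a b c :: real by simp
  then show ?thesis
    unfolding energy2_def harmonic_Laplace e sum.distrib sum_negf .
qed

lemma sum_Re_mult_le:
  "(\<Sum>i\<in>I. Re (f i * cnj (g i)))\<^sup>2 \<le> (\<Sum>i\<in>I. (cmod (f i))\<^sup>2) * (\<Sum>i\<in>I. (cmod (g i))\<^sup>2)"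
proof -
  have "\<bar>\<Sum>i\<in>I. Re (f i * cnj (g i))\<bar> \<le> (\<Sum>i\<in>I. \<bar>cmod (f i)\<bar> * \<bar>cmod (g i)\<bar>)"
  proof (rule order_trans[OF sum_abs sum_mono])
    fix i
    show "\<bar>Re (f i * cnj (g i))\<bar> \<le> \<bar>cmod (f i)\<bar> * \<bar>cmod (g i)\<bar>"
      using abs_Re_le_cmod[of "f i * cnj (g i)"] by (simp add: norm_mult)
  qed
  also have "\<dots> \<le> L2_set (\<lambda>i. cmod (f i)) I * L2_set (\<lambda>i. cmod (g i)) I" by (rule L2_set_mult_ineq)
  finally have "\<bar>\<Sum>i\<in>I. Re (f i * cnj (g i))\<bar>\<^sup>2 \<le> (L2_set (\<lambda>i. cmod (f i)) I * L2_set (\<lambda>i. cmod (g i)) I)\<^sup>2"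
    by (intro power_mono) auto
  then show ?thesis by (simp add: L2_set_def power_mult_distrib sum_nonneg)
qed

text \<open>Cauchy-Schwarz for each of the two derivatives separately. By
  \<open>sqrt_Laplacian\<close> the factor 2 is exactly what makes the square root of the energy
  subharmonic, with nothing to spare.\<close>

lemma energy_gradient_le:
  assumes "0 \<le> A"
  shows "(energy1 coeff_\<tau> I S c \<tau> t)\<^sup>2 + (energy1 coeff_t I S c \<tau> t)\<^sup>2
    \<le> 2 * energy A I S c \<tau> t * (energy2 coeff_\<tau> I S c \<tau> t + energy2 coeff_t I S c \<tau> t)"
proof -
  define E where "E = (\<Sum>i\<in>I. (cmod (harmonic S (c i) \<tau> t))\<^sup>2)"
  define G where "G = (\<lambda>D. \<Sum>i\<in>I. (cmod (harmonic S (D (c i)) \<tau> t))\<^sup>2)"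
  have "(energy1 D I S c \<tau> t)\<^sup>2 \<le> 4 * (E * G D)" for D
    unfolding energy1_def E_def G_def power_mult_distrib
    using sum_Re_mult_le[of "\<lambda>i. harmonic S (c i) \<tau> t" "\<lambda>i. harmonic S (D (c i)) \<tau> t" I] by simp
  from this[of coeff_\<tau>] this[of coeff_t]
  have "(energy1 coeff_\<tau> I S c \<tau> t)\<^sup>2 + (energy1 coeff_t I S c \<tau> t)\<^sup>2 \<le> 4 * (E * (G coeff_\<tau> + G coeff_t))"
    by (simp add: algebra_simps)
  also have "\<dots> \<le> 4 * ((A + E) * (G coeff_\<tau> + G coeff_t))"
    using assms by (intro mult_left_mono mult_right_mono) (auto simp: G_def sum_nonneg)
  also have "\<dots> = 2 * energy A I S c \<tau> t * (energy2 coeff_\<tau> I S c \<tau> t + energy2 coeff_t I S c \<tau> t)"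
    unfolding energy_Laplacian by (simp add: energy_def E_def G_def sum.distrib algebra_simps)
  finally show ?thesis .
qed

lemma sum_mult_le:
  "(cmod (\<Sum>i\<in>I. f i * cnj (g i)))\<^sup>2 \<le> (\<Sum>i\<in>I. (cmod (f i))\<^sup>2) * (\<Sum>i\<in>I. (cmod (g i))\<^sup>2)"
proof -
  have "cmod (\<Sum>i\<in>I. f i * cnj (g i)) \<le> (\<Sum>i\<in>I. \<bar>cmod (f i)\<bar> * \<bar>cmod (g i)\<bar>)"
    by (intro sum_norm_le) (simp add: norm_mult)
  also have "\<dots> \<le> L2_set (\<lambda>i. cmod (f i)) I * L2_set (\<lambda>i. cmod (g i)) I" by (rule L2_set_mult_ineq)
  finally have "(cmod (\<Sum>i\<in>I. f i * cnj (g i)))\<^sup>2 \<le> (L2_set (\<lambda>i. cmod (f i)) I * L2_set (\<lambda>i. cmod (g i)) I)\<^sup>2"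
    by (intro power_mono) auto
  then show ?thesis by (simp add: L2_set_def power_mult_distrib sum_nonneg)
qed

text \<open>By the Cauchy-Riemann equations the two derivatives of the energy are, up to sign and a
  factor 2, the real and imaginary parts of one sum. A single application of Cauchy-Schwarz bounds
  both and saves a factor 2; what is saved becomes the area integrand.\<close>

lemma energy_gradient_le_analytic:
  assumes "0 \<le> A" and S: "\<And>n. n \<in> S \<Longrightarrow> 0 \<le> n"
  shows "(energy1 coeff_\<tau> I S c \<tau> t)\<^sup>2 + (energy1 coeff_t I S c \<tau> t)\<^sup>2
    \<le> energy A I S c \<tau> t * (energy2 coeff_\<tau> I S c \<tau> t + energy2 coeff_t I S c \<tau> t)"
    and "energy2 coeff_\<tau> I S c \<tau> t + energy2 coeff_t I S c \<tau> t = 4 * (\<Sum>i\<in>I. (cmod (harmonic S (coeff_\<tau> (c i)) \<tau> t))\<^sup>2)"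
proof -
  define f where "f = (\<lambda>i. harmonic S (c i) \<tau> t)"
  define g where "g = (\<lambda>i. harmonic S (coeff_\<tau> (c i)) \<tau> t)"
  have ht: "harmonic S (coeff_t (c i)) \<tau> t = - \<i> * g i" for i
    unfolding g_def by (rule harmonic_analytic[OF S])
  show L: "energy2 coeff_\<tau> I S c \<tau> t + energy2 coeff_t I S c \<tau> t = 4 * (\<Sum>i\<in>I. (cmod (harmonic S (coeff_\<tau> (c i)) \<tau> t))\<^sup>2)"
    unfolding energy_Laplacian ht by (simp add: norm_mult sum_distrib_left g_def)
  define Z where "Z = (\<Sum>i\<in>I. f i * cnj (g i))"
  have e1: "energy1 coeff_\<tau> I S c \<tau> t = 2 * Re Z"
    by (simp add: energy1_def Z_def f_def g_def Re_sum)
  have e2: "energy1 coeff_t I S c \<tau> t = - 2 * Im Z"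
  proof -
    have "Re (x * cnj (- \<i> * y)) = - Im (x * cnj y)" for x y by simp
    then show ?thesis
      unfolding energy1_def ht Z_def f_def Im_sum by (simp only: sum_negf mult_minus_right mult_minus_left)
  qed
  have "(energy1 coeff_\<tau> I S c \<tau> t)\<^sup>2 + (energy1 coeff_t I S c \<tau> t)\<^sup>2 = 4 * (cmod Z)\<^sup>2"
    unfolding e1 e2 by (simp add: cmod_power2)
  also have "\<dots> \<le> 4 * ((\<Sum>i\<in>I. (cmod (f i))\<^sup>2) * (\<Sum>i\<in>I. (cmod (g i))\<^sup>2))"
    unfolding Z_def by (intro mult_left_mono sum_mult_le) auto
  also have "\<dots> \<le> 4 * (energy A I S c \<tau> t * (\<Sum>i\<in>I. (cmod (g i))\<^sup>2))"
    using assms(1) by (intro mult_left_mono mult_right_mono) (auto simp: energy_def f_def sum_nonneg)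
  also have "\<dots> = energy A I S c \<tau> t * (energy2 coeff_\<tau> I S c \<tau> t + energy2 coeff_t I S c \<tau> t)"
    unfolding L by (simp add: g_def)
  finally show "(energy1 coeff_\<tau> I S c \<tau> t)\<^sup>2 + (energy1 coeff_t I S c \<tau> t)\<^sup>2
    \<le> energy A I S c \<tau> t * (energy2 coeff_\<tau> I S c \<tau> t + energy2 coeff_t I S c \<tau> t)" .
qed

lemma harmonic_norm_le:
  assumes "0 \<le> \<tau>"
  shows "cmod (harmonic S c \<tau> t) \<le> (\<Sum>n\<in>S. cmod (c n))"
  unfolding harmonic_def
proof (intro sum_norm_le)
  fix n
  have "- (2 * pi * \<bar>of_int n\<bar>) * \<tau> \<le> 0" using assms by (simp add: mult_nonneg_nonneg)
  then show "cmod (c n * exp (of_real (- (2 * pi * \<bar>of_int n\<bar>)) * of_real \<tau> + \<i> * of_real (2 * pi * of_int n) * of_real t)) \<le> cmod (c n)"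
    by (simp add: norm_mult norm_exp_eq_Re mult_left_le)
qed

lemma energy_bounded:
  assumes "0 \<le> \<tau>"
  shows "energy A I S c \<tau> t \<le> A + (\<Sum>i\<in>I. (\<Sum>n\<in>S. cmod (c i n))\<^sup>2)"
  unfolding energy_def by (intro add_left_mono sum_mono power_mono harmonic_norm_le assms) auto

lemma harmonic_tendsto_mean:
  assumes "0 \<le> \<tau>" "finite S"
  shows "cmod (harmonic S c \<tau> t - (if 0 \<in> S then c 0 else 0)) \<le> exp (- (2 * pi * \<tau>)) * (\<Sum>n\<in>S. cmod (c n))"
proof -
  define h where "h = (\<lambda>n. c n * exp (of_real (- (2 * pi * \<bar>of_int n\<bar>)) * of_real \<tau> + \<i> * of_real (2 * pi * of_int n) * of_real t))"
  have "harmonic S c \<tau> t - (if 0 \<in> S then c 0 else 0) = (\<Sum>n\<in>S - {0}. h n)"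
    using assms(2) by (simp add: harmonic_def h_def sum_diff1)
  also have "cmod \<dots> \<le> (\<Sum>n\<in>S - {0}. exp (- (2 * pi * \<tau>)) * cmod (c n))"
  proof (intro sum_norm_le)
    fix n assume "n \<in> S - {0}"
    then have "1 \<le> \<bar>real_of_int n\<bar>" by auto
    then have "2 * pi * \<tau> * 1 \<le> 2 * pi * \<tau> * \<bar>of_int n\<bar>" using assms by (intro mult_left_mono) auto
    then have "exp (- (2 * pi * \<bar>of_int n\<bar>) * \<tau>) \<le> exp (- (2 * pi * \<tau>))"
      by (simp add: mult_ac)
    then have "cmod (c n) * exp (- (2 * pi * \<bar>of_int n\<bar>) * \<tau>) \<le> cmod (c n) * exp (- (2 * pi * \<tau>))"
      by (intro mult_left_mono) auto
    then show "cmod (h n) \<le> exp (- (2 * pi * \<tau>)) * cmod (c n)"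
      by (simp add: h_def norm_mult norm_exp_eq_Re mult.commute)
  qed
  also have "\<dots> \<le> (\<Sum>n\<in>S. exp (- (2 * pi * \<tau>)) * cmod (c n))"
    using assms(2) by (intro sum_mono2) auto
  finally show ?thesis by (simp add: sum_distrib_left)
qed

section \<open>Trigonometric polynomials and vector-valued Riesz projections\<close>

definition trig :: "int set \<Rightarrow> (int \<Rightarrow> complex) \<Rightarrow> real \<Rightarrow> complex" where
  "trig S c t = (\<Sum>n\<in>S. c n * cis (2 * pi * of_int n * t))"

lemma harmonic_eq_trig:
  "harmonic S c \<tau> t = trig S (\<lambda>n. c n * of_real (exp (- (2 * pi * \<bar>of_int n\<bar> * \<tau>)))) t"
proof -
  have "exp (of_real (- (2 * pi * \<bar>of_int n\<bar>)) * of_real \<tau> + \<i> * of_real (2 * pi * of_int n) * of_real t)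
     = of_real (exp (- (2 * pi * \<bar>of_int n\<bar> * \<tau>))) * cis (2 * pi * of_int n * t)" for n :: int
    unfolding exp_add cis_conv_exp exp_of_real[symmetric] by (simp add: mult.assoc)
  then show ?thesis by (simp only: harmonic_def trig_def mult.assoc)
qed

lemma harmonic_0: "harmonic S c 0 t = trig S c t"
  by (simp add: harmonic_eq_trig)

lemma continuous_on_trig [continuous_intros]:
  "continuous_on D f \<Longrightarrow> continuous_on D (\<lambda>z. trig S c (f z))"
  unfolding trig_def by (intro continuous_intros)

lemma trig_scale: "trig S (\<lambda>n. of_real a * c n) t = of_real a * trig S c t"
  by (simp add: trig_def sum_distrib_left mult.assoc)

text \<open>Let \<open>f\<close> and \<open>g\<close> be the parts of the height derivative from
  nonnegative and negative frequencies. The derivative in \<open>t\<close> has parts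
  \<open>- i f\<close> and \<open>i g\<close>, and the parallelogram law adds the squares without
  cross terms. Dropping the negative frequencies thus lowers the Laplacian pointwise, the
  differential subordination that \<open>burkholder_superharmonic\<close> asks for.\<close>

lemma energy_Laplacian_analytic_part:
  assumes "finite S"
  shows "energy2 coeff_\<tau> I {n\<in>S. 0 \<le> n} c \<tau> t + energy2 coeff_t I {n\<in>S. 0 \<le> n} c \<tau> t
    \<le> energy2 coeff_\<tau> I S c \<tau> t + energy2 coeff_t I S c \<tau> t"
  unfolding energy_Laplacian
proof (intro mult_left_mono sum_mono)
  fix i
  define S1 S2 where "S1 = {n\<in>S. 0 \<le> n}" and "S2 = {n\<in>S. n < 0}"
  have split: "harmonic S d \<tau> t = harmonic S1 d \<tau> t + harmonic S2 d \<tau> t" for d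
  proof -
    have "S = S1 \<union> S2" "S1 \<inter> S2 = {}" by (auto simp: S1_def S2_def)
    moreover have "finite S1" "finite S2" using assms by (simp_all add: S1_def S2_def)
    ultimately show ?thesis unfolding harmonic_def
      using sum.union_disjoint[of S1 S2] by simp
  qed
  define f where "f = harmonic S1 (coeff_\<tau> (c i)) \<tau> t"
  define g where "g = harmonic S2 (coeff_\<tau> (c i)) \<tau> t"
  have 1: "harmonic S1 (coeff_t (c i)) \<tau> t = - \<i> * f"
    unfolding f_def by (rule harmonic_analytic) (auto simp: S1_def)
  have 2: "harmonic S2 (coeff_t (c i)) \<tau> t = \<i> * g"
    unfolding f_def g_def harmonic_def sum_distrib_left
    by (intro sum.cong refl) (auto simp: coeff_t_def coeff_\<tau>_def S2_def)
  have "(cmod f)\<^sup>2 + (cmod (- \<i> * f))\<^sup>2 \<le> (cmod (f + g))\<^sup>2 + (cmod (- \<i> * f + \<i> * g))\<^sup>2"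
    by (simp add: cmod_power2) (simp add: power2_eq_square algebra_simps)
  then show "(cmod (harmonic {n \<in> S. 0 \<le> n} (coeff_\<tau> (c i)) \<tau> t))\<^sup>2 +
      (cmod (harmonic {n \<in> S. 0 \<le> n} (coeff_t (c i)) \<tau> t))\<^sup>2
    \<le> (cmod (harmonic S (coeff_\<tau> (c i)) \<tau> t))\<^sup>2 + (cmod (harmonic S (coeff_t (c i)) \<tau> t))\<^sup>2"
    unfolding split[of "coeff_\<tau> (c i)"] split[of "coeff_t (c i)"] S1_def[symmetric] 1 2
    by (simp add: f_def g_def)
qed simp

text \<open>For \<open>x = sqrt P\<close> these are \<open>x\<close> times its Laplacian and its
  squared gradient. Their sum is half the Laplacian of \<open>P\<close>, so subordination of two
  such roots is a statement about their energies.\<close>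

lemma sqrt_Laplacian:
  fixes P Pa Pt Paa Ptt :: real
  assumes "0 < P"
  defines "x \<equiv> sqrt P"
  shows "x * ((Paa / (2 * x) - Pa\<^sup>2 / (4 * x ^ 3)) + (Ptt / (2 * x) - Pt\<^sup>2 / (4 * x ^ 3)))
      = (Paa + Ptt) / 2 - (Pa\<^sup>2 + Pt\<^sup>2) / (4 * P)"
    and "(Pa / (2 * x))\<^sup>2 + (Pt / (2 * x))\<^sup>2 = (Pa\<^sup>2 + Pt\<^sup>2) / (4 * P)"
proof -
  have x: "0 < x" "P = x * x" using assms by (auto simp: x_def)
  show "x * ((Paa / (2 * x) - Pa\<^sup>2 / (4 * x ^ 3)) + (Ptt / (2 * x) - Pt\<^sup>2 / (4 * x ^ 3)))
      = (Paa + Ptt) / 2 - (Pa\<^sup>2 + Pt\<^sup>2) / (4 * P)"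
    using x by (simp add: field_simps power2_eq_square power3_eq_cube)
  show "(Pa / (2 * x))\<^sup>2 + (Pt / (2 * x))\<^sup>2 = (Pa\<^sup>2 + Pt\<^sup>2) / (4 * P)"
    using x by (simp add: field_simps power2_eq_square)
qed

text \<open>\<open>burkholder_integral_bound\<close> is applied to the roots of the energies of the
  function, shifted by \<open>A^2\<close>, and of its projection, shifted by 1 to be positive. The
  condition \<open>y \<le> 2 x\<close> holds at a large height because both sums of squares tend to
  the same limit: the projection keeps the frequency 0.\<close>

lemma riesz_projection_harmonic:
  fixes c :: "'i \<Rightarrow> int \<Rightarrow> complex"
  assumes "finite S" and A: "exp (2 * (real m + 1)) \<le> A" "64 \<le> A"
  shows "integral {0..1} (\<lambda>t. sqrt (energy 1 I {n\<in>S. 0 \<le> n} c 0 t) *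
            ln (sqrt (energy (A\<^sup>2) I S c 0 t) + sqrt (energy 1 I {n\<in>S. 0 \<le> n} c 0 t)) ^ m)
     \<le> 2 * 3 ^ (m + 1) * integral {0..1} (\<lambda>t. llog (m + 1) (sqrt (energy (A\<^sup>2) I S c 0 t)))"
proof -
  define S1 where "S1 = {n\<in>S. 0 \<le> n}"
  have A0: "0 < A" using A by simp
  have P0: "0 < energy (A\<^sup>2) I S c \<tau> t" for \<tau> t
    using less_le_trans[OF zero_less_power[OF A0] energy_pos] .
  have Q0: "0 < energy 1 I S1 c \<tau> t" for \<tau> t
    using energy_pos[of 1 I S1 c \<tau> t] by linarith
  note x = cylinder_smooth_sqrt[OF cylinder_smooth_energy P0]
  note y = cylinder_smooth_sqrt[OF cylinder_smooth_energy Q0]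
  have xA: "A \<le> sqrt (energy (A\<^sup>2) I S c \<tau> t)" for \<tau> t
    using A0 energy_pos[of "A\<^sup>2" I S c \<tau> t] by (intro real_le_rsqrt) auto
  define B where "B = (\<Sum>i\<in>I. (\<Sum>n\<in>S. cmod (c i n))\<^sup>2)"
  define B1 where "B1 = (\<Sum>i\<in>I. (\<Sum>n\<in>S1. cmod (c i n))\<^sup>2)"
  define R where "R = max (sqrt (A\<^sup>2 + B)) (sqrt (1 + B1))"
  \<comment> \<open>\<open>E / 2\<close> exceeds both \<open>B\<close> and \<open>B1\<close>, and
    the height is chosen so that \<open>exp (- 2 \<pi> \<tau>) = 1 / (4 E)\<close>; this keeps both
    sums of squares within 1 of their common limit \<open>M0\<close>.\<close>
  define E where "E = 2 * (B + B1) + 1"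
  define \<tau> where "\<tau> = ln (4 * E) / (2 * pi)"
  have BB: "0 \<le> B" "0 \<le> B1" by (simp_all add: B_def B1_def sum_nonneg)
  have \<tau>: "0 \<le> \<tau>" using BB by (simp add: \<tau>_def E_def)
  have e\<tau>: "exp (- (2 * pi * \<tau>)) = 1 / (4 * E)"
  proof -
    have "0 < 4 * E" using BB by (simp add: E_def)
    then have "exp (ln (4 * E)) = 4 * E" by (rule exp_ln)
    moreover have "2 * pi * \<tau> = ln (4 * E)" by (simp add: \<tau>_def)
    ultimately show ?thesis by (simp only: exp_minus inverse_eq_divide)
  qed
  define M0 where "M0 = (\<Sum>i\<in>I. (cmod (if 0 \<in> S then c i 0 else 0))\<^sup>2)"
  have near: "\<bar>(\<Sum>i\<in>I. (cmod (harmonic T (c i) \<tau> t))\<^sup>2) - M0\<bar> \<le> 1"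
    if T: "T \<subseteq> S" "0 \<in> T \<longleftrightarrow> 0 \<in> S" "(\<Sum>i\<in>I. (\<Sum>n\<in>T. cmod (c i n))\<^sup>2) \<le> E / 2" for T t
  proof -
    have finT: "finite T" using T(1) assms(1) finite_subset by blast
    have "\<bar>(\<Sum>i\<in>I. (cmod (harmonic T (c i) \<tau> t))\<^sup>2) - M0\<bar>
      \<le> (\<Sum>i\<in>I. \<bar>(cmod (harmonic T (c i) \<tau> t))\<^sup>2 - (cmod (if 0 \<in> S then c i 0 else 0))\<^sup>2\<bar>)"
      unfolding M0_def sum_subtractf[symmetric] by (rule sum_abs)
    also have "\<dots> \<le> (\<Sum>i\<in>I. 2 * exp (- (2 * pi * \<tau>)) * (\<Sum>n\<in>T. cmod (c i n))\<^sup>2)"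
    proof (intro sum_mono)
      fix i
      define C where "C = (\<Sum>n\<in>T. cmod (c i n))"
      define h where "h = cmod (harmonic T (c i) \<tau> t)"
      define k where "k = cmod (if 0 \<in> S then c i 0 else 0)"
      have C0: "0 \<le> C" by (simp add: C_def sum_nonneg)
      have "cmod (harmonic T (c i) \<tau> t - (if 0 \<in> S then c i 0 else 0)) \<le> exp (- (2 * pi * \<tau>)) * C"
        using harmonic_tendsto_mean[OF \<tau> finT, of "c i" t] T(2) by (simp add: C_def)
      then have hk: "\<bar>h - k\<bar> \<le> exp (- (2 * pi * \<tau>)) * C"
        unfolding h_def k_def using norm_triangle_ineq3 order_trans by blast
      have hC: "h \<le> C" unfolding h_def C_def by (rule harmonic_norm_le[OF \<tau>])
      have kC: "k \<le> C"
      proof (cases "0 \<in> S")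
        case True
        then show ?thesis unfolding k_def C_def using T(2) finT
          by (simp add: member_le_sum[where f = "\<lambda>n. cmod (c i n)"])
      qed (use C0 in \<open>simp add: k_def\<close>)
      have "\<bar>h\<^sup>2 - k\<^sup>2\<bar> = \<bar>h - k\<bar> * (h + k)"
        by (simp add: power2_eq_square square_diff_square_factored abs_mult h_def k_def mult.commute)
      also have "\<dots> \<le> (exp (- (2 * pi * \<tau>)) * C) * (C + C)"
        using hk hC kC C0 by (intro mult_mono) (auto simp: h_def k_def)
      also have "\<dots> = 2 * exp (- (2 * pi * \<tau>)) * C\<^sup>2" by (simp add: power2_eq_square)
      finally show "\<bar>(cmod (harmonic T (c i) \<tau> t))\<^sup>2 - (cmod (if 0 \<in> S then c i 0 else 0))\<^sup>2\<bar>
        \<le> 2 * exp (- (2 * pi * \<tau>)) * (\<Sum>n\<in>T. cmod (c i n))\<^sup>2" by (simp add: h_def k_def C_def)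
    qed
    also have "\<dots> = 2 * exp (- (2 * pi * \<tau>)) * (\<Sum>i\<in>I. (\<Sum>n\<in>T. cmod (c i n))\<^sup>2)"
      by (simp add: sum_distrib_left)
    also have "\<dots> \<le> 2 * exp (- (2 * pi * \<tau>)) * (E / 2)" using T(3) by (intro mult_left_mono) auto
    also have "\<dots> \<le> 1" unfolding e\<tau> using BB by (simp add: E_def)
    finally show ?thesis .
  qed
  have yx: "sqrt (energy 1 I S1 c \<tau> t) \<le> 2 * sqrt (energy (A\<^sup>2) I S c \<tau> t)" for t
  proof -
    have "energy 1 I S1 c \<tau> t \<le> 1 + (M0 + 1)"
      using near[of S1 t] BB by (simp add: energy_def S1_def E_def B1_def)
    also have "\<dots> \<le> 4 * (A\<^sup>2 + (M0 - 1))"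
    proof -
      have "64\<^sup>2 \<le> A\<^sup>2" using A by (intro power_mono) auto
      moreover have "0 \<le> M0" by (simp add: M0_def sum_nonneg)
      ultimately show ?thesis by simp
    qed
    also have "\<dots> \<le> 4 * energy (A\<^sup>2) I S c \<tau> t"
      using near[of S t] BB by (simp add: energy_def E_def B_def)
    finally have "sqrt (energy 1 I S1 c \<tau> t) \<le> sqrt (4 * energy (A\<^sup>2) I S c \<tau> t)" by simp
    then show ?thesis by (simp add: real_sqrt_mult)
  qed
  have Lx: "energy2 coeff_\<tau> I S c \<tau> t + energy2 coeff_t I S c \<tau> t \<ge> 0" for \<tau> t
    unfolding energy_Laplacian by (simp add: sum_nonneg)
  show ?thesis
    unfolding S1_def[symmetric]
  proof (rule burkholder_integral_bound[OF x y _ _ _ _ _ _ _ \<tau> yx])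
    fix \<tau> t :: real
    show "exp (2 * (real m + 1)) \<le> sqrt (energy (A\<^sup>2) I S c \<tau> t)" "64 \<le> sqrt (energy (A\<^sup>2) I S c \<tau> t)"
      using xA[of \<tau> t] A by linarith+
    show "0 < sqrt (energy 1 I S1 c \<tau> t)" using Q0 by simp
    define P where "P = energy (A\<^sup>2) I S c \<tau> t"
    have P0': "0 < P" using P0 by (simp add: P_def)
    have gr: "(energy1 coeff_\<tau> I S c \<tau> t)\<^sup>2 + (energy1 coeff_t I S c \<tau> t)\<^sup>2
      \<le> 2 * P * (energy2 coeff_\<tau> I S c \<tau> t + energy2 coeff_t I S c \<tau> t)"
      unfolding P_def by (rule energy_gradient_le) simp
    have "0 \<le> sqrt P * ((energy2 coeff_\<tau> I S c \<tau> t / (2 * sqrt P) -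
             (energy1 coeff_\<tau> I S c \<tau> t)\<^sup>2 / (4 * sqrt P ^ 3)) +
            (energy2 coeff_t I S c \<tau> t / (2 * sqrt P) -
             (energy1 coeff_t I S c \<tau> t)\<^sup>2 / (4 * sqrt P ^ 3)))"
      unfolding sqrt_Laplacian(1)[OF P0'] using gr P0' by (simp add: field_simps)
    then show "0 \<le> energy2 coeff_\<tau> I S c \<tau> t / (2 * sqrt (energy (A\<^sup>2) I S c \<tau> t)) -
             (energy1 coeff_\<tau> I S c \<tau> t)\<^sup>2 / (4 * sqrt (energy (A\<^sup>2) I S c \<tau> t) ^ 3) +
            (energy2 coeff_t I S c \<tau> t / (2 * sqrt (energy (A\<^sup>2) I S c \<tau> t)) -
             (energy1 coeff_t I S c \<tau> t)\<^sup>2 / (4 * sqrt (energy (A\<^sup>2) I S c \<tau> t) ^ 3))"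
      using P0' unfolding P_def[symmetric] by (simp only: zero_le_mult_iff) auto
    show "sqrt (energy 1 I S1 c \<tau> t) *
       (energy2 coeff_\<tau> I S1 c \<tau> t / (2 * sqrt (energy 1 I S1 c \<tau> t)) -
        (energy1 coeff_\<tau> I S1 c \<tau> t)\<^sup>2 / (4 * sqrt (energy 1 I S1 c \<tau> t) ^ 3) +
        (energy2 coeff_t I S1 c \<tau> t / (2 * sqrt (energy 1 I S1 c \<tau> t)) -
         (energy1 coeff_t I S1 c \<tau> t)\<^sup>2 / (4 * sqrt (energy 1 I S1 c \<tau> t) ^ 3))) +
       (energy1 coeff_\<tau> I S1 c \<tau> t / (2 * sqrt (energy 1 I S1 c \<tau> t)))\<^sup>2 +
       (energy1 coeff_t I S1 c \<tau> t / (2 * sqrt (energy 1 I S1 c \<tau> t)))\<^sup>2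
       \<le> sqrt (energy (A\<^sup>2) I S c \<tau> t) *
       (energy2 coeff_\<tau> I S c \<tau> t / (2 * sqrt (energy (A\<^sup>2) I S c \<tau> t)) -
        (energy1 coeff_\<tau> I S c \<tau> t)\<^sup>2 / (4 * sqrt (energy (A\<^sup>2) I S c \<tau> t) ^ 3) +
        (energy2 coeff_t I S c \<tau> t / (2 * sqrt (energy (A\<^sup>2) I S c \<tau> t)) -
         (energy1 coeff_t I S c \<tau> t)\<^sup>2 / (4 * sqrt (energy (A\<^sup>2) I S c \<tau> t) ^ 3))) +
       (energy1 coeff_\<tau> I S c \<tau> t / (2 * sqrt (energy (A\<^sup>2) I S c \<tau> t)))\<^sup>2 +
       (energy1 coeff_t I S c \<tau> t / (2 * sqrt (energy (A\<^sup>2) I S c \<tau> t)))\<^sup>2"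
      unfolding add.assoc[of _ "(_ / _)\<^sup>2" "(_ / _)\<^sup>2"] sqrt_Laplacian[OF P0] sqrt_Laplacian[OF Q0]
      using energy_Laplacian_analytic_part[OF assms(1), of I c \<tau> t] by (simp add: S1_def)
    assume "0 \<le> \<tau>"
    show "sqrt (energy (A\<^sup>2) I S c \<tau> t) \<le> R"
      unfolding R_def B_def by (rule max.coboundedI1) (intro real_sqrt_le_mono energy_bounded \<open>0 \<le> \<tau>\<close>)
    show "sqrt (energy 1 I S1 c \<tau> t) \<le> R"
      unfolding R_def B1_def by (rule max.coboundedI2) (intro real_sqrt_le_mono energy_bounded \<open>0 \<le> \<tau>\<close>)
  qed
qed

text \<open>The cutoff may differ from component to component: multiplying the \<open>i\<close>-th
  component by the character of frequency \<open>- N i\<close> preserves its modulus and moves its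
  cutoff to 0. \<open>T\<close> is a common set of frequencies after the shifts, with coefficients
  padded by zero.\<close>

theorem riesz_projection_llog:
  fixes c :: "'i \<Rightarrow> int \<Rightarrow> complex" and N :: "'i \<Rightarrow> int"
  assumes "finite I" "finite S" and A: "exp (2 * (real m + 1)) \<le> A" "64 \<le> A"
  defines "x \<equiv> \<lambda>t. sqrt (A\<^sup>2 + (\<Sum>i\<in>I. (cmod (trig S (c i) t))\<^sup>2))"
    and "y \<equiv> \<lambda>t. sqrt (1 + (\<Sum>i\<in>I. (cmod (trig {n\<in>S. N i \<le> n} (c i) t))\<^sup>2))"
  shows "integral {0..1} (\<lambda>t. y t * ln (x t + y t) ^ m) \<le> 2 * 3 ^ (m + 1) * integral {0..1} (\<lambda>t. llog (m + 1) (x t))"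
proof -
  define T where "T = (\<Union>i\<in>I. (\<lambda>n. n - N i) ` S)"
  define b where "b = (\<lambda>i n. if n + N i \<in> S then c i (n + N i) else 0)"
  have finT: "finite T" using assms by (simp add: T_def)
  have shift: "cmod (trig {n\<in>T. Q (n + N i)} (b i) t) = cmod (trig {n\<in>S. Q n} (c i) t)" if "i \<in> I" for i t Q
  proof -
    have "trig {n\<in>T. Q (n + N i)} (b i) t = trig {n\<in>T. Q (n + N i) \<and> n + N i \<in> S} (b i) t"
      unfolding trig_def using finT by (intro sum.mono_neutral_right) (auto simp: b_def)
    also have "\<dots> = (\<Sum>n\<in>{n\<in>S. Q n}. c i n * cis (2 * pi * of_int (n - N i) * t))"
      unfolding trig_def
      by (rule sum.reindex_bij_witness[of _ "\<lambda>n. n - N i" "\<lambda>n. n + N i"]) (use that in \<open>auto simp: T_def b_def\<close>)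
    also have "\<dots> = cis (- (2 * pi * of_int (N i) * t)) * trig {n\<in>S. Q n} (c i) t"
      unfolding trig_def sum_distrib_left
      by (intro sum.cong refl) (simp add: cis_mult algebra_simps)
    finally show ?thesis by (simp add: norm_mult)
  qed
  have x: "sqrt (energy (A\<^sup>2) I T b 0 t) = x t" for t
    unfolding x_def energy_def harmonic_0 using shift[of _ "\<lambda>_. True"] by simp
  have y: "sqrt (energy 1 I {n\<in>T. 0 \<le> n} b 0 t) = y t" for t
  proof -
    have "cmod (trig {n\<in>T. 0 \<le> n} (b i) t) = cmod (trig {n\<in>S. N i \<le> n} (c i) t)" if "i \<in> I" for i
      using shift[OF that, of "\<lambda>n. N i \<le> n"] by simp
    then show ?thesis unfolding y_def energy_def harmonic_0 by simp
  qed
  show ?thesis using riesz_projection_harmonic[OF finT A, of I b] by (simp only: x y)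
qed

section \<open>The square function of Poisson increments\<close>

text \<open>Here the factor saved by analyticity is spent: \<open>x\<close> times its Laplacian is
  at least \<open>L / 2 - L / 4 = h\<close>, where \<open>L = 4 h\<close> is the Laplacian of the
  energy.\<close>

lemma energy_area:
  fixes a :: "'i \<Rightarrow> int \<Rightarrow> complex" and I :: "'i set"
  assumes S: "\<And>n. n \<in> S \<Longrightarrow> 0 \<le> n" and A: "1 \<le> A" and "0 \<le> T"
  defines "x \<equiv> \<lambda>\<tau> t. sqrt (energy (A\<^sup>2) I S a \<tau> t)"
    and "h \<equiv> \<lambda>\<tau> t. \<Sum>i\<in>I. (cmod (harmonic S (coeff_\<tau> (a i)) \<tau> t))\<^sup>2"
  shows "integral {0..1} (\<lambda>t. integral {0..T} (\<lambda>\<tau>. \<tau> * (h \<tau> t * ln (x \<tau> t) ^ m / x \<tau> t)))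
         \<le> integral {0..1} (\<lambda>t. llog m (x 0 t))"
proof -
  have A0: "0 < A" using A by simp
  have P0: "0 < energy (A\<^sup>2) I S a \<tau> t" for \<tau> t
    using less_le_trans[OF zero_less_power[OF A0] energy_pos] .
  note x = cylinder_smooth_sqrt[OF cylinder_smooth_energy P0]
  show ?thesis
    unfolding x_def
  proof (rule llog_weighted_energy[OF x _ _ _ _ _ \<open>0 \<le> T\<close>])
    fix \<tau> t :: real
    have "1 \<le> A\<^sup>2" using A by simp
    then show "1 \<le> sqrt (energy (A\<^sup>2) I S a \<tau> t)"
      using energy_pos[of "A\<^sup>2" I S a \<tau> t] by simp
    show "sqrt (energy (A\<^sup>2) I S a \<tau> t) \<le> sqrt (A\<^sup>2 + (\<Sum>i\<in>I. (\<Sum>n\<in>S. cmod (a i n))\<^sup>2))" if "0 \<le> \<tau>"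
      by (intro real_sqrt_le_mono energy_bounded that)
    show "0 \<le> h \<tau> t" by (simp add: h_def sum_nonneg)
    define P where "P = energy (A\<^sup>2) I S a \<tau> t"
    have P0': "0 < P" using P0 by (simp add: P_def)
    define L where "L = energy2 coeff_\<tau> I S a \<tau> t + energy2 coeff_t I S a \<tau> t"
    have gr: "(energy1 coeff_\<tau> I S a \<tau> t)\<^sup>2 + (energy1 coeff_t I S a \<tau> t)\<^sup>2 \<le> P * L"
      unfolding P_def L_def by (rule energy_gradient_le_analytic(1)[OF _ S]) simp
    have L: "L = 4 * h \<tau> t"
      unfolding L_def h_def by (rule energy_gradient_le_analytic(2)[OF order_refl S])
    have "((energy1 coeff_\<tau> I S a \<tau> t)\<^sup>2 + (energy1 coeff_t I S a \<tau> t)\<^sup>2) / (4 * P) \<le> P * L / (4 * P)"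
      using gr P0' by (intro divide_right_mono) auto
    also have "\<dots> = h \<tau> t" using P0' L by simp
    finally have "h \<tau> t \<le> L / 2 - ((energy1 coeff_\<tau> I S a \<tau> t)\<^sup>2 + (energy1 coeff_t I S a \<tau> t)\<^sup>2) / (4 * P)"
      using L by simp
    then show "h \<tau> t \<le> sqrt (energy (A\<^sup>2) I S a \<tau> t) *
          (energy2 coeff_\<tau> I S a \<tau> t / (2 * sqrt (energy (A\<^sup>2) I S a \<tau> t)) -
           (energy1 coeff_\<tau> I S a \<tau> t)\<^sup>2 / (4 * sqrt (energy (A\<^sup>2) I S a \<tau> t) ^ 3) +
           (energy2 coeff_t I S a \<tau> t / (2 * sqrt (energy (A\<^sup>2) I S a \<tau> t)) -
            (energy1 coeff_t I S a \<tau> t)\<^sup>2 / (4 * sqrt (energy (A\<^sup>2) I S a \<tau> t) ^ 3)))"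
      unfolding sqrt_Laplacian(1)[OF P0] by (simp add: P_def L_def)
  next
    show "continuous_on UNIV (\<lambda>z. h (fst z) (snd z))"
      unfolding h_def by (intro continuous_intros continuous_on_harmonic)
  qed
qed

text \<open>Nonnegative frequencies make each component a polynomial on the disc, and the shift
  \<open>A\<close> enters as one more component, constant and indexed by \<open>None\<close>; thus
  \<open>x\<close> is itself the norm of a vector of polynomials.\<close>

lemma harmonic_submean:
  fixes a :: "'i \<Rightarrow> int \<Rightarrow> complex"
  assumes "finite I" and S: "\<And>n. n \<in> S \<Longrightarrow> 0 \<le> n" and A: "0 < A" and B: "real m + 4 \<le> B" and \<tau>: "0 < \<tau>"
  defines "x \<equiv> \<lambda>\<tau> t. sqrt (energy (A\<^sup>2) I S a \<tau> t)"
  shows "root_llog m B (sqrt (x \<tau> t)) \<le>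
     integral {0..1} (\<lambda>y. poisson (exp (- (2 * pi * \<tau>))) (t - y) * root_llog m B (sqrt (x 0 y)))"
proof -
  define p where "p = (\<lambda>j. case j of None \<Rightarrow> [:of_real A:] | Some i \<Rightarrow> (\<Sum>n\<in>S. monom (a i n) (nat n)))"
  define F where "F = (\<lambda>z. L2_set (\<lambda>j. cmod (poly (p j) z)) (insert None (Some ` I)))"
  have pz: "poly (p (Some i)) (of_real (exp (- (2 * pi * \<sigma>))) * cis (2 * pi * s)) = harmonic S (a i) \<sigma> s" for i \<sigma> s
  proof -
    have "(of_real (exp (- (2 * pi * \<sigma>))) * cis (2 * pi * s)) ^ nat n
        = of_real (exp (- (2 * pi * \<bar>of_int n\<bar> * \<sigma>))) * cis (2 * pi * of_int n * s)" if "n \<in> S" for n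
    proof -
      have n: "real (nat n) = of_int n" "0 \<le> n" using S[OF that] by auto
      have "(of_real (exp (- (2 * pi * \<sigma>))) * cis (2 * pi * s)) ^ nat n
         = of_real (exp (real (nat n) * (- (2 * pi * \<sigma>)))) * cis (real (nat n) * (2 * pi * s))"
        by (simp only: power_mult_distrib Complex.DeMoivre exp_of_nat_mult of_real_power)
      then show ?thesis using n by (simp add: mult_ac)
    qed
    then show ?thesis
      by (simp add: p_def poly_sum poly_monom harmonic_eq_trig trig_def mult.assoc)
  qed
  have F: "F (of_real (exp (- (2 * pi * \<sigma>))) * cis (2 * pi * s)) = x \<sigma> s" for \<sigma> s
    unfolding F_def L2_set_def x_def energy_def using \<open>finite I\<close>
    by (simp add: sum.reindex pz) (simp add: p_def)
  have F': "F (cis (2 * pi * y)) = x 0 y" for y using F[of 0 y] by simp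
  have "x \<tau> t \<noteq> 0"
  proof -
    have "0 < energy (A\<^sup>2) I S a \<tau> t" using less_le_trans[OF zero_less_power[OF A] energy_pos] .
    then show ?thesis by (simp add: x_def)
  qed
  then have "root_llog m B (sqrt (F (of_real (exp (- (2 * pi * \<tau>))) * cis (2 * pi * t)))) \<le>
     integral {0..1} (\<lambda>y. poisson (exp (- (2 * pi * \<tau>))) (t - y) * root_llog m B (sqrt (F (cis (2 * pi * y)))))"
    using \<tau> by (intro poisson_submean root_llog_mono root_llog_tangent continuous_on_root_llog B)
      (auto simp: F, simp add: F_def)
  then show ?thesis by (simp only: F F')
qed

text \<open>Chosen so that \<open>exp (- 2 \<pi> * scale_level k) = 2 powr (- 1 / 2 ^ k)\<close>;
  consecutive heights differ by a factor 2.\<close>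

definition scale_level :: "nat \<Rightarrow> real" where
  "scale_level k = ln 2 / (2 * pi) / 2 ^ k"

lemma scale_level_pos: "0 < scale_level k"
  by (simp add: scale_level_def)

lemma scale_level_Suc: "scale_level k = 2 * scale_level (Suc k)"
  by (simp add: scale_level_def)

lemma scale_level_antimono: "j \<le> k \<Longrightarrow> scale_level k \<le> scale_level j"
  unfolding scale_level_def by (intro divide_left_mono) auto

lemma scale_level_cover:
  assumes "scale_level K \<le> \<tau>" "\<tau> \<le> scale_level 0"
  shows "\<exists>k\<le>K. scale_level k \<le> \<tau> \<and> \<tau> \<le> 2 * scale_level k"
  using assms
proof (induction K)
  case (Suc K)
  show ?case
  proof (cases "scale_level K \<le> \<tau>")
    case True
    then show ?thesis using Suc by (meson le_Suc_eq)
  next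
    case False
    then show ?thesis using Suc scale_level_Suc[of K] by (intro exI[of _ "Suc K"]) auto
  qed
qed (use scale_level_pos[of 0] in auto)

lemma poisson_scale_le:
  assumes "0 < \<sigma>" "\<sigma> \<le> \<tau>" "\<tau> \<le> 2 * \<sigma>"
  shows "poisson (exp (- (2 * pi * \<tau>))) t \<le> 16 * poisson (exp (- (2 * pi * \<sigma>))) t"
proof -
  define \<rho> where "\<rho> = exp (- (2 * pi * \<sigma>))"
  have \<rho>: "0 < \<rho>" "\<rho> < 1" using assms by (simp_all add: \<rho>_def)
  have "poisson (exp (- (2 * pi * \<tau>))) t \<le> 8 * 2 * poisson \<rho> t"
  proof (rule poisson_le_poisson)
    show "exp (- (2 * pi * \<tau>)) \<le> \<rho>" using assms by (simp add: \<rho>_def)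
    have "\<rho> * \<rho> = exp (- (2 * pi * (2 * \<sigma>)))" by (simp add: \<rho>_def flip: exp_add)
    also have "\<dots> \<le> exp (- (2 * pi * \<tau>))" using assms by simp
    finally have "1 - exp (- (2 * pi * \<tau>)) \<le> 1 - \<rho> * \<rho>" by simp
    also have "\<dots> = (1 + \<rho>) * (1 - \<rho>)" by (simp add: algebra_simps)
    also have "\<dots> \<le> 2 * (1 - \<rho>)" using \<rho> by (intro mult_right_mono) auto
    finally show "1 - exp (- (2 * pi * \<tau>)) \<le> 2 * (1 - \<rho>)" .
  qed (use \<rho> in auto)
  then show ?thesis by (simp add: \<rho>_def)
qed

lemma integral_square_le:
  fixes v :: "real \<Rightarrow> real"
  assumes "a < b" and v: "continuous_on {a..b} v"
  shows "(integral {a..b} v)\<^sup>2 \<le> (b - a) * integral {a..b} (\<lambda>s. (v s)\<^sup>2)"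
proof -
  define c where "c = integral {a..b} v / (b - a)"
  have i1: "v integrable_on {a..b}" "(\<lambda>s. (v s)\<^sup>2) integrable_on {a..b}"
    by (intro integrable_continuous_interval continuous_intros v)+
  have hc: "((\<lambda>s. c\<^sup>2) has_integral (b - a) *\<^sub>R c\<^sup>2) {a..b}"
    using has_integral_const_real[of "c\<^sup>2" a b] \<open>a < b\<close> by simp
  have "0 \<le> integral {a..b} (\<lambda>s. (v s - c)\<^sup>2)"
    by (intro Henstock_Kurzweil_Integration.integral_nonneg integrable_continuous_interval continuous_intros v) auto
  also have "\<dots> = integral {a..b} (\<lambda>s. (v s)\<^sup>2) - 2 * c * integral {a..b} v + c\<^sup>2 * (b - a)"
  proof (rule integral_unique)
    have "((\<lambda>s. (v s)\<^sup>2 - (2 * c) * v s + c\<^sup>2) has_integral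
      integral {a..b} (\<lambda>s. (v s)\<^sup>2) - 2 * c * integral {a..b} v + (b - a) *\<^sub>R c\<^sup>2) {a..b}"
      using \<open>a < b\<close> by (intro has_integral_add has_integral_diff has_integral_mult_right integrable_integral i1 hc)
    then show "((\<lambda>s. (v s - c)\<^sup>2) has_integral integral {a..b} (\<lambda>s. (v s)\<^sup>2) - 2 * c * integral {a..b} v + c\<^sup>2 * (b - a)) {a..b}"
      by (simp add: power2_eq_square algebra_simps)
  qed
  also have "\<dots> = integral {a..b} (\<lambda>s. (v s)\<^sup>2) - (integral {a..b} v)\<^sup>2 / (b - a)"
  proof -
    have "V2 - 2 * (V / l) * V + (V / l)\<^sup>2 * l = V2 - V\<^sup>2 / l" if "l \<noteq> 0" for V V2 l :: real
      using that by (simp add: field_simps power2_eq_square)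
    then show ?thesis using \<open>a < b\<close> by (simp add: c_def)
  qed
  finally show ?thesis using \<open>a < b\<close> by (simp add: field_simps)
qed

text \<open>The interval from \<sigma> to \<open>2 * \<sigma>\<close> has length at most each of its
  points \<tau>, so Cauchy-Schwarz produces exactly the weight of Green's formula.\<close>

lemma harmonic_increment_le:
  assumes "0 < \<sigma>"
  shows "(cmod (harmonic S c (2 * \<sigma>) t - harmonic S c \<sigma> t))\<^sup>2
     \<le> integral {\<sigma>..2 * \<sigma>} (\<lambda>\<tau>. \<tau> * (cmod (harmonic S (coeff_\<tau> c) \<tau> t))\<^sup>2)"
proof -
  define v where "v = (\<lambda>\<tau>. harmonic S (coeff_\<tau> c) \<tau> t)"
  have cv: "continuous_on D v" for D
    unfolding v_def by (intro continuous_on_harmonic continuous_intros)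
  have "(v has_integral (harmonic S c (2 * \<sigma>) t - harmonic S c \<sigma> t)) {\<sigma>..2 * \<sigma>}"
    unfolding v_def by (rule fundamental_theorem_of_calculus)
      (use assms harmonic_deriv_\<tau>[of S c t] in \<open>auto intro: has_vector_derivative_at_within\<close>)
  then have "cmod (harmonic S c (2 * \<sigma>) t - harmonic S c \<sigma> t) \<le> integral {\<sigma>..2 * \<sigma>} (\<lambda>\<tau>. cmod (v \<tau>))"
    using integral_norm_bound_integral[of v "{\<sigma>..2 * \<sigma>}" "\<lambda>\<tau>. cmod (v \<tau>)"] cv[of "{\<sigma>..2 * \<sigma>}"]
    by (simp add: integral_unique integrable_continuous_interval continuous_on_norm)
  then have "(cmod (harmonic S c (2 * \<sigma>) t - harmonic S c \<sigma> t))\<^sup>2 \<le> (integral {\<sigma>..2 * \<sigma>} (\<lambda>\<tau>. cmod (v \<tau>)))\<^sup>2"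
    by (intro power_mono) auto
  also have "\<dots> \<le> (2 * \<sigma> - \<sigma>) * integral {\<sigma>..2 * \<sigma>} (\<lambda>\<tau>. (cmod (v \<tau>))\<^sup>2)"
    using assms by (intro integral_square_le continuous_on_norm cv) auto
  also have "\<dots> = integral {\<sigma>..2 * \<sigma>} (\<lambda>\<tau>. \<sigma> * (cmod (v \<tau>))\<^sup>2)"
    by (simp only: integral_mult_right) simp
  also have "\<dots> \<le> integral {\<sigma>..2 * \<sigma>} (\<lambda>\<tau>. \<tau> * (cmod (v \<tau>))\<^sup>2)"
    by (intro Henstock_Kurzweil_Integration.integral_le integrable_continuous_interval continuous_intros cv mult_right_mono) auto
  finally show ?thesis by (simp add: v_def)
qed

lemma scale_increments_le:
  fixes a :: "'i \<Rightarrow> int \<Rightarrow> complex"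
  shows "(\<Sum>k<K. \<Sum>i\<in>I. (cmod (harmonic S (a i) (scale_level k) t - harmonic S (a i) (scale_level (Suc k)) t))\<^sup>2)
    \<le> integral {scale_level K..scale_level 0} (\<lambda>\<tau>. \<tau> * (\<Sum>i\<in>I. (cmod (harmonic S (coeff_\<tau> (a i)) \<tau> t))\<^sup>2))"
proof -
  define q where "q = (\<lambda>i \<tau>. \<tau> * (cmod (harmonic S (coeff_\<tau> (a i)) \<tau> t))\<^sup>2)"
  have cq: "continuous_on D (q i)" for D i
    unfolding q_def by (intro continuous_intros continuous_on_harmonic)
  have iq: "(\<lambda>\<tau>. \<Sum>i\<in>I. q i \<tau>) integrable_on {b..c}" for b c
    by (intro integrable_continuous_interval continuous_on_sum cq)
  have "(\<Sum>k<K. \<Sum>i\<in>I. (cmod (harmonic S (a i) (scale_level k) t - harmonic S (a i) (scale_level (Suc k)) t))\<^sup>2)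
    \<le> integral {scale_level K..scale_level 0} (\<lambda>\<tau>. \<Sum>i\<in>I. q i \<tau>)"
  proof (induction K)
    case (Suc K)
    have "(\<Sum>i\<in>I. (cmod (harmonic S (a i) (scale_level K) t - harmonic S (a i) (scale_level (Suc K)) t))\<^sup>2)
      \<le> (\<Sum>i\<in>I. integral {scale_level (Suc K)..scale_level K} (q i))"
      unfolding q_def scale_level_Suc[of K] by (intro sum_mono harmonic_increment_le scale_level_pos)
    also have "\<dots> = integral {scale_level (Suc K)..scale_level K} (\<lambda>\<tau>. \<Sum>i\<in>I. q i \<tau>)"
      by (cases "finite I") (simp_all add: integral_sum integrable_continuous_interval cq)
    finally have "(\<Sum>k<Suc K. \<Sum>i\<in>I. (cmod (harmonic S (a i) (scale_level k) t - harmonic S (a i) (scale_level (Suc k)) t))\<^sup>2)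
      \<le> integral {scale_level (Suc K)..scale_level K} (\<lambda>\<tau>. \<Sum>i\<in>I. q i \<tau>)
       + integral {scale_level K..scale_level 0} (\<lambda>\<tau>. \<Sum>i\<in>I. q i \<tau>)"
      using Suc by simp
    also have "\<dots> = integral {scale_level (Suc K)..scale_level 0} (\<lambda>\<tau>. \<Sum>i\<in>I. q i \<tau>)"
      by (intro Henstock_Kurzweil_Integration.integral_combine iq scale_level_antimono) auto
    finally show ?case .
  qed simp
  then show ?thesis by (simp add: q_def sum_distrib_left)
qed

lemma llog_mono: "1 \<le> v \<Longrightarrow> v \<le> w \<Longrightarrow> llog m v \<le> llog m w"
  unfolding llog_def by (intro mult_mono power_mono ln_mono) auto

lemma llog_nonneg: "1 \<le> v \<Longrightarrow> 0 \<le> llog m v"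
  by (simp add: llog_def)

lemma llog_cmult_le:
  assumes "1 \<le> c" "c \<le> v"
  shows "llog m (c * v) \<le> c * 2 ^ m * llog m v"
proof -
  have "1 \<le> v" using assms by simp
  have "1 \<le> c * v" using assms \<open>1 \<le> v\<close> mult_mono[of 1 c 1 v] by simp
  have "ln (c * v) = ln c + ln v" using assms by (simp add: ln_mult)
  moreover have "ln c \<le> ln v" using assms by simp
  ultimately have "ln (c * v) \<le> 2 * ln v" by simp
  then have "ln (c * v) ^ m \<le> (2 * ln v) ^ m"
    using \<open>1 \<le> c * v\<close> by (intro power_mono) auto
  then have "c * v * ln (c * v) ^ m \<le> c * v * (2 * ln v) ^ m"
    using assms by (intro mult_left_mono) auto
  then show ?thesis by (simp add: llog_def power_mult_distrib mult_ac)
qed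

text \<open>Allows the weight in the area integral to be bounded below by its value at an upper
  bound for \<open>x\<close>.\<close>

lemma ln_power_div_antimono:
  fixes x y :: real
  assumes x: "exp m \<le> x" and "x \<le> y"
  shows "ln y ^ m / y \<le> ln x ^ m / x"
proof -
  have "0 < x" using x by (meson exp_gt_zero less_le_trans)
  show ?thesis
  proof (rule DERIV_nonpos_imp_nonincreasing[OF \<open>x \<le> y\<close>])
    fix z assume z: "x \<le> z" "z \<le> y"
    have z0: "0 < z" using \<open>0 < x\<close> z by simp
    have L: "real m \<le> ln z" using x z z0 by (simp add: ln_ge_iff)
    have "((\<lambda>z. ln z ^ m / z) has_real_derivative
       (m * ln z ^ (m - 1) * (1 / z) * z - ln z ^ m * 1) / (z * z)) (at z)"
      using z0 by (intro DERIV_divide DERIV_ln_power DERIV_ident) auto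
    moreover have "(m * ln z ^ (m - 1) * (1 / z) * z - ln z ^ m * 1) / (z * z) \<le> 0"
    proof (cases m)
      case (Suc k)
      have "real m * ln z ^ k \<le> ln z * ln z ^ k" using L by (intro mult_right_mono) auto
      then show ?thesis using z0 Suc by (intro divide_nonpos_pos) auto
    qed (use z0 in auto)
    ultimately show "\<exists>d. ((\<lambda>z. ln z ^ m / z) has_real_derivative d) (at z) \<and> d \<le> 0" by blast
  qed
qed

text \<open>Passes from the area integral \<open>D\<close> without logarithm to the weighted one,
  \<open>E\<close>. Put \<open>J = sqrt D\<close> and suppose that \<open>J > x \<beta>\<close> and
  \<open>llog m J > w + E\<close>. Then \<open>x \<le> J\<close> on the whole segment, since
  \<open>llog m x \<le> w\<close> there; the weight is therefore at least
  \<open>ln J ^ m / J\<close>, and \<open>E \<ge> D * ln J ^ m / J = llog m J\<close>, a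
  contradiction.\<close>

lemma llog_area_pointwise:
  fixes x h :: "real \<Rightarrow> real"
  assumes ab: "0 \<le> \<alpha>" "\<alpha> \<le> \<beta>" and x: "continuous_on {\<alpha>..\<beta>} x" and h: "continuous_on {\<alpha>..\<beta>} h" "\<And>\<tau>. 0 \<le> h \<tau>"
    and xA: "\<And>\<tau>. A \<le> x \<tau>" and A: "2 \<le> A" "exp m \<le> A"
    and w: "\<And>\<tau>. \<tau> \<in> {\<alpha>..\<beta>} \<Longrightarrow> llog m (x \<tau>) \<le> w"
  shows "llog m (sqrt ((x \<beta>)\<^sup>2 + integral {\<alpha>..\<beta>} (\<lambda>\<tau>. \<tau> * h \<tau>)))
    \<le> 2 * 2 ^ m * (w + integral {\<alpha>..\<beta>} (\<lambda>\<tau>. \<tau> * (h \<tau> * ln (x \<tau>) ^ m / x \<tau>)))"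
proof -
  define D where "D = integral {\<alpha>..\<beta>} (\<lambda>\<tau>. \<tau> * h \<tau>)"
  define E where "E = integral {\<alpha>..\<beta>} (\<lambda>\<tau>. \<tau> * (h \<tau> * ln (x \<tau>) ^ m / x \<tau>))"
  have x0: "0 < x \<tau>" "1 \<le> x \<tau>" "x \<tau> \<noteq> 0" for \<tau> using xA[of \<tau>] A by linarith+
  have iD: "(\<lambda>\<tau>. \<tau> * h \<tau>) integrable_on {\<alpha>..\<beta>}"
    by (intro integrable_continuous_interval continuous_intros h)
  have iE: "(\<lambda>\<tau>. \<tau> * (h \<tau> * ln (x \<tau>) ^ m / x \<tau>)) integrable_on {\<alpha>..\<beta>}"
    by (intro integrable_continuous_interval continuous_intros h x) (auto simp: x0)
  have D0: "0 \<le> D"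
    unfolding D_def using ab h by (intro Henstock_Kurzweil_Integration.integral_nonneg iD) auto
  have E0: "0 \<le> E"
    unfolding E_def using ab h x0 by (intro Henstock_Kurzweil_Integration.integral_nonneg iE) (auto intro!: mult_nonneg_nonneg divide_nonneg_nonneg less_imp_le[OF x0(1)])
  have w0: "0 \<le> w" using w[of \<beta>] ab llog_nonneg[OF x0(2)[of \<beta>], of m] by auto
  have "\<exists>v\<ge>2. sqrt ((x \<beta>)\<^sup>2 + D) \<le> 2 * v \<and> llog m v \<le> w + E"
  proof (cases "D \<le> (x \<beta>)\<^sup>2")
    case True
    have "D \<le> 3 * (x \<beta>)\<^sup>2" using True zero_le_power2[of "x \<beta>"] by linarith
    then have "sqrt ((x \<beta>)\<^sup>2 + D) \<le> 2 * x \<beta>"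
      using x0(1)[of \<beta>] by (intro real_le_lsqrt) (auto simp: power_mult_distrib)
    moreover have "llog m (x \<beta>) \<le> w + E" using w[of \<beta>] ab E0 by auto
    ultimately show ?thesis using xA[of \<beta>] A by (intro exI[of _ "x \<beta>"]) auto
  next
    case False
    define J where "J = sqrt D"
    have J2: "J * J = D" using D0 by (simp add: J_def)
    have J: "x \<beta> < J" using False x0(1)[of \<beta>] by (simp add: J_def real_less_rsqrt)
    have "(x \<beta>)\<^sup>2 \<le> 3 * D" using False D0 by linarith
    then have "sqrt ((x \<beta>)\<^sup>2 + D) \<le> 2 * J"
      using J x0(1)[of \<beta>] by (intro real_le_lsqrt) (auto simp: power_mult_distrib power2_eq_square[of J] J2)
    moreover have "llog m J \<le> w + E"
    proof (rule ccontr)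
      assume neg: "\<not> llog m J \<le> w + E"
      have xJ: "x \<tau> \<le> J" if "\<tau> \<in> {\<alpha>..\<beta>}" for \<tau>
      proof (rule ccontr)
        assume "\<not> x \<tau> \<le> J"
        then have "llog m J \<le> llog m (x \<tau>)" using J x0(2)[of \<beta>] by (intro llog_mono) auto
        then show False using w[OF that] neg E0 by linarith
      qed
      have "D * (ln J ^ m / J) = integral {\<alpha>..\<beta>} (\<lambda>\<tau>. \<tau> * h \<tau> * (ln J ^ m / J))"
        unfolding D_def by (simp only: integral_mult_left)
      also have "\<dots> \<le> E"
        unfolding E_def
      proof (rule Henstock_Kurzweil_Integration.integral_le[OF _ iE])
        show "(\<lambda>\<tau>. \<tau> * h \<tau> * (ln J ^ m / J)) integrable_on {\<alpha>..\<beta>}"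
          by (intro integrable_continuous_interval continuous_intros h)
        fix \<tau> assume \<tau>: "\<tau> \<in> {\<alpha>..\<beta>}"
        have "\<tau> * h \<tau> * (ln J ^ m / J) \<le> \<tau> * h \<tau> * (ln (x \<tau>) ^ m / x \<tau>)"
          using \<tau> ab h(2)[of \<tau>] xJ[OF \<tau>] xA[of \<tau>] A
          by (intro mult_left_mono ln_power_div_antimono mult_nonneg_nonneg) auto
        then show "\<tau> * h \<tau> * (ln J ^ m / J) \<le> \<tau> * (h \<tau> * ln (x \<tau>) ^ m / x \<tau>)" by (simp add: mult.assoc)
      qed
      also have "D * (ln J ^ m / J) = llog m J"
        using J x0(1)[of \<beta>] unfolding J2[symmetric] by (simp add: llog_def)
      finally show False using neg w0 by linarith
    qed
    ultimately show ?thesis using xA[of \<beta>] A J by (intro exI[of _ J]) auto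
  qed
  then obtain v where v: "2 \<le> v" "sqrt ((x \<beta>)\<^sup>2 + D) \<le> 2 * v" "llog m v \<le> w + E" by blast
  have "1 \<le> sqrt ((x \<beta>)\<^sup>2 + D)"
    using x0(2)[of \<beta>] D0 by (smt (verit) one_le_power real_sqrt_ge_1_iff)
  then have "llog m (sqrt ((x \<beta>)\<^sup>2 + D)) \<le> llog m (2 * v)" using v by (intro llog_mono)
  also have "\<dots> \<le> 2 * 2 ^ m * llog m v" using v by (intro llog_cmult_le) auto
  also have "\<dots> \<le> 2 * 2 ^ m * (w + E)" using v by (intro mult_left_mono) auto
  finally show ?thesis by (simp add: D_def E_def)
qed

text \<open>\<open>llog_area_pointwise\<close> is applied on each vertical segment, with
  \<open>w\<close> from the maximal function, and \<open>energy_area\<close> integrates the area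
  term. The finitely many levels \<open>k \<le> K\<close> suffice for the maximal function, because
  every height in between is within a factor 2 of one of them; the constant does not depend on
  \<open>K\<close>.\<close>

lemma square_function_llog_bound:
  fixes a :: "'i \<Rightarrow> int \<Rightarrow> complex" and K :: nat
  assumes "finite I" and S: "\<And>n. n \<in> S \<Longrightarrow> 0 \<le> n"
    and A: "64 \<le> A" "2 * (real m + 4) \<le> A" "exp m \<le> A"
  defines "G \<equiv> \<lambda>t. sqrt (A\<^sup>2 + (\<Sum>i\<in>I. (cmod (harmonic S (a i) (scale_level 0) t))\<^sup>2) +
      (\<Sum>k<K. \<Sum>i\<in>I. (cmod (harmonic S (a i) (scale_level k) t - harmonic S (a i) (scale_level (Suc k)) t))\<^sup>2))"
  shows "integral {0..1} (\<lambda>t. llog m (G t)) \<le>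
    2 * 2 ^ m * (2 ^ m * 256 * 1024 + 1) *
      integral {0..1} (\<lambda>t. llog m (sqrt (A\<^sup>2 + (\<Sum>i\<in>I. (cmod (trig S (a i) t))\<^sup>2))))"
proof -
  define B where "B = real m + 4"
  have B: "real m + 4 \<le> B" by (simp add: B_def)
  define x where "x = (\<lambda>\<tau> t. sqrt (energy (A\<^sup>2) I S a \<tau> t))"
  define h where "h = (\<lambda>\<tau> t. \<Sum>i\<in>I. (cmod (harmonic S (coeff_\<tau> (a i)) \<tau> t))\<^sup>2)"
  define \<phi> where "\<phi> = (\<lambda>y. root_llog m B (sqrt (x 0 y)))"
  define \<rho> where "\<rho> = (\<lambda>k. exp (- (2 * pi * scale_level k)))"
  have \<rho>: "0 \<le> \<rho> k" "\<rho> k < 1" for k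
    using scale_level_pos[of k] by (simp_all add: \<rho>_def)
  have xA: "A \<le> x \<tau> t" for \<tau> t
    unfolding x_def using energy_pos[of "A\<^sup>2" I S a \<tau> t] by (intro real_le_rsqrt)
  have x1: "1 \<le> x \<tau> t" "0 < x \<tau> t" "0 \<le> x \<tau> t" "64 \<le> x \<tau> t" for \<tau> t using xA[of \<tau> t] A by linarith+
  have cx: "continuous_on D (\<lambda>z. x (f z) (g z))" if "continuous_on D f" "continuous_on D g" for D f g
    unfolding x_def energy_def using that by (intro continuous_intros continuous_on_harmonic)
  have ch: "continuous_on D (\<lambda>z. h (f z) (g z))" if "continuous_on D f" "continuous_on D g" for D f g
    unfolding h_def using that by (intro continuous_intros continuous_on_harmonic)
  have cll: "continuous_on D (\<lambda>z. llog m (f z))" if "continuous_on D f" "\<And>z. 1 \<le> f z" for D and f :: "real \<Rightarrow> real"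
  proof -
    have "f z \<noteq> 0" for z using that(2)[of z] by auto
    then show ?thesis unfolding llog_def using that by (intro continuous_intros) auto
  qed
  have c\<phi>: "continuous_on D \<phi>" for D
    unfolding \<phi>_def
    by (rule continuous_on_compose2[OF continuous_on_root_llog[OF B]]) (auto intro!: continuous_intros cx x1)
  have \<phi>0: "0 \<le> \<phi> y" for y unfolding \<phi>_def by (intro root_llog_nonneg[OF B]) (simp add: x1)
  have \<phi>sq: "(\<phi> y)\<^sup>2 = x 0 y * ln (B + sqrt (x 0 y)) ^ m" for y
    unfolding \<phi>_def using x1(3)[of 0 y] by (subst root_llog_square[OF B]) auto
  have sqx: "(root_llog m B (sqrt (x \<tau> t)))\<^sup>2 = x \<tau> t * ln (B + sqrt (x \<tau> t)) ^ m" for \<tau> t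
    using x1(3)[of \<tau> t] by (subst root_llog_square[OF B]) auto
  define P where "P = (\<lambda>k t. integral {0..1} (\<lambda>y. poisson (\<rho> k) (t - y) * \<phi> y))"
  define Nr where "Nr = (\<lambda>t. Max ((\<lambda>k. P k t) ` {..K}))"
  define N where "N = (\<lambda>t. Max ((\<lambda>k. poisson_op (\<rho> k) (\<lambda>y. ennreal (\<phi> y)) t) ` {..K}))"
  have P_op: "poisson_op (\<rho> k) (\<lambda>y. ennreal (\<phi> y)) t = ennreal (P k t)" for k t
  proof -
    have "poisson_op (\<rho> k) (\<lambda>y. ennreal (\<phi> y)) t = (\<integral>\<^sup>+y. ennreal (poisson (\<rho> k) (t - y) * \<phi> y) \<partial>circle)"
      unfolding poisson_op_def using poisson_pos[OF \<rho>] \<phi>0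
      by (intro nn_integral_cong) (simp add: ennreal_mult less_imp_le)
    also have "\<dots> = ennreal (P k t)"
      unfolding P_def
      by (intro nn_integral_circle continuous_on_mult continuous_on_poisson \<rho> c\<phi> continuous_intros mult_nonneg_nonneg \<phi>0
          less_imp_le[OF poisson_pos])
    finally show ?thesis .
  qed
  have NN: "N t = ennreal (Nr t)" for t
  proof -
    have "ennreal (Max ((\<lambda>k. P k t) ` {..K})) = Max (ennreal ` ((\<lambda>k. P k t) ` {..K}))"
      by (intro mono_Max_commute) (auto simp: mono_def ennreal_leI)
    then show ?thesis by (simp add: N_def Nr_def P_op image_image)
  qed
  have P_Nr: "P k t \<le> Nr t" if "k \<le> K" for k t
    unfolding Nr_def using that by (intro Max_ge) auto
  have Nr0: "0 \<le> Nr t" for t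
  proof -
    have "0 \<le> P 0 t" unfolding P_def
      by (intro Henstock_Kurzweil_Integration.integral_nonneg integrable_continuous_interval continuous_on_mult
          continuous_on_poisson \<rho> c\<phi> continuous_intros mult_nonneg_nonneg \<phi>0 less_imp_le[OF poisson_pos])
    then show ?thesis using P_Nr[of 0 t] by simp
  qed
  \<comment> \<open>\<open>256 = 16\<^sup>2\<close> comes from \<open>poisson_scale_le\<close>, and
    \<open>2 ^ m\<close> from \<open>ln x = 2 * ln (sqrt x)\<close>.\<close>
  define w where "w = (\<lambda>t. 2 ^ m * 256 * (Nr t)\<^sup>2)"
  have xw: "llog m (x \<tau> t) \<le> w t" if \<tau>: "scale_level K \<le> \<tau>" "\<tau> \<le> scale_level 0" for \<tau> t
  proof -
    obtain k where k: "k \<le> K" "scale_level k \<le> \<tau>" "\<tau> \<le> 2 * scale_level k"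
      using scale_level_cover[OF \<tau>] by blast
    have "0 < \<tau>" using k scale_level_pos[of k] by linarith
    then have r: "0 \<le> exp (- (2 * pi * \<tau>))" "exp (- (2 * pi * \<tau>)) < 1" by auto
    have "root_llog m B (sqrt (x \<tau> t)) \<le> integral {0..1} (\<lambda>y. poisson (exp (- (2 * pi * \<tau>))) (t - y) * \<phi> y)"
      unfolding x_def \<phi>_def using A by (intro harmonic_submean \<open>finite I\<close> S B \<open>0 < \<tau>\<close>) auto
    also have "\<dots> \<le> integral {0..1} (\<lambda>y. 16 * (poisson (\<rho> k) (t - y) * \<phi> y))"
    proof (rule Henstock_Kurzweil_Integration.integral_le)
      show "(\<lambda>y. poisson (exp (- (2 * pi * \<tau>))) (t - y) * \<phi> y) integrable_on {0..1}"
        by (intro integrable_continuous_interval continuous_on_mult continuous_on_poisson r c\<phi> continuous_intros)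
      show "(\<lambda>y. 16 * (poisson (\<rho> k) (t - y) * \<phi> y)) integrable_on {0..1}"
        by (intro integrable_continuous_interval continuous_on_mult continuous_on_poisson \<rho> c\<phi> continuous_intros)
      show "poisson (exp (- (2 * pi * \<tau>))) (t - y) * \<phi> y \<le> 16 * (poisson (\<rho> k) (t - y) * \<phi> y)" for y
        using mult_right_mono[OF poisson_scale_le[OF scale_level_pos k(2,3), of "t - y"] \<phi>0[of y]] by (simp add: \<rho>_def mult.assoc)
    qed
    also have "\<dots> = 16 * P k t" unfolding P_def by (simp only: integral_mult_right)
    also have "\<dots> \<le> 16 * Nr t" using P_Nr[OF k(1)] by simp
    finally have "(root_llog m B (sqrt (x \<tau> t)))\<^sup>2 \<le> (16 * Nr t)\<^sup>2"
      by (intro power_mono root_llog_nonneg[OF B]) (auto simp: x1)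
    then have 1: "x \<tau> t * ln (B + sqrt (x \<tau> t)) ^ m \<le> 256 * (Nr t)\<^sup>2"
      unfolding sqx by (simp add: power_mult_distrib)
    have "ln (x \<tau> t) = 2 * ln (sqrt (x \<tau> t))" using x1[of \<tau> t] by (simp add: ln_sqrt)
    also have "\<dots> \<le> 2 * ln (B + sqrt (x \<tau> t))"
      using x1[of \<tau> t] by (intro mult_left_mono ln_mono) (auto simp: B_def)
    finally have "ln (x \<tau> t) ^ m \<le> (2 * ln (B + sqrt (x \<tau> t))) ^ m"
      using x1[of \<tau> t] by (intro power_mono) auto
    then have "llog m (x \<tau> t) \<le> x \<tau> t * (2 * ln (B + sqrt (x \<tau> t))) ^ m"
      unfolding llog_def using x1[of \<tau> t] by (intro mult_left_mono) auto
    also have "\<dots> = 2 ^ m * (x \<tau> t * ln (B + sqrt (x \<tau> t)) ^ m)" by (simp add: power_mult_distrib)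
    also have "\<dots> \<le> 2 ^ m * (256 * (Nr t)\<^sup>2)" using 1 by (intro mult_left_mono) auto
    finally show ?thesis by (simp add: w_def)
  qed
  define T where "T = scale_level 0"
  have T: "0 \<le> T" "scale_level K \<le> T" "0 \<le> scale_level K"
    using scale_level_pos[of 0] scale_level_antimono[of 0 K] scale_level_pos[of K] by (simp_all add: T_def less_imp_le)
  define E0 where "E0 = (\<lambda>t. integral {0..T} (\<lambda>\<tau>. \<tau> * (h \<tau> t * ln (x \<tau> t) ^ m / x \<tau> t)))"
  have h0: "0 \<le> h \<tau> t" for \<tau> t by (simp add: h_def sum_nonneg)
  have L0: "0 \<le> ln (x \<tau> t)" for \<tau> t using x1(1)[of \<tau> t] by simp
  have ne: "x \<tau> t \<noteq> 0" for \<tau> t using x1(2)[of \<tau> t] by simp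
  have cE: "continuous_on UNIV (\<lambda>z. fst z * (h (fst z) (snd z) * ln (x (fst z) (snd z)) ^ m / x (fst z) (snd z)))"
    by (intro continuous_intros ch cx) (auto simp: ne)
  have iE: "(\<lambda>\<tau>. \<tau> * (h \<tau> t * ln (x \<tau> t) ^ m / x \<tau> t)) integrable_on {b..c}" for b c t
    by (intro integrable_continuous_interval continuous_on_curry_fst[OF cE])
  have E0_nn: "0 \<le> E0 t" for t
    unfolding E0_def by (intro Henstock_Kurzweil_Integration.integral_nonneg iE)
      (auto intro!: mult_nonneg_nonneg divide_nonneg_nonneg zero_le_power L0 h0 x1)
  have cE0: "continuous_on UNIV E0"
  proof -
    have "continuous_on UNIV (\<lambda>t. integral (cbox 0 T) (\<lambda>\<tau>. \<tau> * (h \<tau> t * ln (x \<tau> t) ^ m / x \<tau> t)))"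
    proof (rule integral_continuous_on_param)
      have "continuous_on (UNIV \<times> cbox 0 T) ((\<lambda>z. fst z * (h (fst z) (snd z) * ln (x (fst z) (snd z)) ^ m / x (fst z) (snd z))) \<circ> (\<lambda>(t, \<tau>). (\<tau>, t)))"
        by (intro continuous_on_compose continuous_on_subset[OF cE]) (auto intro!: continuous_intros simp: case_prod_beta')
      then show "continuous_on (UNIV \<times> cbox 0 T) (\<lambda>(t, \<tau>). \<tau> * (h \<tau> t * ln (x \<tau> t) ^ m / x \<tau> t))"
        by (simp add: o_def case_prod_beta')
    qed
    then show ?thesis by (simp add: E0_def)
  qed
  have G1: "1 \<le> G t" for t
  proof -
    have "1 \<le> A\<^sup>2" using A by simp
    then have "1 \<le> A\<^sup>2 + (\<Sum>i\<in>I. (cmod (harmonic S (a i) (scale_level 0) t))\<^sup>2) +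
      (\<Sum>k<K. \<Sum>i\<in>I. (cmod (harmonic S (a i) (scale_level k) t - harmonic S (a i) (scale_level (Suc k)) t))\<^sup>2)"
      by (simp add: add_increasing2 sum_nonneg)
    then show ?thesis by (simp add: G_def)
  qed
  have pw: "llog m (G t) \<le> 2 * 2 ^ m * (w t + E0 t)" for t
  proof -
    define D where "D = integral {scale_level K..T} (\<lambda>\<tau>. \<tau> * h \<tau> t)"
    have "G t \<le> sqrt ((x T t)\<^sup>2 + D)"
    proof -
      have "(x T t)\<^sup>2 = A\<^sup>2 + (\<Sum>i\<in>I. (cmod (harmonic S (a i) (scale_level 0) t))\<^sup>2)"
        by (simp add: x_def energy_def T_def sum_nonneg)
      then show ?thesis
        unfolding G_def D_def h_def T_def using scale_increments_le[of S a t I K] by simp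
    qed
    then have "llog m (G t) \<le> llog m (sqrt ((x T t)\<^sup>2 + D))" by (intro llog_mono G1)
    also have "\<dots> \<le> 2 * 2 ^ m * (w t + integral {scale_level K..T} (\<lambda>\<tau>. \<tau> * (h \<tau> t * ln (x \<tau> t) ^ m / x \<tau> t)))"
      unfolding D_def
    proof (rule llog_area_pointwise[OF T(3,2)])
      show "continuous_on {scale_level K..T} (\<lambda>\<tau>. x \<tau> t)" "continuous_on {scale_level K..T} (\<lambda>\<tau>. h \<tau> t)"
        by (intro cx ch continuous_intros)+
    qed (use A xA h0 xw in \<open>auto simp: T_def\<close>)
    also have "\<dots> \<le> 2 * 2 ^ m * (w t + E0 t)"
      unfolding E0_def using T
      by (intro mult_left_mono add_left_mono integral_subset_le iE)
        (auto intro!: mult_nonneg_nonneg divide_nonneg_nonneg zero_le_power L0 h0 x1)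
    finally show ?thesis .
  qed
  have cG: "continuous_on UNIV G"
    unfolding G_def by (intro continuous_intros continuous_on_harmonic)
  define V where "V = integral {0..1} (\<lambda>t. llog m (x 0 t))"
  have cV: "continuous_on UNIV (\<lambda>t. llog m (x 0 t))" by (intro cll cx continuous_intros x1)
  have V0: "0 \<le> V" unfolding V_def
    by (intro Henstock_Kurzweil_Integration.integral_nonneg integrable_continuous_interval continuous_on_subset[OF cV] llog_nonneg x1) auto
  have m\<phi> [measurable]: "(\<lambda>y. ennreal (\<phi> y)) \<in> borel_measurable circle"
    by (intro measurable_circle measurable_compose[OF borel_measurable_continuous_onI[OF c\<phi>]]) simp
  have mN [measurable]: "N \<in> borel_measurable circle"
    unfolding N_def by (intro borel_measurable_Max measurable_poisson_op[OF \<rho>] m\<phi>) auto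
  have mE0 [measurable]: "(\<lambda>y. ennreal (E0 y)) \<in> borel_measurable circle"
    by (intro measurable_circle measurable_compose[OF borel_measurable_continuous_onI[OF cE0]]) simp
  have IN: "(\<integral>\<^sup>+t. (N t)\<^sup>2 \<partial>circle) \<le> ennreal (1024 * V)"
  proof -
    define M where "M = root_llog m B (sqrt (sqrt (A\<^sup>2 + (\<Sum>i\<in>I. (\<Sum>n\<in>S. cmod (a i n))\<^sup>2))))"
    have "(\<integral>\<^sup>+t. (N t)\<^sup>2 \<partial>circle) \<le> 1024 * (\<integral>\<^sup>+t. (ennreal (\<phi> t))\<^sup>2 \<partial>circle)"
      unfolding N_def
    proof (rule poisson_maximal[OF \<rho> m\<phi>])
      show "ennreal (\<phi> t) \<le> ennreal M" for t
        unfolding \<phi>_def M_def x_def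
        by (intro ennreal_leI root_llog_mono[OF B] real_sqrt_le_mono energy_bounded) (auto simp: energy_def sum_nonneg)
    qed simp
    also have "\<dots> = 1024 * (\<integral>\<^sup>+t. ennreal ((\<phi> t)\<^sup>2) \<partial>circle)"
      by (simp add: ennreal_power \<phi>0)
    also have "\<dots> \<le> 1024 * (\<integral>\<^sup>+t. ennreal (llog m (x 0 t)) \<partial>circle)"
    proof (intro mult_left_mono nn_integral_mono ennreal_leI)
      fix t
      have "8 * 8 \<le> x 0 t" using x1(4)[of 0 t] by simp
      then have s8: "8 \<le> sqrt (x 0 t)" by (intro real_le_rsqrt) (simp add: power2_eq_square)
      then have "8 * sqrt (x 0 t) \<le> sqrt (x 0 t) * sqrt (x 0 t)" by (intro mult_right_mono) (auto simp: x1)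
      then have "8 * sqrt (x 0 t) \<le> x 0 t" using x1(3)[of 0 t] by simp
      \<comment> \<open>\<open>B \<le> A / 2 \<le> x / 2\<close> and
        \<open>sqrt x \<le> x / 8\<close>, by the bounds \<open>2 * (m + 4) \<le> A\<close> and
        \<open>64 \<le> A\<close>.\<close>
      then have "B + sqrt (x 0 t) \<le> x 0 t" using A(2) xA[of 0 t] x1(4)[of 0 t] by (simp add: B_def)
      then have "ln (B + sqrt (x 0 t)) ^ m \<le> ln (x 0 t) ^ m"
        using s8 x1(3)[of 0 t] by (intro power_mono ln_mono ln_ge_zero) (auto simp: B_def)
      then show "(\<phi> t)\<^sup>2 \<le> llog m (x 0 t)"
        unfolding \<phi>sq llog_def using x1 by (intro mult_left_mono)
    qed simp
    also have "(\<integral>\<^sup>+t. ennreal (llog m (x 0 t)) \<partial>circle) = ennreal V"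
      unfolding V_def by (intro nn_integral_circle cV llog_nonneg x1)
    finally show ?thesis using V0 by (simp add: ennreal_mult)
  qed
  have IE: "(\<integral>\<^sup>+t. ennreal (E0 t) \<partial>circle) \<le> ennreal V"
  proof -
    have "(\<integral>\<^sup>+t. ennreal (E0 t) \<partial>circle) = ennreal (integral {0..1} E0)"
      by (intro nn_integral_circle cE0 E0_nn)
    also have "integral {0..1} E0 \<le> V"
      unfolding E0_def V_def h_def x_def using A T by (intro energy_area S) auto
    finally show ?thesis by (simp add: ennreal_leI)
  qed
  have "ennreal (integral {0..1} (\<lambda>t. llog m (G t))) = (\<integral>\<^sup>+t. ennreal (llog m (G t)) \<partial>circle)"
    by (intro nn_integral_circle[symmetric] cll cG G1 llog_nonneg)
  also have "\<dots> \<le> (\<integral>\<^sup>+t. ennreal (2 * 2 ^ m) * (ennreal (2 ^ m * 256) * (N t)\<^sup>2 + ennreal (E0 t)) \<partial>circle)"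
  proof (intro nn_integral_mono)
    fix t
    have "ennreal (llog m (G t)) \<le> ennreal (2 * 2 ^ m * (w t + E0 t))" by (intro ennreal_leI pw)
    also have "\<dots> = ennreal (2 * 2 ^ m) * (ennreal (w t) + ennreal (E0 t))"
    proof -
      have "0 \<le> w t" by (simp add: w_def)
      then show ?thesis using E0_nn[of t]
        by (subst ennreal_mult) (simp_all only: ennreal_plus add_nonneg_nonneg, simp_all)
    qed
    also have "ennreal (w t) = ennreal (2 ^ m * 256) * (N t)\<^sup>2"
      unfolding NN w_def ennreal_power[OF Nr0] by (rule ennreal_mult) auto
    finally show "ennreal (llog m (G t)) \<le> ennreal (2 * 2 ^ m) * (ennreal (2 ^ m * 256) * (N t)\<^sup>2 + ennreal (E0 t))" .
  qed
  also have "\<dots> = ennreal (2 * 2 ^ m) * (ennreal (2 ^ m * 256) * (\<integral>\<^sup>+t. (N t)\<^sup>2 \<partial>circle) + (\<integral>\<^sup>+t. ennreal (E0 t) \<partial>circle))"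
    by (subst nn_integral_cmult; measurable?) (simp add: nn_integral_add nn_integral_cmult)
  also have "\<dots> \<le> ennreal (2 * 2 ^ m) * (ennreal (2 ^ m * 256) * ennreal (1024 * V) + ennreal V)"
    by (intro mult_left_mono add_mono IN IE) auto
  also have "\<dots> = ennreal (2 * 2 ^ m * (2 ^ m * 256 * 1024 + 1) * V)"
    using V0 by (simp add: algebra_simps flip: ennreal_mult ennreal_plus)
  finally have "integral {0..1} (\<lambda>t. llog m (G t)) \<le> 2 * 2 ^ m * (2 ^ m * 256 * 1024 + 1) * V"
    using V0 by (subst (asm) ennreal_le_iff) auto
  then show ?thesis by (simp add: V_def x_def energy_def harmonic_0)
qed

section \<open>The one-variable inequality\<close>

lemma weighted_sum_square_le:
  fixes \<delta> :: "'j \<Rightarrow> real" and z :: "'j \<Rightarrow> complex"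
  assumes "\<And>j. j \<in> J \<Longrightarrow> 0 \<le> \<delta> j"
  shows "(cmod (\<Sum>j\<in>J. of_real (\<delta> j) * z j))\<^sup>2 \<le> (\<Sum>j\<in>J. \<delta> j) * (\<Sum>j\<in>J. \<delta> j * (cmod (z j))\<^sup>2)"
proof -
  define f where "f = (\<lambda>j. complex_of_real (sqrt (\<delta> j)))"
  define g where "g = (\<lambda>j. complex_of_real (sqrt (\<delta> j)) * cnj (z j))"
  have "(\<Sum>j\<in>J. of_real (\<delta> j) * z j) = (\<Sum>j\<in>J. f j * cnj (g j))"
  proof (intro sum.cong refl)
    fix j assume "j \<in> J"
    then have "complex_of_real (sqrt (\<delta> j)) * complex_of_real (sqrt (\<delta> j)) = of_real (\<delta> j)"
      using assms by (simp flip: of_real_mult)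
    then show "of_real (\<delta> j) * z j = f j * cnj (g j)" by (simp add: f_def g_def flip: mult.assoc)
  qed
  moreover have "(\<Sum>j\<in>J. (cmod (f j))\<^sup>2) = (\<Sum>j\<in>J. \<delta> j)"
    using assms by (intro sum.cong refl) (simp add: f_def)
  moreover have "(\<Sum>j\<in>J. (cmod (g j))\<^sup>2) = (\<Sum>j\<in>J. \<delta> j * (cmod (z j))\<^sup>2)"
    using assms by (intro sum.cong refl) (simp add: g_def norm_mult power_mult_distrib)
  ultimately show ?thesis using sum_mult_le[of f g J] by simp
qed

text \<open>The value beyond the last index is taken to be 0, so that the last difference is the
  last value itself and the sum telescopes completely.\<close>

lemma sum_telescope_int:
  fixes lam :: "int \<Rightarrow> real"
  assumes "n < h"
  shows "(\<Sum>j\<in>{n..<h}. lam j - (if j + 1 < h then lam (j + 1) else 0)) = lam n"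
  using assms
proof (induction "nat (h - n)" arbitrary: n)
  case (Suc k)
  have e: "{n..<h} = insert n {n + 1..<h}" using Suc(3) by auto
  show ?case
  proof (cases "n + 1 < h")
    case True
    then have "(\<Sum>j\<in>{n + 1..<h}. lam j - (if j + 1 < h then lam (j + 1) else 0)) = lam (n + 1)"
      using Suc(1)[of "n + 1"] Suc(2) by simp
    then show ?thesis unfolding e using True by simp
  next
    case False
    then have "{n..<h} = {n}" using Suc(3) by auto
    then show ?thesis using False by simp
  qed
qed simp

text \<open>Abel summation writes the weighted block as a combination, with nonnegative weights
  \<delta> of total mass \<open>lam l\<close>, of the partial sums over \<open>{l..j}\<close>. Each
  of these is a difference of two Riesz projections of the same polynomial over \<open>S\<close>.
  Cauchy-Schwarz for the weights gives the factor \<open>L\<close>, the two terms of the difference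
  give the factor 2.\<close>

lemma abel_block:
  fixes b :: "int \<Rightarrow> complex" and lam :: "int \<Rightarrow> real"
  assumes S: "finite S" "{l..<h} \<subseteq> S"
    and mono: "\<And>n. l \<le> n \<Longrightarrow> n + 1 < h \<Longrightarrow> lam (n + 1) \<le> lam n" and pos: "\<And>n. l \<le> n \<Longrightarrow> n < h \<Longrightarrow> 0 \<le> lam n"
    and L: "lam l \<le> L" "l < h"
  defines "\<delta> \<equiv> \<lambda>j. lam j - (if j + 1 < h then lam (j + 1) else 0)"
  shows "\<And>j. j \<in> {l..<h} \<Longrightarrow> 0 \<le> \<delta> j" and "(\<Sum>j\<in>{l..<h}. \<delta> j) \<le> L"
    and "(cmod (trig {l..<h} (\<lambda>n. of_real (lam n) * b n) t))\<^sup>2 \<le>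
      2 * L * (\<Sum>j\<in>{l..<h}. \<delta> j * ((cmod (trig {n\<in>S. l \<le> n} b t))\<^sup>2 + (cmod (trig {n\<in>S. j + 1 \<le> n} b t))\<^sup>2))"
proof -
  show \<delta>0: "0 \<le> \<delta> j" if "j \<in> {l..<h}" for j
    using that mono[of j] pos[of j] by (auto simp: \<delta>_def)
  show \<delta>L: "(\<Sum>j\<in>{l..<h}. \<delta> j) \<le> L"
    unfolding \<delta>_def using sum_telescope_int[OF L(2), of lam] L(1) by simp
  define Z where "Z = (\<lambda>j. trig {n\<in>S. l \<le> n} b t - trig {n\<in>S. j + 1 \<le> n} b t)"
  have Z: "Z j = trig {l..j} b t" if "j \<in> {l..<h}" for j
  proof -
    have fin: "finite {n\<in>S. l \<le> n}" using S by simp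
    have "{n\<in>S. l \<le> n} = {l..j} \<union> {n\<in>S. j + 1 \<le> n}" "{l..j} \<inter> {n\<in>S. j + 1 \<le> n} = {}"
      using that S(2) by auto
    then have "trig {n\<in>S. l \<le> n} b t = trig {l..j} b t + trig {n\<in>S. j + 1 \<le> n} b t"
      unfolding trig_def using sum.union_disjoint[of "{l..j}" "{n\<in>S. j + 1 \<le> n}"] S(1) by simp
    then show ?thesis by (simp add: Z_def)
  qed
  define e where "e = (\<lambda>n. b n * cis (2 * pi * of_int n * t))"
  have "trig {l..<h} (\<lambda>n. of_real (lam n) * b n) t = (\<Sum>n\<in>{l..<h}. \<Sum>j\<in>{n..<h}. of_real (\<delta> j) * e n)"
    unfolding trig_def
  proof (intro sum.cong refl)
    fix n assume n: "n \<in> {l..<h}"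
    have "(\<Sum>j\<in>{n..<h}. of_real (\<delta> j) * e n) = of_real (\<Sum>j\<in>{n..<h}. \<delta> j) * e n"
      by (simp add: sum_distrib_right)
    also have "(\<Sum>j\<in>{n..<h}. \<delta> j) = lam n"
      unfolding \<delta>_def using n by (intro sum_telescope_int) auto
    finally show "of_real (lam n) * b n * cis (2 * pi * of_int n * t) = (\<Sum>j\<in>{n..<h}. of_real (\<delta> j) * e n)"
      by (simp add: e_def mult.assoc)
  qed
  also have "\<dots> = (\<Sum>(n, j)\<in>(SIGMA n:{l..<h}. {n..<h}). of_real (\<delta> j) * e n)"
    by (rule sum.Sigma) auto
  also have "\<dots> = (\<Sum>(j, n)\<in>(SIGMA j:{l..<h}. {l..j}). of_real (\<delta> j) * e n)"
    by (rule sum.reindex_bij_witness[of _ "\<lambda>(j, n). (n, j)" "\<lambda>(n, j). (j, n)"]) auto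
  also have "\<dots> = (\<Sum>j\<in>{l..<h}. \<Sum>n\<in>{l..j}. of_real (\<delta> j) * e n)"
    by (rule sum.Sigma[symmetric]) auto
  also have "\<dots> = (\<Sum>j\<in>{l..<h}. of_real (\<delta> j) * Z j)"
    by (intro sum.cong refl) (simp add: Z trig_def e_def sum_distrib_left)
  finally have "(cmod (trig {l..<h} (\<lambda>n. of_real (lam n) * b n) t))\<^sup>2
      \<le> (\<Sum>j\<in>{l..<h}. \<delta> j) * (\<Sum>j\<in>{l..<h}. \<delta> j * (cmod (Z j))\<^sup>2)"
    using weighted_sum_square_le[of "{l..<h}" \<delta> Z] \<delta>0 by simp
  also have "\<dots> \<le> L * (\<Sum>j\<in>{l..<h}. \<delta> j * (2 * ((cmod (trig {n\<in>S. l \<le> n} b t))\<^sup>2 + (cmod (trig {n\<in>S. j + 1 \<le> n} b t))\<^sup>2)))"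
  proof (intro mult_mono sum_mono \<delta>L)
    show "0 \<le> L" using L pos[of l] by simp
    show "0 \<le> (\<Sum>j\<in>{l..<h}. \<delta> j * (cmod (Z j))\<^sup>2)" using \<delta>0 by (auto intro!: sum_nonneg)
    fix j assume j: "j \<in> {l..<h}"
    show "\<delta> j \<le> \<delta> j" "0 \<le> \<delta> j" "0 \<le> (cmod (Z j))\<^sup>2" using \<delta>0[OF j] by auto
    have "(cmod (Z j))\<^sup>2 \<le> (cmod (trig {n\<in>S. l \<le> n} b t) + cmod (trig {n\<in>S. j + 1 \<le> n} b t))\<^sup>2"
      unfolding Z_def by (intro power_mono norm_triangle_ineq4) auto
    also have "\<dots> \<le> 2 * ((cmod (trig {n\<in>S. l \<le> n} b t))\<^sup>2 + (cmod (trig {n\<in>S. j + 1 \<le> n} b t))\<^sup>2)"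
      using sum_squares_bound[of "cmod (trig {n\<in>S. l \<le> n} b t)" "cmod (trig {n\<in>S. j + 1 \<le> n} b t)"]
      by (simp add: power2_eq_square algebra_simps)
    finally show "(cmod (Z j))\<^sup>2 \<le> 2 * ((cmod (trig {n\<in>S. l \<le> n} b t))\<^sup>2 + (cmod (trig {n\<in>S. j + 1 \<le> n} b t))\<^sup>2)" .
  qed
  also have "\<dots> = 2 * L * (\<Sum>j\<in>{l..<h}. \<delta> j * ((cmod (trig {n\<in>S. l \<le> n} b t))\<^sup>2 + (cmod (trig {n\<in>S. j + 1 \<le> n} b t))\<^sup>2))"
    by (simp add: sum_distrib_left mult_ac)
  finally show "(cmod (trig {l..<h} (\<lambda>n. of_real (lam n) * b n) t))\<^sup>2 \<le>
      2 * L * (\<Sum>j\<in>{l..<h}. \<delta> j * ((cmod (trig {n\<in>S. l \<le> n} b t))\<^sup>2 + (cmod (trig {n\<in>S. j + 1 \<le> n} b t))\<^sup>2))" .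
qed

definition block_lo :: "nat \<Rightarrow> int" where
  "block_lo k = (if k = 0 then 0 else 2 ^ (k - 1))"

lemma dyadic_block_nat: "dyadic_block (int k) = {block_lo k..<2 ^ k}"
  by (auto simp: dyadic_block_def block_lo_def)

lemma block_lo_less: "block_lo k < 2 ^ k" "0 \<le> block_lo k"
  by (auto simp: block_lo_def)

text \<open>The symbol of the Poisson increment of level \<open>k\<close>; at \<open>k = 0\<close>
  there is no previous level and the extension itself is taken.\<close>

definition scale_multiplier :: "nat \<Rightarrow> int \<Rightarrow> real" where
  "scale_multiplier k n = exp (- (2 * pi * of_int n * scale_level k)) -
     (if k = 0 then 0 else exp (- (2 * pi * of_int n * scale_level (k - 1))))"

text \<open>
  On the block of index \<open>k \<ge> 1\<close> the multiplier is \<open>w - w\<^sup>2\<close> with \<open>w = 2 powr (- n / 2 ^ k)\<close> between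
  \<open>1/2\<close> and \<open>1/\<surd>2\<close>, where \<open>w - w\<^sup>2\<close> is decreasing in \<open>w\<close>.
\<close>

lemma scale_multiplier_bounds:
  assumes n: "block_lo k \<le> n" "n < 2 ^ k"
  shows "1 / 5 \<le> scale_multiplier k n"
    and "n + 1 < 2 ^ k \<Longrightarrow> scale_multiplier k n \<le> scale_multiplier k (n + 1)"
proof -
  define w where "w = (\<lambda>n::int. exp (- (2 * pi * of_int n * scale_level k)))"
  have mult: "scale_multiplier k n = w n - w n * w n" if "k \<noteq> 0" for n
  proof -
    have "scale_level (k - 1) = 2 * scale_level k" using that scale_level_Suc[of "k - 1"] by simp
    then have "exp (- (2 * pi * of_int n * scale_level (k - 1))) = w n * w n"
      by (simp add: w_def flip: exp_add)
    then show ?thesis using that by (simp add: scale_multiplier_def w_def)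
  qed
  have w_eq: "w n = exp (- (ln 2 * (of_int n / 2 ^ k)))" for n
    by (simp add: w_def scale_level_def)
  have w_lo: "1 / 2 \<le> w n" if "n < 2 ^ k" for n
  proof -
    have "real_of_int n \<le> real_of_int (2 ^ k)" using that by (simp only: of_int_le_iff)
    then have "of_int n / 2 ^ k \<le> (1 :: real)" by simp
    then have "ln 2 * (of_int n / 2 ^ k) \<le> ln 2 * (1::real)" by (intro mult_left_mono) auto
    then have "- ln (2::real) \<le> - (ln 2 * (of_int n / 2 ^ k))" by simp
    then have "exp (- ln 2 :: real) \<le> w n" unfolding w_eq by (simp only: exp_le_cancel_iff)
    then show ?thesis by (simp add: exp_minus)
  qed
  have w_hi: "w n * w n \<le> 1 / 2" if "k \<noteq> 0" "block_lo k \<le> n" for n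
  proof -
    have "real_of_int (2 ^ (k - 1)) \<le> real_of_int n" using that by (simp only: of_int_le_iff) (simp add: block_lo_def)
    then have "(2::real) ^ k \<le> 2 * of_int n" using that(1) by (cases k) auto
    then have "1 \<le> 2 * (of_int n / 2 ^ k :: real)" by (simp add: field_simps)
    then have "ln 2 * 1 \<le> ln 2 * (2 * (of_int n / 2 ^ k :: real))" by (intro mult_left_mono) auto
    moreover have "w n * w n = exp (- (ln 2 * (2 * (of_int n / 2 ^ k))))"
      unfolding w_eq exp_add[symmetric] by (simp add: algebra_simps)
    ultimately have "w n * w n \<le> exp (- ln 2)" by simp
    then show ?thesis by (simp add: exp_minus)
  qed
  show "1 / 5 \<le> scale_multiplier k n"
  proof (cases "k = 0")
    case True
    then have "n = 0" using n by (auto simp: block_lo_def)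
    then show ?thesis using True by (simp add: scale_multiplier_def)
  next
    case False
    define v where "v = w n"
    have v: "1 / 2 \<le> v" "v * v \<le> 1 / 2" using w_lo[OF n(2)] w_hi[OF False n(1)] by (simp_all add: v_def)
    \<comment> \<open>A rational bound slightly above \<open>1 / \<surd>2\<close>; on
      \<open>[1/2, 72/100]\<close> the parabola \<open>v - v * v\<close> lies above its chord, which
      is at least 1/5.\<close>
    have "v \<le> 72 / 100"
    proof (rule ccontr)
      assume "\<not> v \<le> 72 / 100"
      then have "(72 / 100) * (72 / 100) < v * v" by (intro mult_strict_mono) auto
      then show False using v by simp
    qed
    then have "0 \<le> (v - 1 / 2) * (72 / 100 - v)" using v by simp
    moreover have "(v - 1 / 2) * (72 / 100 - v) = 122 / 100 * v - 36 / 100 - v * v" by (simp add: field_simps)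
    ultimately have "1 / 5 \<le> v - v * v" using \<open>v \<le> 72 / 100\<close> by linarith
    then show ?thesis using mult[OF False] by (simp add: v_def)
  qed
  show "scale_multiplier k n \<le> scale_multiplier k (n + 1)" if "n + 1 < 2 ^ k"
  proof (cases "k = 0")
    case True
    then show ?thesis using n that by (auto simp: block_lo_def)
  next
    case False
    have "w (n + 1) \<le> w n" unfolding w_def using scale_level_pos[of k] by simp
    moreover have "1 / 2 \<le> w n" "1 / 2 \<le> w (n + 1)" using w_lo n that by auto
    ultimately have "0 \<le> (w n - w (n + 1)) * (w n + w (n + 1) - 1)" by (intro mult_nonneg_nonneg) auto
    then show ?thesis unfolding mult[OF False] by (simp add: algebra_simps)
  qed
qed

text \<open>The factors of the constant belong to four comparisons: \<open>Sf\<close> with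
  \<open>y\<close>, \<open>y\<close> with \<open>x\<close> (the Riesz projections, where the
  logarithm is lost), \<open>x\<close> with \<open>G\<close>, and \<open>G\<close> with the
  polynomial. The constant depends neither on \<open>I\<close> nor on \<open>K\<close>, as the
  iteration over the variables requires.\<close>

theorem LP_one_variable:
  fixes a :: "'i \<Rightarrow> int \<Rightarrow> complex"
  assumes "finite I" and A: "64 \<le> A" "exp (2 * (real m + 1)) \<le> A" "2 * (real m + 5) \<le> A"
  shows "integral {0..1} (\<lambda>t. llog m (sqrt (A\<^sup>2 + (\<Sum>i\<in>I. \<Sum>k\<le>K. (cmod (trig (dyadic_block (int k)) (a i) t))\<^sup>2)))) \<le>
      (A * 2 ^ m * (2 * 3 ^ (m + 1)) * (4 * 2 ^ (m + 1)) * (2 * 2 ^ (m + 1) * (2 ^ (m + 1) * 256 * 1024 + 1))) *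
      integral {0..1} (\<lambda>t. llog (m + 1) (sqrt (A\<^sup>2 + (\<Sum>i\<in>I. (cmod (trig {0..<2 ^ K} (a i) t))\<^sup>2))))"
proof -
  define S where "S = {0..<2 ^ K :: int}"
  have finS: "finite S" by (simp add: S_def)
  have Sblk: "{block_lo k..<2 ^ k} \<subseteq> S" if "k \<le> K" for k
  proof -
    have "(2::int) ^ k \<le> 2 ^ K" using that by (intro power_increasing) auto
    then show ?thesis using block_lo_less(2)[of k] by (auto simp: S_def)
  qed
  define b where "b = (\<lambda>i k n. a i n * of_real (scale_multiplier k n))"
  define lam where "lam = (\<lambda>k n. 1 / scale_multiplier k n)"
  define \<delta> where "\<delta> = (\<lambda>k j. lam k j - (if j + 1 < 2 ^ k then lam k (j + 1) else 0))"
  have lampos: "0 \<le> lam k n" if "block_lo k \<le> n" "n < 2 ^ k" for k n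
    using scale_multiplier_bounds(1)[OF that] by (simp add: lam_def)
  have lammono: "lam k (n + 1) \<le> lam k n" if "block_lo k \<le> n" "n + 1 < 2 ^ k" for k n
    using scale_multiplier_bounds(1)[of k n] scale_multiplier_bounds(2)[of k n] that
    unfolding lam_def by (intro divide_left_mono) auto
  have lam5: "lam k (block_lo k) \<le> 5" for k
    using scale_multiplier_bounds(1)[OF order_refl block_lo_less(1), of k] by (simp add: lam_def field_simps)
  have ab1: "0 \<le> \<delta> k j" if "k \<le> K" "j \<in> {block_lo k..<2 ^ k}" for k j
    unfolding \<delta>_def by (rule abel_block(1)[where S = S and l = "block_lo k" and h = "2 ^ k" and lam = "lam k" and L = 5,
      OF finS Sblk[OF that(1)] lammono lampos lam5 block_lo_less(1) that(2)])
  have ab2: "(\<Sum>j\<in>{block_lo k..<2 ^ k}. \<delta> k j) \<le> 5" if "k \<le> K" for k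
    unfolding \<delta>_def by (rule abel_block(2)[where S = S and l = "block_lo k" and h = "2 ^ k" and lam = "lam k" and L = 5,
      OF finS Sblk[OF that(1)] lammono lampos lam5 block_lo_less(1)])
  have ab3: "(cmod (trig {block_lo k..<2 ^ k} (\<lambda>n. of_real (lam k n) * \<beta> n) t))\<^sup>2 \<le>
      2 * 5 * (\<Sum>j\<in>{block_lo k..<2 ^ k}. \<delta> k j * ((cmod (trig {n\<in>S. block_lo k \<le> n} \<beta> t))\<^sup>2
        + (cmod (trig {n\<in>S. j + 1 \<le> n} \<beta> t))\<^sup>2))" if "k \<le> K" for k \<beta> t
    unfolding \<delta>_def by (rule abel_block(3)[where S = S and l = "block_lo k" and h = "2 ^ k" and lam = "lam k" and L = 5,
      OF finS Sblk[OF that(1)] lammono lampos lam5 block_lo_less(1)])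
  \<comment> \<open>One component for each block and Abel index, carrying the weight
    \<open>sqrt (\<delta> k j)\<close>. The Boolean doubles it and selects which of the two Riesz
    projections is taken, at the start of the block or at \<open>j + 1\<close>.\<close>
  define J where "J = I \<times> ((SIGMA k:{..K}. {block_lo k..<2 ^ k}) \<times> (UNIV :: bool set))"
  define c where "c = (\<lambda>(i, (k, j), \<epsilon>::bool) n. of_real (sqrt (\<delta> k j)) * b i k n)"
  define N where "N = (\<lambda>(i :: 'i, (k, j), \<epsilon>). if \<epsilon> then block_lo k else j + 1)"
  have finJ: "finite J" using \<open>finite I\<close> by (auto simp: J_def)
  have sumJ: "(\<Sum>q\<in>J. F q) = (\<Sum>i\<in>I. \<Sum>k\<le>K. \<Sum>j\<in>{block_lo k..<2 ^ k}. F (i, (k, j), True) + F (i, (k, j), False))"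
    for F :: "'i \<times> (nat \<times> int) \<times> bool \<Rightarrow> real"
    unfolding J_def sum.cartesian_product[symmetric, where g = "\<lambda>i q. F (i, q)", simplified]
      sum.cartesian_product[symmetric, where g = "\<lambda>kj \<epsilon>. F (_, kj, \<epsilon>)", simplified]
    by (subst sum.Sigma) (auto simp: UNIV_bool case_prod_beta' add.commute intro!: sum.cong)
  define x where "x = (\<lambda>t. sqrt (A\<^sup>2 + (\<Sum>q\<in>J. (cmod (trig S (c q) t))\<^sup>2)))"
  define y where "y = (\<lambda>t. sqrt (1 + (\<Sum>q\<in>J. (cmod (trig {n\<in>S. N q \<le> n} (c q) t))\<^sup>2)))"
  define Sf where "Sf = (\<lambda>t. sqrt (A\<^sup>2 + (\<Sum>i\<in>I. \<Sum>k\<le>K. (cmod (trig (dyadic_block (int k)) (a i) t))\<^sup>2)))"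
  define G where "G = (\<lambda>t. sqrt (A\<^sup>2 + (\<Sum>i\<in>I. \<Sum>k\<le>K. (cmod (trig S (b i k) t))\<^sup>2)))"
  have ct: "cmod (trig T (c (i, (k, j), \<epsilon>)) t) = sqrt (\<delta> k j) * cmod (trig T (b i k) t)"
    if "k \<le> K" "j \<in> {block_lo k..<2 ^ k}" for T i k j \<epsilon> t
    using ab1[OF that(1) that(2)] unfolding c_def prod.case trig_scale by (simp add: norm_mult)
  have ct2: "(cmod (trig T (c (i, (k, j), \<epsilon>)) t))\<^sup>2 = \<delta> k j * (cmod (trig T (b i k) t))\<^sup>2"
    if "k \<le> K" "j \<in> {block_lo k..<2 ^ k}" for T i k j \<epsilon> t
    unfolding ct[OF that] power_mult_distrib using ab1[OF that] by simp
  \<comment> \<open>The weights of a block sum to at most 5 and the Boolean doubles them; 10 is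
    below \<open>4\<^sup>2\<close>.\<close>
  have xG: "x t \<le> 4 * G t" for t
  proof -
    have "(\<Sum>q\<in>J. (cmod (trig S (c q) t))\<^sup>2) = (\<Sum>i\<in>I. \<Sum>k\<le>K. 2 * (\<Sum>j\<in>{block_lo k..<2 ^ k}. \<delta> k j) * (cmod (trig S (b i k) t))\<^sup>2)"
      unfolding sumJ by (intro sum.cong refl) (simp add: ct2 sum_distrib_right sum_distrib_left mult.assoc)
    also have "\<dots> \<le> (\<Sum>i\<in>I. \<Sum>k\<le>K. 10 * (cmod (trig S (b i k) t))\<^sup>2)"
      using ab2 by (intro sum_mono mult_right_mono) auto
    also have "\<dots> = 10 * (\<Sum>i\<in>I. \<Sum>k\<le>K. (cmod (trig S (b i k) t))\<^sup>2)" by (simp add: sum_distrib_left)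
    finally have le10: "(\<Sum>q\<in>J. (cmod (trig S (c q) t))\<^sup>2) \<le> 10 * (\<Sum>i\<in>I. \<Sum>k\<le>K. (cmod (trig S (b i k) t))\<^sup>2)" .
    have "0 \<le> (\<Sum>i\<in>I. \<Sum>k\<le>K. (cmod (trig S (b i k) t))\<^sup>2)" by (simp add: sum_nonneg)
    moreover have "\<alpha> + \<xi> \<le> 16 * (\<alpha> + \<eta>)" if "0 \<le> \<eta>" "\<xi> \<le> 10 * \<eta>" "0 \<le> \<alpha>" for \<alpha> \<xi> \<eta> :: real
      using that by simp
    ultimately have "A\<^sup>2 + (\<Sum>q\<in>J. (cmod (trig S (c q) t))\<^sup>2) \<le> 16 * (A\<^sup>2 + (\<Sum>i\<in>I. \<Sum>k\<le>K. (cmod (trig S (b i k) t))\<^sup>2))"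
      using le10 zero_le_power2[of A] by blast
    then have "x t \<le> sqrt (16 * (A\<^sup>2 + (\<Sum>i\<in>I. \<Sum>k\<le>K. (cmod (trig S (b i k) t))\<^sup>2)))"
      unfolding x_def by (rule real_sqrt_le_mono)
    moreover have "sqrt 16 = (4::real)" by (rule real_sqrt_unique) auto
    ultimately show ?thesis by (simp only: real_sqrt_mult G_def)
  qed
  \<comment> \<open>Abel summation costs a factor 10, absorbed by \<open>A\<^sup>2\<close>.\<close>
  have SfY: "Sf t \<le> A * y t" for t
  proof -
    define Y where "Y = (\<Sum>q\<in>J. (cmod (trig {n\<in>S. N q \<le> n} (c q) t))\<^sup>2)"
    have Y0: "0 \<le> Y" by (simp add: Y_def sum_nonneg)
    have "(\<Sum>i\<in>I. \<Sum>k\<le>K. (cmod (trig (dyadic_block (int k)) (a i) t))\<^sup>2)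
      \<le> (\<Sum>i\<in>I. \<Sum>k\<le>K. 2 * 5 * (\<Sum>j\<in>{block_lo k..<2 ^ k}. \<delta> k j * ((cmod (trig {n\<in>S. block_lo k \<le> n} (b i k) t))\<^sup>2
           + (cmod (trig {n\<in>S. j + 1 \<le> n} (b i k) t))\<^sup>2)))"
    proof (intro sum_mono)
      fix i k assume k: "k \<in> {..K}"
      have "trig (dyadic_block (int k)) (a i) t = trig {block_lo k..<2 ^ k} (\<lambda>n. of_real (lam k n) * b i k n) t"
        unfolding dyadic_block_nat trig_def
      proof (intro sum.cong refl)
        fix n assume "n \<in> {block_lo k..<2 ^ k}"
        then have "scale_multiplier k n \<noteq> 0" using scale_multiplier_bounds(1)[of k n] by auto
        then show "a i n * cis (2 * pi * of_int n * t) = of_real (lam k n) * b i k n * cis (2 * pi * of_int n * t)"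
          by (simp add: lam_def b_def)
      qed
      then show "(cmod (trig (dyadic_block (int k)) (a i) t))\<^sup>2 \<le> 2 * 5 * (\<Sum>j\<in>{block_lo k..<2 ^ k}. \<delta> k j * ((cmod (trig {n\<in>S. block_lo k \<le> n} (b i k) t))\<^sup>2
           + (cmod (trig {n\<in>S. j + 1 \<le> n} (b i k) t))\<^sup>2))"
        using ab3[of k "b i k" t] k by simp
    qed
    also have "\<dots> = 10 * Y"
      unfolding Y_def sumJ sum_distrib_left
      by (intro sum.cong refl) (simp add: ct2 N_def distrib_left)
    finally have "A\<^sup>2 + (\<Sum>i\<in>I. \<Sum>k\<le>K. (cmod (trig (dyadic_block (int k)) (a i) t))\<^sup>2) \<le> A\<^sup>2 + 10 * Y" by simp
    also have "\<dots> \<le> A\<^sup>2 * (1 + Y)"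
    proof -
      have "64\<^sup>2 \<le> A\<^sup>2" using A by (intro power_mono) auto
      then have "10 * Y \<le> A\<^sup>2 * Y" using Y0 by (intro mult_right_mono) auto
      then show ?thesis by (simp add: algebra_simps)
    qed
    finally have "Sf t \<le> sqrt (A\<^sup>2 * (1 + Y))" unfolding Sf_def by (rule real_sqrt_le_mono)
    then show ?thesis using A by (simp add: real_sqrt_mult y_def Y_def)
  qed
  have xA: "A \<le> x t" "A \<le> G t" "A \<le> Sf t" for t
    unfolding x_def G_def Sf_def by (intro real_le_rsqrt; simp add: sum_nonneg)+
  have y1: "1 \<le> y t" for t unfolding y_def by (simp add: sum_nonneg)
  have pos: "x t \<noteq> 0" "G t \<noteq> 0" "Sf t \<noteq> 0" "x t + y t \<noteq> 0" for t
    using xA[of t] y1[of t] A by linarith+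
  have c1: "continuous_on {0..1} x" "continuous_on {0..1} y" "continuous_on {0..1} G" "continuous_on {0..1} Sf"
    unfolding x_def y_def G_def Sf_def by (intro continuous_intros)+
  define U where "U = integral {0..1} (\<lambda>t. llog (m + 1) (sqrt (A\<^sup>2 + (\<Sum>i\<in>I. (cmod (trig S (a i) t))\<^sup>2))))"
  have "integral {0..1} (\<lambda>t. llog m (Sf t)) \<le> integral {0..1} (\<lambda>t. A * 2 ^ m * (y t * ln (x t + y t) ^ m))"
  proof (rule Henstock_Kurzweil_Integration.integral_le)
    show "(\<lambda>t. llog m (Sf t)) integrable_on {0..1}"
      unfolding llog_def by (intro integrable_continuous_interval continuous_intros c1) (simp add: pos)
    show "(\<lambda>t. A * 2 ^ m * (y t * ln (x t + y t) ^ m)) integrable_on {0..1}"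
      by (intro integrable_continuous_interval continuous_intros c1) (simp add: pos)
    fix t
    have A0: "0 < A" "1 \<le> A" using A by auto
    have "ln (A * y t) = ln A + ln (y t)" using A0 y1[of t] by (simp add: ln_mult)
    also have "\<dots> \<le> ln (x t + y t) + ln (x t + y t)"
      using A0 y1[of t] xA[of t] by (intro add_mono ln_mono) auto
    finally have l: "ln (A * y t) \<le> 2 * ln (x t + y t)" by simp
    have "1 * 1 \<le> A * y t" using A0 y1[of t] by (intro mult_mono) auto
    then have "ln (A * y t) ^ m \<le> (2 * ln (x t + y t)) ^ m" using l by (intro power_mono) auto
    then have "A * y t * ln (A * y t) ^ m \<le> A * y t * (2 * ln (x t + y t)) ^ m"
      using A0 y1[of t] by (intro mult_left_mono) auto
    moreover have "llog m (Sf t) \<le> llog m (A * y t)"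
      using xA[of t] A0 by (intro llog_mono SfY) auto
    ultimately show "llog m (Sf t) \<le> A * 2 ^ m * (y t * ln (x t + y t) ^ m)"
      by (simp add: llog_def power_mult_distrib mult_ac)
  qed
  also have "\<dots> = A * 2 ^ m * integral {0..1} (\<lambda>t. y t * ln (x t + y t) ^ m)"
    by (simp only: integral_mult_right)
  also have "\<dots> \<le> A * 2 ^ m * (2 * 3 ^ (m + 1) * integral {0..1} (\<lambda>t. llog (m + 1) (x t)))"
    unfolding x_def y_def using A by (intro mult_left_mono riesz_projection_llog finJ finS) auto
  also have "integral {0..1} (\<lambda>t. llog (m + 1) (x t)) \<le> integral {0..1} (\<lambda>t. 4 * 2 ^ (m + 1) * llog (m + 1) (G t))"
  proof (rule Henstock_Kurzweil_Integration.integral_le)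
    show "(\<lambda>t. llog (m + 1) (x t)) integrable_on {0..1}" "(\<lambda>t. 4 * 2 ^ (m + 1) * llog (m + 1) (G t)) integrable_on {0..1}"
      unfolding llog_def by (intro integrable_continuous_interval continuous_intros c1; simp add: pos)+
    fix t
    have "llog (m + 1) (x t) \<le> llog (m + 1) (4 * G t)"
      using xA[of t] A by (intro llog_mono xG) auto
    also have "\<dots> \<le> 4 * 2 ^ (m + 1) * llog (m + 1) (G t)"
      using xA[of t] A by (intro llog_cmult_le) auto
    finally show "llog (m + 1) (x t) \<le> 4 * 2 ^ (m + 1) * llog (m + 1) (G t)" .
  qed
  also have "\<dots> = 4 * 2 ^ (m + 1) * integral {0..1} (\<lambda>t. llog (m + 1) (G t))"
    by (simp only: integral_mult_right)
  also have "integral {0..1} (\<lambda>t. llog (m + 1) (G t)) \<le> 2 * 2 ^ (m + 1) * (2 ^ (m + 1) * 256 * 1024 + 1) * U"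
  proof -
    \<comment> \<open>By construction \<open>b i 0\<close> and \<open>b i (Suc k)\<close> hold the
      coefficients of the extension at level 0 and of the increments, so \<open>G\<close> is the
      quantity bounded by \<open>square_function_llog_bound\<close>.\<close>
    have G_eq: "G t = sqrt (A\<^sup>2 + (\<Sum>i\<in>I. (cmod (harmonic S (a i) (scale_level 0) t))\<^sup>2) +
      (\<Sum>k<K. \<Sum>i\<in>I. (cmod (harmonic S (a i) (scale_level k) t - harmonic S (a i) (scale_level (Suc k)) t))\<^sup>2))" for t
    proof -
      have h0: "trig S (b i 0) t = harmonic S (a i) (scale_level 0) t" for i
        unfolding harmonic_eq_trig trig_def by (intro sum.cong refl) (auto simp: b_def scale_multiplier_def S_def)
      have hS: "trig S (b i (Suc k)) t = harmonic S (a i) (scale_level (Suc k)) t - harmonic S (a i) (scale_level k) t" for i k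
        unfolding harmonic_eq_trig trig_def sum_subtractf[symmetric]
        by (intro sum.cong refl) (auto simp: b_def scale_multiplier_def S_def algebra_simps)
      have "(\<Sum>i\<in>I. \<Sum>k\<le>K. (cmod (trig S (b i k) t))\<^sup>2) = (\<Sum>i\<in>I. (cmod (trig S (b i 0) t))\<^sup>2) + (\<Sum>k<K. \<Sum>i\<in>I. (cmod (trig S (b i (Suc k)) t))\<^sup>2)"
        unfolding sum.atMost_shift sum.distrib by (subst sum.swap) (rule refl)
      then show ?thesis unfolding G_def h0 hS by (simp add: norm_minus_commute add.assoc)
    qed
    show ?thesis
      unfolding G_eq U_def
    proof (rule square_function_llog_bound[OF \<open>finite I\<close>])
      show "exp (real (m + 1)) \<le> A" using A(2) by (smt (verit) exp_le_cancel_iff of_nat_0_le_iff of_nat_1 of_nat_add)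
    qed (use A in \<open>auto simp: S_def\<close>)
  qed
  finally show ?thesis
    using A by (simp add: Sf_def U_def S_def mult_left_mono)
qed

section \<open>Iteration over the variables\<close>

lemma measurable_torus_component: "j < d \<Longrightarrow> (\<lambda>x. x j) \<in> borel_measurable (torus d)"
  unfolding torus_def
  using measurable_compose[OF measurable_component_singleton[of j "{..<d}" "\<lambda>_. circle"] measurable_circle[of "\<lambda>x. x" borel]]
  by simp

lemma borel_measurable_character [measurable]: "character d n \<in> borel_measurable (torus d)"
proof -
  have "(\<lambda>x. 2 * pi * (\<Sum>j<d. of_int (n j) * x j)) \<in> borel_measurable (torus d)"
    by (intro borel_measurable_times borel_measurable_const borel_measurable_sum measurable_torus_component) auto
  moreover have "cis \<in> borel_measurable borel"
    by (intro borel_measurable_continuous_onI continuous_intros)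
  ultimately have "(\<lambda>x. cis (2 * pi * (\<Sum>j<d. of_int (n j) * x j))) \<in> borel_measurable (torus d)"
    by (rule measurable_compose)
  then show ?thesis by (simp add: character_def[abs_def])
qed

lemma borel_measurable_llog [measurable]: "llog m \<in> borel_measurable borel"
  unfolding llog_def[abs_def] by measurable

text \<open>Only the variables in \<open>J\<close> are localised to blocks. The coefficients are
  left free because the estimate will be applied to Fejer means.\<close>

definition block_part ::
  "nat \<Rightarrow> (nat \<Rightarrow> int) set \<Rightarrow> ((nat \<Rightarrow> int) \<Rightarrow> complex) \<Rightarrow> nat set \<Rightarrow> (nat \<Rightarrow> nat) \<Rightarrow> (nat \<Rightarrow> real) \<Rightarrow> complex" where
  "block_part d F c J k x = (\<Sum>n\<in>{n\<in>F. \<forall>j\<in>J. n j \<in> dyadic_block (int (k j))}. c n * character d n x)"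

definition LP_const :: "nat \<Rightarrow> real \<Rightarrow> real" where
  "LP_const m A = A * 2 ^ m * (2 * 3 ^ (m + 1)) * (4 * 2 ^ (m + 1)) * (2 * 2 ^ (m + 1) * (2 ^ (m + 1) * 256 * 1024 + 1))"

lemma character_fun_upd:
  assumes "j < d"
  shows "character d n (x(j := t)) = cis (2 * pi * (\<Sum>i\<in>{..<d} - {j}. of_int (n i) * x i)) * cis (2 * pi * of_int (n j) * t)"
proof -
  have "(\<Sum>i<d. of_int (n i) * (x(j := t)) i) = of_int (n j) * t + (\<Sum>i\<in>{..<d} - {j}. of_int (n i) * (x(j := t)) i)"
    using assms by (subst sum.remove[of _ j]) auto
  also have "(\<Sum>i\<in>{..<d} - {j}. of_int (n i) * (x(j := t)) i) = (\<Sum>i\<in>{..<d} - {j}. of_int (n i) * x i)"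
    by (intro sum.cong) auto
  finally show ?thesis
    unfolding character_def cis_mult by (simp add: algebra_simps)
qed

lemma sum_PiE_lessThan_Suc:
  fixes f :: "(nat \<Rightarrow> 'b) \<Rightarrow> 'c::comm_monoid_add"
  shows "(\<Sum>k\<in>{..<Suc j} \<rightarrow>\<^sub>E B. f k) = (\<Sum>k\<in>{..<j} \<rightarrow>\<^sub>E B. \<Sum>\<kappa>\<in>B. f (k(j := \<kappa>)))"
proof -
  have "{..<Suc j} \<rightarrow>\<^sub>E B = (\<lambda>(\<kappa>, k). k(j := \<kappa>)) ` (B \<times> ({..<j} \<rightarrow>\<^sub>E B))"
    unfolding lessThan_Suc by (rule PiE_insert_eq)
  moreover have "inj_on (\<lambda>(\<kappa>, k). k(j := \<kappa>)) (B \<times> ({..<j} \<rightarrow>\<^sub>E B))"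
    using inj_combinator[of j "{..<j}" "\<lambda>_. B"] by simp
  ultimately have "(\<Sum>k\<in>{..<Suc j} \<rightarrow>\<^sub>E B. f k) = (\<Sum>(\<kappa>, k)\<in>B \<times> ({..<j} \<rightarrow>\<^sub>E B). f (k(j := \<kappa>)))"
    by (simp add: sum.reindex case_prod_beta' o_def)
  also have "\<dots> = (\<Sum>\<kappa>\<in>B. \<Sum>k\<in>{..<j} \<rightarrow>\<^sub>E B. f (k(j := \<kappa>)))" by (rule sum.cartesian_product[symmetric])
  finally show ?thesis by (simp add: sum.swap[of _ B])
qed

text \<open>Interpolates between the modulus (\<open>j = 0\<close>) and the full square function
  (\<open>j = d\<close>), both regularised by \<open>A\<close>: the first \<open>j\<close> variables
  have been split into blocks.\<close>

definition LP_step :: "nat \<Rightarrow> nat \<Rightarrow> real \<Rightarrow> (nat \<Rightarrow> int) set \<Rightarrow> ((nat \<Rightarrow> int) \<Rightarrow> complex) \<Rightarrow> nat \<Rightarrow> (nat \<Rightarrow> real) \<Rightarrow> real" where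
  "LP_step d K A F c j x = sqrt (A\<^sup>2 + (\<Sum>k\<in>{..<j} \<rightarrow>\<^sub>E {..K}. (cmod (block_part d F c {..<j} k x))\<^sup>2))"

lemma borel_measurable_LP_step [measurable]: "LP_step d K A F c j \<in> borel_measurable (torus d)"
  unfolding LP_step_def[abs_def] block_part_def by measurable

lemma LP_step_bound:
  fixes F :: "(nat \<Rightarrow> int) set"
  assumes F: "finite F" "\<And>n i. n \<in> F \<Longrightarrow> i < d \<Longrightarrow> n i \<in> {0..<2 ^ K}" and j: "j < d"
    and A: "64 \<le> A" "exp (2 * (real m + 1)) \<le> A" "2 * (real m + 5) \<le> A"
  shows "(\<integral>\<^sup>+x. ennreal (llog m (LP_step d K A F c (Suc j) x)) \<partial>torus d)
     \<le> ennreal (LP_const m A) * (\<integral>\<^sup>+x. ennreal (llog (m + 1) (LP_step d K A F c j x)) \<partial>torus d)"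
proof -
  interpret product_sigma_finite "\<lambda>_::nat. circle" by (rule product_sigma_finite_circle)
  define I where "I = {..<d} - {j}"
  have I: "finite I" "j \<notin> I" "insert j I = {..<d}" using j by (auto simp: I_def)
  have torus: "torus d = PiM (insert j I) (\<lambda>_. circle)" by (simp add: torus_def I(3))
  define P where "P = {..<j} \<rightarrow>\<^sub>E {..K}"
  have finP: "finite P" by (simp add: P_def finite_PiE)
  define Fk where "Fk = (\<lambda>k. {n\<in>F. \<forall>i\<in>{..<j}. n i \<in> dyadic_block (int (k i))})"
  define E where "E = (\<lambda>n x. cis (2 * pi * (\<Sum>i\<in>I. of_int (n i) * x i)))"
  define a where "a = (\<lambda>x k \<nu>. \<Sum>n\<in>{n\<in>Fk k. n j = \<nu>}. c n * E n x)"
  have finFk: "finite (Fk k)" for k using F(1) by (simp add: Fk_def)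
  have trig_a: "trig T (a x k) t = (\<Sum>n\<in>{n\<in>Fk k. n j \<in> T}. c n * character d n (x(j := t)))"
    if "finite T" for T x k t
  proof -
    have "trig T (a x k) t = (\<Sum>\<nu>\<in>T. \<Sum>n\<in>{n\<in>{n\<in>Fk k. n j \<in> T}. n j = \<nu>}. c n * character d n (x(j := t)))"
      unfolding trig_def
    proof (intro sum.cong refl)
      fix \<nu> assume "\<nu> \<in> T"
      then have "{n\<in>{n\<in>Fk k. n j \<in> T}. n j = \<nu>} = {n\<in>Fk k. n j = \<nu>}" by auto
      then show "a x k \<nu> * cis (2 * pi * of_int \<nu> * t) = (\<Sum>n\<in>{n\<in>{n\<in>Fk k. n j \<in> T}. n j = \<nu>}. c n * character d n (x(j := t)))"
        unfolding a_def sum_distrib_right character_fun_upd[OF j] E_def I_def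
        by (intro sum.cong) (auto simp: mult.assoc)
    qed
    also have "\<dots> = (\<Sum>n\<in>{n\<in>Fk k. n j \<in> T}. c n * character d n (x(j := t)))"
      using finFk[of k] that by (intro sum.group) auto
    finally show ?thesis .
  qed
  have step0: "LP_step d K A F c j (x(j := t)) = sqrt (A\<^sup>2 + (\<Sum>k\<in>P. (cmod (trig {0..<2 ^ K} (a x k) t))\<^sup>2))" for x t
  proof -
    have e: "{n\<in>Fk k. n j \<in> {0..<2 ^ K}} = Fk k" for k
      using F(2)[OF _ j] by (auto simp: Fk_def)
    have "block_part d F c {..<j} k (x(j := t)) = trig {0..<2 ^ K} (a x k) t" for k
      unfolding trig_a[OF finite_atLeastLessThan_int] e by (simp add: block_part_def Fk_def)
    then show ?thesis unfolding LP_step_def P_def[symmetric] by simp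
  qed
  have step1: "LP_step d K A F c (Suc j) (x(j := t)) = sqrt (A\<^sup>2 + (\<Sum>k\<in>P. \<Sum>\<kappa>\<le>K. (cmod (trig (dyadic_block (int \<kappa>)) (a x k) t))\<^sup>2))" for x t
  proof -
    have "block_part d F c {..<Suc j} (k(j := \<kappa>)) (x(j := t)) = trig (dyadic_block (int \<kappa>)) (a x k) t" for k \<kappa>
    proof -
      have "{n\<in>F. \<forall>i\<in>{..<Suc j}. n i \<in> dyadic_block (int ((k(j := \<kappa>)) i))} = {n\<in>Fk k. n j \<in> dyadic_block (int \<kappa>)}"
        by (auto simp: Fk_def less_Suc_eq)
      then show ?thesis unfolding block_part_def trig_a[OF finite_dyadic_block] by simp
    qed
    then show ?thesis unfolding LP_step_def sum_PiE_lessThan_Suc P_def by simp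
  qed
  have A1: "1 \<le> A" using A by simp
  have ge1: "1 \<le> sqrt (A\<^sup>2 + q)" if "0 \<le> q" for q
  proof -
    have "1 \<le> A\<^sup>2" using A1 by simp
    then show ?thesis using that by simp
  qed
  have cll: "continuous_on UNIV (\<lambda>t. llog l (sqrt (A\<^sup>2 + q t)))" if "continuous_on UNIV q" "\<And>t. 0 \<le> q t" for q :: "real \<Rightarrow> real" and l
  proof -
    have "A\<^sup>2 + q t \<noteq> 0" for t using that(2)[of t] A1 by (smt (verit) one_le_power)
    then show ?thesis unfolding llog_def using that by (intro continuous_intros) auto
  qed
  have inner: "(\<integral>\<^sup>+t. ennreal (llog m (LP_step d K A F c (Suc j) (x(j := t)))) \<partial>circle)
    \<le> ennreal (LP_const m A) * (\<integral>\<^sup>+t. ennreal (llog (m + 1) (LP_step d K A F c j (x(j := t)))) \<partial>circle)" for x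
  proof -
    have "(\<integral>\<^sup>+t. ennreal (llog m (LP_step d K A F c (Suc j) (x(j := t)))) \<partial>circle) =
      ennreal (integral {0..1} (\<lambda>t. llog m (sqrt (A\<^sup>2 + (\<Sum>k\<in>P. \<Sum>\<kappa>\<le>K. (cmod (trig (dyadic_block (int \<kappa>)) (a x k) t))\<^sup>2)))))"
      unfolding step1 by (intro nn_integral_circle cll continuous_intros llog_nonneg ge1) (simp_all add: sum_nonneg)
    also have "\<dots> \<le> ennreal (LP_const m A * integral {0..1} (\<lambda>t. llog (m + 1) (sqrt (A\<^sup>2 + (\<Sum>k\<in>P. (cmod (trig {0..<2 ^ K} (a x k) t))\<^sup>2)))))"
      unfolding LP_const_def by (intro ennreal_leI LP_one_variable finP A)
    also have "\<dots> = ennreal (LP_const m A) * ennreal (integral {0..1} (\<lambda>t. llog (m + 1) (sqrt (A\<^sup>2 + (\<Sum>k\<in>P. (cmod (trig {0..<2 ^ K} (a x k) t))\<^sup>2)))))"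
      using A1 by (intro ennreal_mult Henstock_Kurzweil_Integration.integral_nonneg integrable_continuous_interval
          continuous_on_subset[OF cll] continuous_intros llog_nonneg ge1) (auto simp: LP_const_def sum_nonneg)
    also have "ennreal (integral {0..1} (\<lambda>t. llog (m + 1) (sqrt (A\<^sup>2 + (\<Sum>k\<in>P. (cmod (trig {0..<2 ^ K} (a x k) t))\<^sup>2)))))
      = (\<integral>\<^sup>+t. ennreal (llog (m + 1) (LP_step d K A F c j (x(j := t)))) \<partial>circle)"
      unfolding step0 by (intro nn_integral_circle[symmetric] cll continuous_intros llog_nonneg ge1) (simp_all add: sum_nonneg)
    finally show ?thesis .
  qed
  have mb: "(\<lambda>x. ennreal (llog l (LP_step d K A F c i x))) \<in> borel_measurable (PiM (insert j I) (\<lambda>_. circle))" for l i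
    unfolding torus[symmetric] by measurable
  have "(\<integral>\<^sup>+x. ennreal (llog m (LP_step d K A F c (Suc j) x)) \<partial>torus d)
    = (\<integral>\<^sup>+x. (\<integral>\<^sup>+t. ennreal (llog m (LP_step d K A F c (Suc j) (x(j := t)))) \<partial>circle) \<partial>PiM I (\<lambda>_. circle))"
    unfolding torus by (rule product_nn_integral_insert[OF I(1,2) mb])
  also have "\<dots> \<le> (\<integral>\<^sup>+x. ennreal (LP_const m A) * (\<integral>\<^sup>+t. ennreal (llog (m + 1) (LP_step d K A F c j (x(j := t)))) \<partial>circle) \<partial>PiM I (\<lambda>_. circle))"
    by (intro nn_integral_mono inner)
  also have "\<dots> = ennreal (LP_const m A) * (\<integral>\<^sup>+x. (\<integral>\<^sup>+t. ennreal (llog (m + 1) (LP_step d K A F c j (x(j := t)))) \<partial>circle) \<partial>PiM I (\<lambda>_. circle))"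
  proof (rule nn_integral_cmult)
    have "(\<lambda>(x, t). ennreal (llog (m + 1) (LP_step d K A F c j (x(j := t))))) \<in> borel_measurable (PiM I (\<lambda>_. circle) \<Otimes>\<^sub>M circle)"
      using measurable_compose[OF measurable_add_dim mb] by (simp add: case_prod_beta')
    then show "(\<lambda>x. \<integral>\<^sup>+t. ennreal (llog (m + 1) (LP_step d K A F c j (x(j := t)))) \<partial>circle) \<in> borel_measurable (PiM I (\<lambda>_. circle))"
      by (rule circle.borel_measurable_nn_integral)
  qed
  also have "(\<integral>\<^sup>+x. (\<integral>\<^sup>+t. ennreal (llog (m + 1) (LP_step d K A F c j (x(j := t)))) \<partial>circle) \<partial>PiM I (\<lambda>_. circle))
    = (\<integral>\<^sup>+x. ennreal (llog (m + 1) (LP_step d K A F c j x)) \<partial>torus d)"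
    unfolding torus by (rule product_nn_integral_insert[OF I(1,2) mb, symmetric])
  finally show ?thesis .
qed

text \<open>Splitting \<open>d - m\<close> variables leaves \<open>m\<close> logarithms: the
  induction runs downward from \<open>m = d\<close>, each step trading a logarithm for a split
  variable.\<close>

theorem LP_polynomial_bound:
  fixes F :: "(nat \<Rightarrow> int) set"
  assumes F: "finite F" "\<And>n i. n \<in> F \<Longrightarrow> i < d \<Longrightarrow> n i \<in> {0..<2 ^ K}"
    and A: "64 \<le> A" "exp (2 * (real d + 1)) \<le> A" "2 * (real d + 5) \<le> A"
  shows "(\<integral>\<^sup>+x. ennreal (LP_step d K A F c d x) \<partial>torus d)
     \<le> ennreal (\<Prod>m<d. LP_const m A) * (\<integral>\<^sup>+x. ennreal (llog d (LP_step d K A F c 0 x)) \<partial>torus d)"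
proof -
  have "(\<integral>\<^sup>+x. ennreal (llog m (LP_step d K A F c (d - m) x)) \<partial>torus d)
     \<le> ennreal (\<Prod>i=m..<d. LP_const i A) * (\<integral>\<^sup>+x. ennreal (llog d (LP_step d K A F c 0 x)) \<partial>torus d)" if "m \<le> d" for m
    using that
  proof (induction m rule: inc_induct)
    case (step m)
    have LP0: "0 \<le> LP_const i A" for i using A by (simp add: LP_const_def)
    have e: "exp (2 * (real m + 1)) \<le> exp (2 * (real d + 1))" using step by simp
    have s: "d - m = Suc (d - Suc m)" using step by simp
    have "(\<integral>\<^sup>+x. ennreal (llog m (LP_step d K A F c (d - m) x)) \<partial>torus d)
      \<le> ennreal (LP_const m A) * (\<integral>\<^sup>+x. ennreal (llog (m + 1) (LP_step d K A F c (d - Suc m) x)) \<partial>torus d)"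
      unfolding s 
    proof (rule LP_step_bound)
      show "n i \<in> {0..<2 ^ K}" if "n \<in> F" "i < d" for n i using F(2) that by blast
      show "exp (2 * (real m + 1)) \<le> A" using e A(2) by linarith
    qed (use F(1) step A in auto)
    also have "\<dots> \<le> ennreal (LP_const m A) * (ennreal (\<Prod>i=Suc m..<d. LP_const i A) * (\<integral>\<^sup>+x. ennreal (llog d (LP_step d K A F c 0 x)) \<partial>torus d))"
      using step.IH by (intro mult_left_mono) auto
    also have "\<dots> = ennreal (\<Prod>i=m..<d. LP_const i A) * (\<integral>\<^sup>+x. ennreal (llog d (LP_step d K A F c 0 x)) \<partial>torus d)"
      using step LP0 by (simp add: prod.atLeast_Suc_lessThan ennreal_mult prod_nonneg mult.assoc)
    finally show ?case .
  qed simp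
  from this[of 0] show ?thesis by (simp add: llog_def lessThan_atLeast0)
qed

section \<open>Reduction to polynomials by Fejer means\<close>

text \<open>
  A trigonometric polynomial in the sense of \<open>trig_poly\<close> is only known through its Fourier
  coefficients. Its Fejer means are honest polynomials, and Jensen's inequality for the positive
  kernel bounds their Orlicz integrals, so uniqueness of Fourier coefficients is not needed.
\<close>

definition fejer :: "nat \<Rightarrow> real \<Rightarrow> real" where
  "fejer R t = (cmod (\<Sum>a<R. cis (2 * pi * real a * t)))\<^sup>2 / real R"

text \<open>Kept as a count, the form in which it arises on expanding the squared modulus; the usual
  triangle is \<open>fejer_weight_eq\<close>.\<close>

definition fejer_weight :: "nat \<Rightarrow> int \<Rightarrow> real" where
  "fejer_weight R n = real (card {p \<in> {..<R} \<times> {..<R}. int (fst p) - int (snd p) = n}) / real R"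

lemma fejer_nonneg: "0 \<le> fejer R t"
  by (simp add: fejer_def)

lemma fejer_expand:
  "complex_of_real (fejer R t) = (\<Sum>n\<in>{- int R<..<int R}. of_real (fejer_weight R n) * cis (2 * pi * of_int n * t))"
proof -
  define Q where "Q = {..<R} \<times> {..<R}"
  have "complex_of_real ((cmod (\<Sum>a<R. cis (2 * pi * real a * t)))\<^sup>2)
     = (\<Sum>a<R. cis (2 * pi * real a * t)) * (\<Sum>b<R. cis (- (2 * pi * real b * t)))"
    unfolding complex_norm_square by (simp add: cis_cnj)
  also have "\<dots> = (\<Sum>p\<in>Q. cis (2 * pi * of_int (int (fst p) - int (snd p)) * t))"
    unfolding sum_product Q_def sum.cartesian_product
    by (intro sum.cong refl) (auto simp: cis_mult algebra_simps)
  also have "\<dots> = (\<Sum>n\<in>{- int R<..<int R}. \<Sum>p\<in>{p\<in>Q. int (fst p) - int (snd p) = n}. cis (2 * pi * of_int (int (fst p) - int (snd p)) * t))"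
    by (intro sum.group[symmetric]) (auto simp: Q_def)
  also have "\<dots> = (\<Sum>n\<in>{- int R<..<int R}. of_nat (card {p\<in>Q. int (fst p) - int (snd p) = n}) * cis (2 * pi * of_int n * t))"
    by (intro sum.cong refl) simp
  finally show ?thesis
    unfolding fejer_def of_real_divide Q_def fejer_weight_def by (simp add: sum_divide_distrib)
qed

lemma fejer_weight_eq:
  assumes "\<bar>n\<bar> \<le> int R"
  shows "fejer_weight R n = (real R - real_of_int \<bar>n\<bar>) / real R"
proof -
  have "card {p \<in> {..<R} \<times> {..<R}. int (fst p) - int (snd p) = n} = R - nat \<bar>n\<bar>"
  proof (cases "0 \<le> n")
    case True
    have "{p \<in> {..<R} \<times> {..<R}. int (fst p) - int (snd p) = n} = (\<lambda>b. (b + nat n, b)) ` {..<R - nat n}"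
      using True by (auto simp: image_iff)
    then show ?thesis using True by (simp add: card_image inj_on_def)
  next
    case False
    have "{p \<in> {..<R} \<times> {..<R}. int (fst p) - int (snd p) = n} = (\<lambda>a. (a, a + nat (- n))) ` {..<R - nat (- n)}"
      using False by (auto simp: image_iff)
    then show ?thesis using False by (simp add: card_image inj_on_def)
  qed
  then show ?thesis using assms by (simp add: fejer_weight_def of_nat_diff nat_le_iff)
qed

lemma fejer_weight_outside: "n \<notin> {- int R<..<int R} \<Longrightarrow> fejer_weight R n = 0"
proof -
  assume "n \<notin> {- int R<..<int R}"
  then have "{p \<in> {..<R} \<times> {..<R}. int (fst p) - int (snd p) = n} = {}" by auto
  then show ?thesis by (simp add: fejer_weight_def)
qed

lemma fejer_weight_tendsto: "(\<lambda>R. fejer_weight R n) \<longlonglongrightarrow> 1"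
proof -
  have "(\<lambda>R. 1 - real_of_int \<bar>n\<bar> / real R) \<longlonglongrightarrow> 1 - 0"
    by (intro tendsto_intros lim_const_over_n)
  moreover have "eventually (\<lambda>R. fejer_weight R n = 1 - real_of_int \<bar>n\<bar> / real R) sequentially"
    using eventually_ge_at_top[of "max 1 (nat \<bar>n\<bar>)"]
  proof eventually_elim
    case (elim R)
    then have "\<bar>n\<bar> \<le> int R" "R \<noteq> 0" by auto
    then show ?case by (simp add: fejer_weight_eq diff_divide_distrib)
  qed
  ultimately show ?thesis by (simp add: tendsto_cong)
qed

lemma cis_has_integral:
  "((\<lambda>t. cis (2 * pi * of_int n * (t - s))) has_integral (if n = 0 then 1 else 0)) {0..1}"
proof (cases "n = 0")
  case True
  have "((\<lambda>t::real. 1::complex) has_integral (1 - 0) *\<^sub>R 1) {0..1}"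
    using has_integral_const_real[of "1::complex" 0 1] by simp
  then show ?thesis using True by simp
next
  case False
  define w where "w = \<i> * of_real (2 * pi * of_int n)"
  have w: "w \<noteq> 0" using False by (simp add: w_def)
  have c: "cis (2 * pi * of_int n * (t - s)) = exp (w * of_real t + w * of_real (- s))" for t
    by (simp add: cis_conv_exp w_def algebra_simps)
  have "((\<lambda>t. exp (w * of_real t + w * of_real (- s)) / w) has_vector_derivative exp (w * of_real t + w * of_real (- s))) (at t within {0..1})" for t
  proof -
    have "((\<lambda>z. exp (w * z + w * of_real (- s)) / w) has_field_derivative exp (w * of_real t + w * of_real (- s))) (at (of_real t))"
      using w by (auto intro!: derivative_eq_intros)
    then show ?thesis by (rule has_vector_derivative_real_field)
  qed
  then have "((\<lambda>t. exp (w * of_real t + w * of_real (- s))) has_integral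
      exp (w * of_real 1 + w * of_real (- s)) / w - exp (w * of_real 0 + w * of_real (- s)) / w) {0..1}"
    by (intro fundamental_theorem_of_calculus) auto
  moreover have "exp (w * of_real 1 + w * of_real (- s)) = exp (w * of_real 0 + w * of_real (- s))"
  proof -
    have "exp w = 1" unfolding w_def by (auto simp: exp_eq_1)
    then show ?thesis by (simp only: exp_add of_real_1 of_real_0 mult_1_right mult_zero_right exp_zero)
  qed
  ultimately show ?thesis using False by (simp add: c)
qed

lemma fejer_minus: "fejer R (- t) = fejer R t"
proof -
  have "(\<Sum>a<R. cis (2 * pi * real a * (- t))) = cnj (\<Sum>a<R. cis (2 * pi * real a * t))"
    by (simp add: cis_cnj)
  then show ?thesis unfolding fejer_def by (metis complex_mod_cnj)
qed

lemma continuous_on_fejer: "continuous_on D f \<Longrightarrow> continuous_on D (\<lambda>x. fejer R (f x))"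
  unfolding fejer_def by (cases "R = 0") (auto intro!: continuous_intros)

lemma nn_integral_fejer:
  assumes "0 < R"
  shows "(\<integral>\<^sup>+t. ennreal (fejer R (t - s)) \<partial>circle) = 1"
proof -
  have "((\<lambda>t. \<Sum>n\<in>{- int R<..<int R}. of_real (fejer_weight R n) * cis (2 * pi * of_int n * (t - s)))
    has_integral (\<Sum>n\<in>{- int R<..<int R}. of_real (fejer_weight R n) * (if n = 0 then 1 else 0))) {0..1}"
    by (intro has_integral_sum has_integral_mult_right cis_has_integral) auto
  moreover have "(\<Sum>n\<in>{- int R<..<int R}. complex_of_real (fejer_weight R n) * (if n = 0 then 1 else 0)) = 1"
  proof -
    have "(\<Sum>n\<in>{- int R<..<int R}. complex_of_real (fejer_weight R n) * (if n = 0 then 1 else 0))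
       = (\<Sum>n\<in>{- int R<..<int R}. if n = 0 then complex_of_real (fejer_weight R 0) else 0)"
      by (intro sum.cong) auto
    also have "\<dots> = of_real (fejer_weight R 0)" using assms by (simp add: sum.delta)
    also have "fejer_weight R 0 = 1" using assms by (subst fejer_weight_eq) auto
    finally show ?thesis by simp
  qed
  ultimately have "((\<lambda>t. complex_of_real (fejer R (t - s))) has_integral 1) {0..1}"
    by (simp add: fejer_expand)
  from has_integral_Re[OF this] have "integral {0..1} (\<lambda>t. fejer R (t - s)) = 1"
    by (simp add: integral_unique)
  then show ?thesis
    by (subst nn_integral_circle) (auto intro!: continuous_on_fejer continuous_intros simp: fejer_nonneg)
qed

section \<open>The Fejer kernel on the torus and Jensen's inequality\<close>

definition fejer_kernel :: "nat \<Rightarrow> nat \<Rightarrow> (nat \<Rightarrow> real) \<Rightarrow> (nat \<Rightarrow> real) \<Rightarrow> real" where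
  "fejer_kernel d R x y = (\<Prod>j<d. fejer R (x j - y j))"

definition fejer_multiplier :: "nat \<Rightarrow> nat \<Rightarrow> (nat \<Rightarrow> int) \<Rightarrow> real" where
  "fejer_multiplier d R n = (\<Prod>j<d. fejer_weight R (n j))"

lemma fejer_kernel_nonneg: "0 \<le> fejer_kernel d R x y"
  by (simp add: fejer_kernel_def prod_nonneg fejer_nonneg)

lemma fejer_kernel_commute: "fejer_kernel d R x y = fejer_kernel d R y x"
  unfolding fejer_kernel_def by (intro prod.cong refl) (metis fejer_minus minus_diff_eq)

lemma fejer_kernel_expand:
  "complex_of_real (fejer_kernel d R x y) =
     (\<Sum>n\<in>{..<d} \<rightarrow>\<^sub>E {- int R<..<int R}. of_real (fejer_multiplier d R n) * (character d n x * cnj (character d n y)))"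
proof -
  have "complex_of_real (fejer_kernel d R x y) =
     (\<Prod>j<d. \<Sum>n\<in>{- int R<..<int R}. of_real (fejer_weight R n) * cis (2 * pi * of_int n * (x j - y j)))"
    by (simp add: fejer_kernel_def fejer_expand)
  also have "\<dots> = (\<Sum>n\<in>{..<d} \<rightarrow>\<^sub>E {- int R<..<int R}. \<Prod>j<d. of_real (fejer_weight R (n j)) * cis (2 * pi * of_int (n j) * (x j - y j)))"
    by (rule prod_sum_PiE) auto
  also have "\<dots> = (\<Sum>n\<in>{..<d} \<rightarrow>\<^sub>E {- int R<..<int R}. of_real (fejer_multiplier d R n) * (character d n x * cnj (character d n y)))"
    by (intro sum.cong refl)
      (simp add: fejer_multiplier_def character_prod prod.distrib[symmetric] cis_cnj cis_mult algebra_simps)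
  finally show ?thesis .
qed

lemma borel_measurable_fejer [measurable]: "fejer R \<in> borel_measurable borel"
  by (intro borel_measurable_continuous_onI continuous_on_fejer continuous_on_id)

lemma nn_integral_fejer_kernel:
  assumes "0 < R"
  shows "(\<integral>\<^sup>+x. ennreal (fejer_kernel d R x y) \<partial>torus d) = 1"
proof -
  interpret product_sigma_finite "\<lambda>_::nat. circle" by (rule product_sigma_finite_circle)
  have m: "(\<lambda>t. ennreal (fejer R (t - y j))) \<in> borel_measurable circle" for j
    by (intro measurable_circle) measurable
  have "(\<integral>\<^sup>+x. ennreal (fejer_kernel d R x y) \<partial>torus d) = (\<integral>\<^sup>+x. (\<Prod>j<d. ennreal (fejer R (x j - y j))) \<partial>torus d)"
    by (simp add: fejer_kernel_def prod_ennreal fejer_nonneg)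
  also have "\<dots> = (\<Prod>j<d. (\<integral>\<^sup>+t. ennreal (fejer R (t - y j)) \<partial>circle))"
    unfolding torus_def by (rule product_nn_integral_prod) (use m in auto)
  also have "\<dots> = 1" by (simp add: nn_integral_fejer[OF assms])
  finally show ?thesis .
qed

lemma sigma_finite_torus: "sigma_finite_measure (torus d)"
proof -
  interpret product_sigma_finite "\<lambda>_::nat. circle" by (rule product_sigma_finite_circle)
  show ?thesis unfolding torus_def by (rule sigma_finite) simp
qed

lemma emeasure_torus: "emeasure (torus d) (space (torus d)) = 1"
proof -
  have "(\<integral>\<^sup>+x. ennreal (fejer_kernel d 1 x (\<lambda>_. 0)) \<partial>torus d) = 1" by (rule nn_integral_fejer_kernel) simp
  then show ?thesis by (simp add: fejer_kernel_def fejer_def)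
qed

lemma measurable_fejer_kernel_pair:
  "(\<lambda>(x, y). ennreal (fejer_kernel d R x y)) \<in> borel_measurable (torus d \<Otimes>\<^sub>M torus d)"
proof -
  have "(\<lambda>z. ennreal (fejer R (fst z j - snd z j))) \<in> borel_measurable (torus d \<Otimes>\<^sub>M torus d)" if "j < d" for j
  proof -
    have [measurable]: "(\<lambda>z. fst z j) \<in> borel_measurable (torus d \<Otimes>\<^sub>M torus d)" "(\<lambda>z. snd z j) \<in> borel_measurable (torus d \<Otimes>\<^sub>M torus d)"
      using measurable_compose[OF measurable_fst measurable_torus_component[OF that]]
        measurable_compose[OF measurable_snd measurable_torus_component[OF that]] by auto
    show ?thesis by measurable
  qed
  then have "(\<lambda>z. \<Prod>j<d. ennreal (fejer R (fst z j - snd z j))) \<in> borel_measurable (torus d \<Otimes>\<^sub>M torus d)"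
    by (intro borel_measurable_prod_ennreal) auto
  then show ?thesis by (simp add: fejer_kernel_def prod_ennreal fejer_nonneg case_prod_beta')
qed

lemma borel_measurable_fejer_kernel: "fejer_kernel d R x \<in> borel_measurable (torus d)"
proof -
  have "(\<lambda>y. fejer R (x j - y j)) \<in> borel_measurable (torus d)" if "j < d" for j
  proof -
    note measurable_torus_component[OF that, measurable]
    show ?thesis by measurable
  qed
  then show ?thesis unfolding fejer_kernel_def[abs_def] by (intro borel_measurable_prod) auto
qed

lemma borel_measurable_cnj_character [measurable]: "(\<lambda>x. cnj (character d n x)) \<in> borel_measurable (torus d)"
proof -
  have "cnj \<in> borel_measurable borel" by (intro borel_measurable_continuous_onI continuous_intros)
  then show ?thesis using measurable_compose[OF borel_measurable_character] by blast
qed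

lemma integrable_mult_character:
  assumes "integrable (torus d) g"
  shows "integrable (torus d) (\<lambda>x. g x * cnj (character d n x))"
  by (rule Bochner_Integration.integrable_bound[OF assms])
    (use assms in \<open>auto simp: norm_mult character_def[of d n]
      intro!: borel_measurable_times borel_measurable_cnj_character[unfolded character_def]\<close>)

text \<open>The kernel is a finite sum of characters, so the mean at a point involves
  \<open>g\<close> only through its Fourier coefficients. Frequencies outside the box of the kernel
  have multiplier 0, so the sum may run over the support of the coefficients.\<close>

lemma fejer_mean:
  assumes g: "integrable (torus d) g" and fin: "finite (fourier_supp d g)"
  shows "integrable (torus d) (\<lambda>y. g y * of_real (fejer_kernel d R x y))"
    and "(LINT y|torus d. g y * of_real (fejer_kernel d R x y)) =
      (\<Sum>n\<in>fourier_supp d g. (of_real (fejer_multiplier d R n) * fourier d g n) * character d n x)"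
proof -
  define D where "D = {..<d} \<rightarrow>\<^sub>E {- int R<..<int R}"
  have finD: "finite D" unfolding D_def by (intro finite_PiE) auto
  have e: "g y * of_real (fejer_kernel d R x y) =
      (\<Sum>n\<in>D. (of_real (fejer_multiplier d R n) * character d n x) * (g y * cnj (character d n y)))" for y
    unfolding fejer_kernel_expand D_def sum_distrib_left by (intro sum.cong refl) (simp add: mult_ac)
  have i: "integrable (torus d) (\<lambda>y. (of_real (fejer_multiplier d R n) * character d n x) * (g y * cnj (character d n y)))" for n
    by (intro integrable_mult_right integrable_mult_character g)
  show "integrable (torus d) (\<lambda>y. g y * of_real (fejer_kernel d R x y))"
    unfolding e by (intro Bochner_Integration.integrable_sum i)
  have "(LINT y|torus d. g y * of_real (fejer_kernel d R x y)) =
      (\<Sum>n\<in>D. (of_real (fejer_multiplier d R n) * character d n x) * fourier d g n)"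
    unfolding e fourier_def using i by (simp add: Bochner_Integration.integral_sum)
  also have "\<dots> = (\<Sum>n\<in>D \<inter> fourier_supp d g. (of_real (fejer_multiplier d R n) * character d n x) * fourier d g n)"
  proof (intro sum.mono_neutral_right finD ballI)
    fix n assume n: "n \<in> D - D \<inter> fourier_supp d g"
    then have "n \<in> int_vectors d" by (auto simp: D_def int_vectors_def PiE_iff)
    then have "fourier d g n = 0" using n by (simp add: fourier_supp_def)
    then show "(of_real (fejer_multiplier d R n) * character d n x) * fourier d g n = 0" by simp
  qed auto
  also have "\<dots> = (\<Sum>n\<in>fourier_supp d g. (of_real (fejer_multiplier d R n) * character d n x) * fourier d g n)"
  proof (intro sum.mono_neutral_left fin ballI)
    fix n assume n: "n \<in> fourier_supp d g - D \<inter> fourier_supp d g"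
    then have "n \<in> extensional {..<d}" "n \<notin> D" by (auto simp: fourier_supp_def int_vectors_def PiE_iff)
    then obtain j where "j < d" "n j \<notin> {- int R<..<int R}" by (auto simp: D_def PiE_iff)
    then have "fejer_multiplier d R n = 0"
      unfolding fejer_multiplier_def using fejer_weight_outside[of "n j" R] by (intro prod_zero) auto
    then show "(of_real (fejer_multiplier d R n) * character d n x) * fourier d g n = 0" by simp
  qed auto
  finally show "(LINT y|torus d. g y * of_real (fejer_kernel d R x y)) =
      (\<Sum>n\<in>fourier_supp d g. (of_real (fejer_multiplier d R n) * fourier d g n) * character d n x)"
    by (simp add: mult_ac)
qed

text \<open>The slope at \<open>v\<close> is a product of two nonnegative nondecreasing factors,
  hence the function is convex on \<open>v \<ge> 0\<close>. The tangent inequality is arranged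
  without subtraction, ready for \<open>ennreal\<close>.\<close>

lemma llog_sqrt_tangent:
  assumes A: "1 \<le> A" and c: "0 \<le> c"
  shows "\<exists>D\<ge>0. \<forall>v\<ge>0. llog d (sqrt (A\<^sup>2 + c\<^sup>2)) + D * v \<le> llog d (sqrt (A\<^sup>2 + v\<^sup>2)) + D * c"
proof -
  define s where "s = (\<lambda>v. sqrt (A\<^sup>2 + v\<^sup>2))"
  have A2: "1 \<le> A\<^sup>2" using A by simp
  have p: "0 < A\<^sup>2 + v\<^sup>2" for v using A2 zero_le_power2[of v] by linarith
  have s1: "1 \<le> s v" for v unfolding s_def using A2 by (simp add: add_increasing2)
  have s0: "0 < s v" for v using s1[of v] by simp
  have ds: "(s has_real_derivative v / s v) (at v)" for v
    unfolding s_def using p[of v] by (auto intro!: derivative_eq_intros simp: field_simps)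
  define \<Theta> where "\<Theta> = (\<lambda>v. (ln (s v) ^ d + d * ln (s v) ^ (d - 1)) * (v / s v))"
  have d\<Theta>: "((\<lambda>v. llog d (s v)) has_real_derivative \<Theta> v) (at v)" for v
    unfolding \<Theta>_def by (rule DERIV_llog[OF ds s0])
  have sm: "s v \<le> s w" if "0 \<le> v" "v \<le> w" for v w
    unfolding s_def using that by (intro real_sqrt_le_mono add_left_mono power_mono) auto
  have qm: "v / s v \<le> w / s w" if "0 \<le> v" "v \<le> w" for v w
  proof -
    have "(v * s w)\<^sup>2 \<le> (w * s v)\<^sup>2"
    proof -
      have "v\<^sup>2 \<le> w\<^sup>2" using that by (intro power_mono) auto
      then have "v\<^sup>2 * A\<^sup>2 \<le> w\<^sup>2 * A\<^sup>2" by (intro mult_right_mono) auto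
      then show ?thesis using p[of v] p[of w] by (simp add: power_mult_distrib s_def algebra_simps)
    qed
    then have "v * s w \<le> w * s v" using that s0[of v] by (intro power2_le_imp_le[of "v * s w"]) auto
    then show ?thesis using s0[of v] s0[of w] by (simp add: field_simps)
  qed
  have \<Theta>m: "\<Theta> v \<le> \<Theta> w" if "0 \<le> v" "v \<le> w" for v w
    unfolding \<Theta>_def
  proof (intro mult_mono add_mono mult_left_mono power_mono ln_mono qm that sm)
    show "0 < s v" "0 \<le> ln (s v)" "0 \<le> ln (s v)" "0 \<le> v / s v" using s0 s1 that by (auto intro: divide_nonneg_pos)
    show "0 \<le> ln (s w) ^ d + real d * ln (s w) ^ (d - 1)" using s1[of w] by simp
  qed (auto intro!: zero_le_power ln_ge_zero s1 simp: s0)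
  have \<Theta>0: "0 \<le> \<Theta> c" using c s0[of c] s1[of c] by (simp add: \<Theta>_def)
  have "llog d (s c) - \<Theta> c * c \<le> llog d (s v) - \<Theta> c * v" if v: "0 \<le> v" for v
  proof (cases "c \<le> v")
    case True
    show ?thesis
    proof (rule DERIV_nonneg_imp_nondecreasing[OF True])
      fix u assume "c \<le> u" "u \<le> v"
      moreover have "((\<lambda>v. llog d (s v) - \<Theta> c * v) has_real_derivative \<Theta> u - \<Theta> c * 1) (at u)"
        by (intro DERIV_diff d\<Theta> DERIV_cmult DERIV_ident)
      ultimately show "\<exists>y. ((\<lambda>v. llog d (s v) - \<Theta> c * v) has_real_derivative y) (at u) \<and> 0 \<le> y"
        using \<Theta>m[of c u] c by (intro exI[of _ "\<Theta> u - \<Theta> c * 1"]) auto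
    qed
  next
    case False
    then have "v \<le> c" by simp
    then show ?thesis
    proof (rule DERIV_nonpos_imp_nonincreasing)
      fix u assume "v \<le> u" "u \<le> c"
      moreover have "((\<lambda>v. llog d (s v) - \<Theta> c * v) has_real_derivative \<Theta> u - \<Theta> c * 1) (at u)"
        by (intro DERIV_diff d\<Theta> DERIV_cmult DERIV_ident)
      ultimately show "\<exists>y. ((\<lambda>v. llog d (s v) - \<Theta> c * v) has_real_derivative y) (at u) \<and> y \<le> 0"
        using \<Theta>m[of u c] v by (intro exI[of _ "\<Theta> u - \<Theta> c * 1"]) auto
    qed
  qed
  then show ?thesis using \<Theta>0 unfolding s_def by (intro exI[of _ "\<Theta> c"]) (auto simp: algebra_simps)
qed

lemma fejer_mean_llog_pointwise:
  assumes g: "integrable (torus d) g" and fin: "finite (fourier_supp d g)" and A: "1 \<le> A" and R: "0 < R"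
  shows "ennreal (llog m (sqrt (A\<^sup>2 + (cmod (\<Sum>n\<in>fourier_supp d g. (of_real (fejer_multiplier d R n) * fourier d g n) * character d n x))\<^sup>2)))
     \<le> (\<integral>\<^sup>+y. ennreal (llog m (sqrt (A\<^sup>2 + (cmod (g y))\<^sup>2))) * ennreal (fejer_kernel d R x y) \<partial>torus d)"
proof -
  define \<Theta> where "\<Theta> = (\<lambda>v. llog m (sqrt (A\<^sup>2 + v\<^sup>2)))"
  define k where "k = fejer_kernel d R x"
  have A2: "1 \<le> A\<^sup>2" using A by simp
  have \<Theta>0: "0 \<le> \<Theta> v" for v unfolding \<Theta>_def using A2 by (intro llog_nonneg) (simp add: add_increasing2)
  have k0: "0 \<le> k y" for y by (simp add: k_def fejer_kernel_nonneg)
  have [measurable]: "g \<in> borel_measurable (torus d)" using g by auto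
  have [measurable]: "k \<in> borel_measurable (torus d)" unfolding k_def by (rule borel_measurable_fejer_kernel)
  have [measurable]: "\<Theta> \<in> borel_measurable borel" unfolding \<Theta>_def by measurable
  have int_k: "(\<integral>\<^sup>+y. ennreal (k y) \<partial>torus d) = 1"
    unfolding k_def fejer_kernel_commute[of d R x] by (rule nn_integral_fejer_kernel[OF R])
  define c where "c = (LINT y|torus d. cmod (g y * of_real (k y)))"
  have ig: "integrable (torus d) (\<lambda>y. cmod (g y * of_real (k y)))"
    unfolding k_def by (intro integrable_norm fejer_mean g fin)
  have c0: "0 \<le> c" unfolding c_def by (intro integral_nonneg_AE) auto
  have int_gk: "(\<integral>\<^sup>+y. ennreal (cmod (g y) * k y) \<partial>torus d) = ennreal c"
  proof -
    have "(\<integral>\<^sup>+y. ennreal (cmod (g y * of_real (k y))) \<partial>torus d) = ennreal c"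
      unfolding c_def by (intro nn_integral_eq_integral ig) auto
    then show ?thesis using k0 by (simp add: norm_mult)
  qed
  obtain D where D: "0 \<le> D" "\<And>v. 0 \<le> v \<Longrightarrow> \<Theta> c + D * v \<le> \<Theta> v + D * c"
    using llog_sqrt_tangent[OF A c0, of m] unfolding \<Theta>_def by blast
  have "cmod (\<Sum>n\<in>fourier_supp d g. (of_real (fejer_multiplier d R n) * fourier d g n) * character d n x) \<le> c"
    unfolding c_def k_def fejer_mean(2)[OF g fin, symmetric] by (rule integral_norm_bound)
  then have "\<Theta> (cmod (\<Sum>n\<in>fourier_supp d g. (of_real (fejer_multiplier d R n) * fourier d g n) * character d n x)) \<le> \<Theta> c"
    unfolding \<Theta>_def using A2 by (intro llog_mono real_sqrt_le_mono add_left_mono power_mono) (auto simp: add_increasing2)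
  moreover have "ennreal (\<Theta> c) \<le> (\<integral>\<^sup>+y. ennreal (\<Theta> (cmod (g y))) * ennreal (k y) \<partial>torus d)"
  proof -
    \<comment> \<open>Jensen's inequality without subtraction: \<open>D * c\<close> is the integral
      of \<open>D * |g|\<close> against the kernel, occurs on both sides, and cancels at the end
      because it is finite.\<close>
    have "ennreal (D * c) + ennreal (\<Theta> c) = (\<integral>\<^sup>+y. ennreal D * ennreal (cmod (g y) * k y) + ennreal (\<Theta> c) * ennreal (k y) \<partial>torus d)"
      using D(1) c0 by (simp add: nn_integral_add nn_integral_cmult int_gk int_k ennreal_mult)
    also have "\<dots> \<le> (\<integral>\<^sup>+y. ennreal (D * c) * ennreal (k y) + ennreal (\<Theta> (cmod (g y))) * ennreal (k y) \<partial>torus d)"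
    proof (intro nn_integral_mono)
      fix y
      have "(\<Theta> c + D * cmod (g y)) * k y \<le> (\<Theta> (cmod (g y)) + D * c) * k y"
        using D(2)[of "cmod (g y)"] k0[of y] by (intro mult_right_mono) auto
      then have "ennreal (D * (cmod (g y) * k y) + \<Theta> c * k y) \<le> ennreal (D * c * k y + \<Theta> (cmod (g y)) * k y)"
        by (intro ennreal_leI) (simp add: algebra_simps)
      then show "ennreal D * ennreal (cmod (g y) * k y) + ennreal (\<Theta> c) * ennreal (k y)
        \<le> ennreal (D * c) * ennreal (k y) + ennreal (\<Theta> (cmod (g y))) * ennreal (k y)"
        using D(1) c0 k0[of y] \<Theta>0 by (simp add: ennreal_mult[symmetric] ennreal_plus[symmetric] del: ennreal_plus)
    qed
    also have "\<dots> = ennreal (D * c) + (\<integral>\<^sup>+y. ennreal (\<Theta> (cmod (g y))) * ennreal (k y) \<partial>torus d)"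
      by (simp add: nn_integral_add nn_integral_cmult int_k)
    finally show ?thesis by (simp add: ennreal_add_left_cancel_le)
  qed
  ultimately show ?thesis unfolding \<Theta>_def k_def using ennreal_leI order_trans by blast
qed

lemma fejer_mean_llog:
  assumes g: "integrable (torus d) g" and fin: "finite (fourier_supp d g)" and A: "1 \<le> A" and R: "0 < R"
  shows "(\<integral>\<^sup>+x. ennreal (llog m (sqrt (A\<^sup>2 + (cmod (\<Sum>n\<in>fourier_supp d g. (of_real (fejer_multiplier d R n) * fourier d g n) * character d n x))\<^sup>2))) \<partial>torus d)
     \<le> (\<integral>\<^sup>+y. ennreal (llog m (sqrt (A\<^sup>2 + (cmod (g y))\<^sup>2))) \<partial>torus d)"
proof -
  interpret pair_sigma_finite "torus d" "torus d"
    using sigma_finite_torus by (simp add: pair_sigma_finite_def)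
  have [measurable]: "g \<in> borel_measurable (torus d)" using g by auto
  define f where "f = (\<lambda>y. ennreal (llog m (sqrt (A\<^sup>2 + (cmod (g y))\<^sup>2))))"
  have [measurable]: "f \<in> borel_measurable (torus d)" unfolding f_def by measurable
  note measurable_fejer_kernel_pair[of d R, measurable]
  have "(\<integral>\<^sup>+x. ennreal (llog m (sqrt (A\<^sup>2 + (cmod (\<Sum>n\<in>fourier_supp d g. (of_real (fejer_multiplier d R n) * fourier d g n) * character d n x))\<^sup>2))) \<partial>torus d)
    \<le> (\<integral>\<^sup>+x. (\<integral>\<^sup>+y. f y * ennreal (fejer_kernel d R x y) \<partial>torus d) \<partial>torus d)"
    unfolding f_def by (intro nn_integral_mono fejer_mean_llog_pointwise assms)
  also have "\<dots> = (\<integral>\<^sup>+y. (\<integral>\<^sup>+x. f y * ennreal (fejer_kernel d R x y) \<partial>torus d) \<partial>torus d)"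
    by (rule Fubini'[symmetric]) measurable
  also have "\<dots> = (\<integral>\<^sup>+y. f y \<partial>torus d)"
  proof (intro nn_integral_cong)
    fix y
    have "(\<lambda>x. ennreal (fejer_kernel d R x y)) \<in> borel_measurable (torus d)"
      unfolding fejer_kernel_commute[of d R _ y] using borel_measurable_fejer_kernel[of d R y] by simp
    then show "(\<integral>\<^sup>+x. f y * ennreal (fejer_kernel d R x y) \<partial>torus d) = f y"
      by (simp add: nn_integral_cmult nn_integral_fejer_kernel[OF R])
  qed
  finally show ?thesis by (simp add: f_def)
qed

lemma frequencies_bounded:
  fixes d :: nat
  assumes "finite F" "F \<subseteq> {n. \<forall>j<d. 0 \<le> (n j :: int)}"
  obtains K :: nat where "\<And>n i. n \<in> F \<Longrightarrow> i < d \<Longrightarrow> n i \<in> {0..<2 ^ K}"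
proof
  define K where "K = (\<Sum>n\<in>F. \<Sum>i<d. nat (n i))"
  fix n i assume n: "n \<in> F" "i < d"
  have "nat (n i) \<le> (\<Sum>i<d. nat (n i))" using n by (intro member_le_sum) auto
  also have "\<dots> \<le> K" unfolding K_def using n assms(1) by (intro member_le_sum[where f = "\<lambda>n. \<Sum>i<d. nat (n i)"]) auto
  finally have "n i \<le> int K" by simp
  also have "\<dots> < 2 ^ K" by (rule of_nat_less_two_power)
  finally show "n i \<in> {0..<2 ^ K}" using n assms(2) by auto
qed

text \<open>Blocks with a negative index or an index above \<open>K\<close> miss the spectrum, so
  the infinite sum reduces to the vectors of natural indices bounded by \<open>K\<close>.\<close>

lemma LP_square_eq_LP_step:
  assumes g: "analytic_trig_poly d g"
    and K: "\<And>n i. n \<in> fourier_supp d g \<Longrightarrow> i < d \<Longrightarrow> n i \<in> {0..<2 ^ K}"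
  shows "LP_square d g x = LP_step d K 0 (fourier_supp d g) (fourier d g) d x"
proof -
  define F where "F = fourier_supp d g"
  have fin: "finite F" using g by (simp add: F_def analytic_trig_poly_def trig_poly_def)
  define P where "P = {..<d} \<rightarrow>\<^sub>E {..K}"
  have finP: "finite P" by (simp add: P_def finite_PiE)
  define \<iota> where "\<iota> = (\<lambda>k::nat \<Rightarrow> nat. \<lambda>j\<in>{..<d}. int (k j))"
  have inj: "inj_on \<iota> P"
  proof (rule inj_onI)
    fix k l assume kl: "k \<in> P" "l \<in> P" "\<iota> k = \<iota> l"
    show "k = l"
    proof (rule PiE_ext[OF kl(1,2)[unfolded P_def]])
      fix j assume "j \<in> {..<d}"
      then show "k j = l j" using fun_cong[OF kl(3), of j] by (simp add: \<iota>_def)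
    qed
  qed
  have \<iota>: "\<iota> ` P \<subseteq> int_vectors d" by (auto simp: \<iota>_def int_vectors_def split: if_splits)
  have LP_eq: "LP d k g x = (\<Sum>n\<in>{n\<in>F. \<forall>j<d. n j \<in> dyadic_block (k j)}. fourier d g n * character d n x)" if "k \<in> int_vectors d" for k
    unfolding LP_def
  proof (rule sum.mono_neutral_right)
    show "finite (\<Pi>\<^sub>E j\<in>{..<d}. dyadic_block (k j))" by (intro finite_PiE) (auto simp: finite_dyadic_block)
    show "{n \<in> F. \<forall>j<d. n j \<in> dyadic_block (k j)} \<subseteq> (\<Pi>\<^sub>E j\<in>{..<d}. dyadic_block (k j))"
      by (auto simp: F_def fourier_supp_def int_vectors_def PiE_iff extensional_def)
    show "\<forall>n\<in>(\<Pi>\<^sub>E j\<in>{..<d}. dyadic_block (k j)) - {n \<in> F. \<forall>j<d. n j \<in> dyadic_block (k j)}. fourier d g n * character d n x = 0"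
    proof
      fix n assume n: "n \<in> (\<Pi>\<^sub>E j\<in>{..<d}. dyadic_block (k j)) - {n \<in> F. \<forall>j<d. n j \<in> dyadic_block (k j)}"
      then have nv: "n \<in> int_vectors d" "\<forall>j<d. n j \<in> dyadic_block (k j)" by (simp_all add: int_vectors_def PiE_iff)
      then have "n \<notin> F" using n by simp
      then have "fourier d g n = 0" using nv(1) by (simp add: F_def fourier_supp_def)
      then show "fourier d g n * character d n x = 0" by simp
    qed
  qed
  have zero: "LP d k g x = 0" if k: "k \<in> int_vectors d - \<iota> ` P" for k
  proof -
    have empty: "{n\<in>F. \<forall>j<d. n j \<in> dyadic_block (k j)} = {}"
    proof (rule ccontr)
      assume "{n\<in>F. \<forall>j<d. n j \<in> dyadic_block (k j)} \<noteq> {}"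
      then obtain n where n: "n \<in> F" "\<And>j. j < d \<Longrightarrow> n j \<in> dyadic_block (k j)" by auto
      have kj: "0 \<le> k j \<and> k j \<le> int K" if "j < d" for j
      proof
        have nj: "0 \<le> n j" "n j < 2 ^ K" using K[of n j] n(1) that by (auto simp: F_def)
        show k0: "0 \<le> k j"
        proof (rule ccontr)
          assume "\<not> 0 \<le> k j"
          then have "n j \<le> - (2 ^ (nat (- k j) - 1))" using n(2)[OF that] by (auto simp: dyadic_block_def split: if_splits)
          moreover have "(0::int) < 2 ^ (nat (- k j) - 1)" by simp
          ultimately show False using nj by linarith
        qed
        show "k j \<le> int K"
        proof (rule ccontr)
          assume neg: "\<not> k j \<le> int K"
          then have "2 ^ (nat (k j) - 1) \<le> n j" using n(2)[OF that] by (auto simp: dyadic_block_def split: if_splits)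
          moreover have "(2::int) ^ K \<le> 2 ^ (nat (k j) - 1)" using neg by (intro power_increasing) auto
          ultimately show False using nj by linarith
        qed
      qed
      define l where "l = (\<lambda>j\<in>{..<d}. nat (k j))"
      have "l \<in> P" using kj by (auto simp: l_def P_def nat_le_iff)
      moreover have "k = \<iota> l"
      proof
        fix j show "k j = \<iota> l j"
          using kj[of j] k by (cases "j < d") (auto simp: \<iota>_def l_def int_vectors_def PiE_iff extensional_def)
      qed
      ultimately show False using k by blast
    qed
    have "k \<in> int_vectors d" using k by simp
    then show ?thesis by (simp only: LP_eq empty sum.empty)
  qed
  have "(\<Sum>\<^sub>\<infinity>k\<in>int_vectors d. (cmod (LP d k g x))\<^sup>2) = (\<Sum>\<^sub>\<infinity>k\<in>\<iota> ` P. (cmod (LP d k g x))\<^sup>2)"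
    using \<iota> zero by (intro infsum_cong_neutral) auto
  also have "\<dots> = (\<Sum>k\<in>\<iota> ` P. (cmod (LP d k g x))\<^sup>2)" using finP by simp
  also have "\<dots> = (\<Sum>k\<in>P. (cmod (LP d (\<iota> k) g x))\<^sup>2)" by (simp add: sum.reindex[OF inj])
  also have "\<dots> = (\<Sum>k\<in>P. (cmod (block_part d F (fourier d g) {..<d} k x))\<^sup>2)"
  proof (intro sum.cong refl)
    fix k assume "k \<in> P"
    then have k: "\<iota> k \<in> int_vectors d" using \<iota> by auto
    have "{n\<in>F. \<forall>j<d. n j \<in> dyadic_block (\<iota> k j)} = {n\<in>F. \<forall>j\<in>{..<d}. n j \<in> dyadic_block (int (k j))}"
      by (auto simp: \<iota>_def)
    then show "(cmod (LP d (\<iota> k) g x))\<^sup>2 = (cmod (block_part d F (fourier d g) {..<d} k x))\<^sup>2"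
      by (simp only: LP_eq[OF k] block_part_def)
  qed
  finally show ?thesis
    unfolding LP_square_def LP_step_def P_def F_def by simp
qed

lemma borel_measurable_LP_square:
  assumes g: "analytic_trig_poly d g"
  shows "LP_square d g \<in> borel_measurable (torus d)"
proof -
  have F: "finite (fourier_supp d g)" "fourier_supp d g \<subseteq> {n. \<forall>j<d. 0 \<le> n j}"
    using g by (auto simp: analytic_trig_poly_def trig_poly_def)
  obtain K where K: "\<And>n i. n \<in> fourier_supp d g \<Longrightarrow> i < d \<Longrightarrow> n i \<in> {0..<2 ^ K}"
    using frequencies_bounded[OF F] by blast
  have "LP_square d g = LP_step d K 0 (fourier_supp d g) (fourier d g) d"
    using LP_square_eq_LP_step[OF g, of K] K by (intro ext) auto
  then show ?thesis by simp
qed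

text \<open>The Fejer multipliers tend to 1 on the finite spectrum, so the square functions of the
  means converge pointwise, and Fatou's lemma passes the uniform bound to the limit.\<close>

theorem LP_square_L1_le_llog:
  assumes g: "analytic_trig_poly d g"
    and A: "64 \<le> A" "exp (2 * (real d + 1)) \<le> A" "2 * (real d + 5) \<le> A"
  shows "L1_norm d (LP_square d g) \<le>
     ennreal (\<Prod>m<d. LP_const m A) * (\<integral>\<^sup>+x. ennreal (llog d (sqrt (A\<^sup>2 + (cmod (g x))\<^sup>2))) \<partial>torus d)"
proof -
  define F where "F = fourier_supp d g"
  have gi: "integrable (torus d) g" and fin: "finite F" and nn: "F \<subseteq> {n. \<forall>j<d. 0 \<le> n j}"
    using g by (auto simp: F_def analytic_trig_poly_def trig_poly_def)
  obtain K where K: "\<And>n i. n \<in> F \<Longrightarrow> i < d \<Longrightarrow> n i \<in> {0..<2 ^ K}"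
    using frequencies_bounded[OF fin nn] by blast
  \<comment> \<open>\<open>Suc R\<close> keeps the order of the Fejer kernel positive, so that its
    mass is 1.\<close>
  define c where "c = (\<lambda>R n. of_real (fejer_multiplier d (Suc R) n) * fourier d g n)"
  define u where "u = (\<lambda>R x. LP_step d K A F (c R) d x)"
  define v where "v = LP_step d K A F (fourier d g) d"
  define B where "B = ennreal (\<Prod>m<d. LP_const m A) * (\<integral>\<^sup>+x. ennreal (llog d (sqrt (A\<^sup>2 + (cmod (g x))\<^sup>2))) \<partial>torus d)"
  have lim: "(\<lambda>R. u R x) \<longlonglongrightarrow> v x" for x
  proof -
    have "(\<lambda>R. fejer_multiplier d R n) \<longlonglongrightarrow> (\<Prod>j<d. 1)" for n
      unfolding fejer_multiplier_def by (intro tendsto_prod fejer_weight_tendsto)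
    then have "(\<lambda>R. fejer_multiplier d (Suc R) n) \<longlonglongrightarrow> 1" for n using LIMSEQ_Suc by force
    then have "(\<lambda>R. of_real (fejer_multiplier d (Suc R) n) * fourier d g n) \<longlonglongrightarrow> of_real 1 * fourier d g n" for n
      by (intro tendsto_intros)
    then have "(\<lambda>R. c R n) \<longlonglongrightarrow> fourier d g n" for n by (simp add: c_def)
    then show ?thesis
      unfolding u_def v_def LP_step_def block_part_def by (intro tendsto_intros)
  qed
  have bound: "(\<integral>\<^sup>+x. ennreal (u R x) \<partial>torus d) \<le> B" for R
  proof -
    have "(\<integral>\<^sup>+x. ennreal (u R x) \<partial>torus d) \<le> ennreal (\<Prod>m<d. LP_const m A) * (\<integral>\<^sup>+x. ennreal (llog d (LP_step d K A F (c R) 0 x)) \<partial>torus d)"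
      unfolding u_def by (rule LP_polynomial_bound[OF fin _ A]) (use K in blast)
    also have "(\<integral>\<^sup>+x. ennreal (llog d (LP_step d K A F (c R) 0 x)) \<partial>torus d) \<le> (\<integral>\<^sup>+x. ennreal (llog d (sqrt (A\<^sup>2 + (cmod (g x))\<^sup>2))) \<partial>torus d)"
      using fejer_mean_llog[OF gi fin[unfolded F_def], of A "Suc R" d] A
      by (simp add: LP_step_def block_part_def c_def F_def)
    finally show ?thesis by (simp add: B_def mult_left_mono)
  qed
  have "L1_norm d (LP_square d g) \<le> (\<integral>\<^sup>+x. ennreal (v x) \<partial>torus d)"
    unfolding L1_norm_def v_def F_def
  proof (intro nn_integral_mono ennreal_leI)
    fix x
    have "0 \<le> LP_square d g x" unfolding LP_square_def by (simp add: infsum_nonneg)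
    then show "\<bar>LP_square d g x\<bar> \<le> LP_step d K A (fourier_supp d g) (fourier d g) d x"
      using LP_square_eq_LP_step[OF g, of K x] K by (simp add: F_def LP_step_def)
  qed
  also have "\<dots> = (\<integral>\<^sup>+x. liminf (\<lambda>R. ennreal (u R x)) \<partial>torus d)"
  proof (intro nn_integral_cong)
    fix x
    have "(\<lambda>R. ennreal (u R x)) \<longlonglongrightarrow> ennreal (v x)" by (intro tendsto_ennrealI lim)
    then show "ennreal (v x) = liminf (\<lambda>R. ennreal (u R x))"
      by (intro lim_imp_Liminf[symmetric]) auto
  qed
  also have "\<dots> \<le> liminf (\<lambda>R. (\<integral>\<^sup>+x. ennreal (u R x) \<partial>torus d))"
    unfolding u_def by (intro nn_integral_liminf) measurable
  also have "\<dots> \<le> liminf (\<lambda>R::nat. B)"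
    by (intro Liminf_mono always_eventually allI bound)
  also have "\<dots> = B" by (simp add: Liminf_const)
  finally show ?thesis by (simp add: B_def)
qed

section \<open>From the modular inequality to the Orlicz norm\<close>

lemma analytic_trig_poly_divide:
  assumes g: "analytic_trig_poly d g" and c: "0 < c"
  shows "analytic_trig_poly d (\<lambda>x. g x / of_real c)"
    and "LP_square d g x = c * LP_square d (\<lambda>x. g x / of_real c) x"
proof -
  have f: "fourier d (\<lambda>x. g x / of_real c) n = fourier d g n / of_real c" for n
    unfolding fourier_def by simp
  have "fourier_supp d (\<lambda>x. g x / of_real c) = fourier_supp d g"
    using c by (simp add: fourier_supp_def f)
  then show "analytic_trig_poly d (\<lambda>x. g x / of_real c)"
    using g by (simp add: analytic_trig_poly_def trig_poly_def)
  have "LP d k (\<lambda>x. g x / of_real c) x = LP d k g x / of_real c" for k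
    by (simp add: LP_def f sum_divide_distrib)
  then have "(cmod (LP d k g x))\<^sup>2 = c\<^sup>2 * (cmod (LP d k (\<lambda>x. g x / of_real c) x))\<^sup>2" for k
    using c by (simp add: norm_divide power_divide)
  then show "LP_square d g x = c * LP_square d (\<lambda>x. g x / of_real c) x"
    unfolding LP_square_def using c by (simp add: infsum_cmult_right' real_sqrt_mult)
qed

text \<open>Below \<open>v = A\<close> the left side is bounded by a constant; above it the shift at
  most doubles the argument.\<close>

lemma llog_sqrt_le_LlogL:
  assumes A: "2 \<le> A" and v: "0 \<le> v"
  shows "llog d (sqrt (A\<^sup>2 + v\<^sup>2)) \<le> llog d (2 * A) + 2 * 2 ^ d * (v * ln (1 + v) powr real d)"
proof (cases "v \<le> A")
  case True
  have "v\<^sup>2 \<le> A\<^sup>2" using True v by (intro power_mono)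
  then have "A\<^sup>2 + v\<^sup>2 \<le> 4 * A\<^sup>2" using zero_le_power2[of A] by linarith
  then have "A\<^sup>2 + v\<^sup>2 \<le> (2 * A)\<^sup>2" by (simp add: power_mult_distrib)
  then have s: "sqrt (A\<^sup>2 + v\<^sup>2) \<le> 2 * A" using A by (intro real_le_lsqrt) auto
  have "1 \<le> A\<^sup>2" using A by simp
  then have "llog d (sqrt (A\<^sup>2 + v\<^sup>2)) \<le> llog d (2 * A)" using s by (intro llog_mono) (auto simp: add_increasing2)
  moreover have "0 \<le> 2 * 2 ^ d * (v * ln (1 + v) powr real d)" using v by simp
  ultimately show ?thesis by linarith
next
  case False
  have "A\<^sup>2 \<le> v\<^sup>2" using False A by (intro power_mono) auto
  then have "A\<^sup>2 + v\<^sup>2 \<le> 4 * v\<^sup>2" using zero_le_power2[of v] by linarith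
  then have "A\<^sup>2 + v\<^sup>2 \<le> (2 * v)\<^sup>2" by (simp add: power_mult_distrib)
  then have s: "sqrt (A\<^sup>2 + v\<^sup>2) \<le> 2 * v" using v by (intro real_le_lsqrt) auto
  have "1 \<le> A\<^sup>2" using A by simp
  then have "llog d (sqrt (A\<^sup>2 + v\<^sup>2)) \<le> llog d (2 * v)" using s by (intro llog_mono) (auto simp: add_increasing2)
  also have "\<dots> \<le> 2 * 2 ^ d * llog d v" using False A by (intro llog_cmult_le) auto
  also have "llog d v \<le> v * ln (1 + v) powr real d"
  proof -
    have "0 < ln (1 + v)" using False A by (intro ln_gt_zero) auto
    moreover have "ln v ^ d \<le> ln (1 + v) ^ d" using False A by (intro power_mono ln_mono ln_ge_zero) auto
    ultimately show ?thesis using v by (simp add: llog_def powr_realpow mult_left_mono)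
  qed
  finally have "llog d (sqrt (A\<^sup>2 + v\<^sup>2)) \<le> 2 * 2 ^ d * (v * ln (1 + v) powr real d)" by simp
  moreover have "0 \<le> llog d (2 * A)" using A by (intro llog_nonneg) auto
  ultimately show ?thesis by linarith
qed

lemma ennreal_le_mult_Inf:
  fixes L :: ennreal
  assumes k: "0 < k" and le: "\<And>c. c \<in> S \<Longrightarrow> L \<le> ennreal k * c"
  shows "L \<le> ennreal k * Inf S"
proof -
  have inv: "ennreal k * (ennreal (1 / k) * y) = y" "ennreal (1 / k) * (ennreal k * y) = y" for y
    using k by (simp_all flip: mult.assoc ennreal_mult)
  have "ennreal (1 / k) * L \<le> Inf S"
  proof (rule Inf_greatest)
    fix c assume "c \<in> S"
    then have "ennreal (1 / k) * L \<le> ennreal (1 / k) * (ennreal k * c)" by (intro mult_left_mono le) auto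
    then show "ennreal (1 / k) * L \<le> c" by (simp only: inv)
  qed
  then have "ennreal k * (ennreal (1 / k) * L) \<le> ennreal k * Inf S" by (intro mult_left_mono) auto
  then show ?thesis by (simp only: inv)
qed

text \<open>Dividing \<open>g\<close> by an admissible \<open>c\<close> makes its modular at most 1,
  so the modular inequality gives a constant bound. The square function is homogeneous, which
  restores the factor \<open>c\<close>, and the infimum over \<open>c\<close> gives the
  norm.\<close>

theorem LP_square_L1_le_LlogL:
  "\<exists>C>0. \<forall>g. analytic_trig_poly d g \<longrightarrow> L1_norm d (LP_square d g) \<le> ennreal C * LlogL_norm d (real d) g"
proof -
  define A where "A = max 64 (max (exp (2 * (real d + 1))) (2 * (real d + 5)))"
  have A: "64 \<le> A" "exp (2 * (real d + 1)) \<le> A" "2 * (real d + 5) \<le> A" by (auto simp: A_def)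
  define C0 where "C0 = (\<Prod>m<d. LP_const m A)"
  define C1 where "C1 = llog d (2 * A)"
  define C2 where "C2 = (2 * 2 ^ d :: real)"
  have C0: "0 < C0" unfolding C0_def LP_const_def using A by (intro prod_pos ballI mult_pos_pos add_pos_pos) auto
  have C1: "0 \<le> C1" unfolding C1_def using A by (intro llog_nonneg) auto
  have C2: "0 < C2" by (simp add: C2_def)
  have "L1_norm d (LP_square d g) \<le> ennreal (C0 * (C1 + C2)) * LlogL_norm d (real d) g"
    if g: "analytic_trig_poly d g" for g
    unfolding LlogL_norm_def
  proof (rule ennreal_le_mult_Inf)
    show "0 < C0 * (C1 + C2)" using C0 C1 C2 by simp
    fix e
    assume "e \<in> {ennreal c |c. 0 < c \<and> (\<integral>\<^sup>+ x. ennreal (cmod (g x) / c * ln (1 + cmod (g x) / c) powr real d) \<partial>torus d) \<le> 1}"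
    then obtain c where e: "e = ennreal c" and c: "0 < c"
      and le1: "(\<integral>\<^sup>+ x. ennreal (cmod (g x) / c * ln (1 + cmod (g x) / c) powr real d) \<partial>torus d) \<le> 1" by auto
    define h where "h = (\<lambda>x. g x / of_real c)"
    have h: "analytic_trig_poly d h" "\<And>x. LP_square d g x = c * LP_square d h x"
      unfolding h_def using analytic_trig_poly_divide[OF g c] by auto
    have [measurable]: "g \<in> borel_measurable (torus d)" using g by (auto simp: analytic_trig_poly_def trig_poly_def)
    have hc: "cmod (h x) = cmod (g x) / c" for x using c by (simp add: h_def norm_divide)
    have "(\<integral>\<^sup>+x. ennreal (llog d (sqrt (A\<^sup>2 + (cmod (h x))\<^sup>2))) \<partial>torus d)
      \<le> (\<integral>\<^sup>+x. ennreal C1 + ennreal C2 * ennreal (cmod (g x) / c * ln (1 + cmod (g x) / c) powr real d) \<partial>torus d)"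
    proof (intro nn_integral_mono)
      fix x
      have "ennreal (llog d (sqrt (A\<^sup>2 + (cmod (h x))\<^sup>2))) \<le> ennreal (C1 + C2 * (cmod (h x) * ln (1 + cmod (h x)) powr real d))"
        unfolding C1_def C2_def using A by (intro ennreal_leI llog_sqrt_le_LlogL) auto
      also have "\<dots> = ennreal C1 + ennreal (C2 * (cmod (h x) * ln (1 + cmod (h x)) powr real d))"
        using C1 C2 by (intro ennreal_plus) auto
      also have "ennreal (C2 * (cmod (h x) * ln (1 + cmod (h x)) powr real d)) = ennreal C2 * ennreal (cmod (h x) * ln (1 + cmod (h x)) powr real d)"
        using C2 by (intro ennreal_mult) auto
      finally show "ennreal (llog d (sqrt (A\<^sup>2 + (cmod (h x))\<^sup>2)))
        \<le> ennreal C1 + ennreal C2 * ennreal (cmod (g x) / c * ln (1 + cmod (g x) / c) powr real d)" by (simp add: hc)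
    qed
    also have "\<dots> = ennreal C1 + ennreal C2 * (\<integral>\<^sup>+x. ennreal (cmod (g x) / c * ln (1 + cmod (g x) / c) powr real d) \<partial>torus d)"
      by (simp add: nn_integral_add nn_integral_cmult emeasure_torus)
    also have "\<dots> \<le> ennreal C1 + ennreal C2 * 1" by (intro add_left_mono mult_left_mono le1) auto
    also have "\<dots> = ennreal (C1 + C2)" using C1 C2 by simp
    finally have int: "(\<integral>\<^sup>+x. ennreal (llog d (sqrt (A\<^sup>2 + (cmod (h x))\<^sup>2))) \<partial>torus d) \<le> ennreal (C1 + C2)" .
    have "L1_norm d (LP_square d h) \<le> ennreal C0 * ennreal (C1 + C2)"
      unfolding C0_def by (intro order_trans[OF LP_square_L1_le_llog[OF h(1) A]] mult_left_mono int) auto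
    also have "\<dots> = ennreal (C0 * (C1 + C2))" using C0 C1 C2 by (intro ennreal_mult[symmetric]) auto
    finally have *: "L1_norm d (LP_square d h) \<le> ennreal (C0 * (C1 + C2))" .
    have "L1_norm d (LP_square d g) \<le> ennreal c * L1_norm d (LP_square d h)"
    proof -
      have "L1_norm d (LP_square d g) = (\<integral>\<^sup>+x. ennreal c * ennreal \<bar>LP_square d h x\<bar> \<partial>torus d)"
        unfolding L1_norm_def h(2) using c by (intro nn_integral_cong) (simp add: abs_mult ennreal_mult)
      also have "\<dots> = ennreal c * L1_norm d (LP_square d h)"
        unfolding L1_norm_def by (intro nn_integral_cmult measurable_compose[OF _ measurable_ennreal] borel_measurable_abs borel_measurable_LP_square h)
      finally show ?thesis by simp
    qed
    also have "\<dots> \<le> ennreal c * ennreal (C0 * (C1 + C2))" by (intro mult_left_mono *) auto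
    finally show "L1_norm d (LP_square d g) \<le> ennreal (C0 * (C1 + C2)) * e" by (simp add: e mult.commute)
  qed
  then show ?thesis using C0 C1 C2 by (intro exI[of _ "C0 * (C1 + C2)"]) auto
qed

section \<open>Sharpness of the exponent\<close>

lemma circle_integral:
  fixes f :: "real \<Rightarrow> complex"
  assumes f: "continuous_on UNIV f"
  shows "integrable circle f" and "(LINT t|circle. f t) = integral {0..1} f"
proof -
  have "set_integrable lborel {0..1} f"
    unfolding set_integrable_def
    by (rule borel_integrable_compact) (auto intro: continuous_on_subset[OF f])
  then have si: "set_integrable lborel {0..<1} f"
    by (rule set_integrable_subset) auto
  then show "integrable circle f"
    unfolding circle_def set_integrable_def by (subst integrable_restrict_space) auto
  have "(LINT t|circle. f t) = (LINT t:{0..<1}|lborel. f t)"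
    unfolding circle_def set_lebesgue_integral_def by (subst integral_restrict_space) auto
  also have "\<dots> = integral {0..<1} f" by (rule set_borel_integral_eq_integral(2)[OF si])
  also have "\<dots> = integral {0..1} f"
  proof (rule integral_spike_set)
    show "negligible {x \<in> {0..<1} - {0..1}. f x \<noteq> 0}" by (rule negligible_subset[of "{}"]) auto
    show "negligible {x \<in> {0..1} - {0..<1}. f x \<noteq> 0}" by (rule negligible_subset[of "{1}"]) auto
  qed
  finally show "(LINT t|circle. f t) = integral {0..1} f" .
qed

lemma fourier1_trig:
  assumes "finite S"
  shows "fourier1 (trig S w) n = (if n \<in> S then w n else 0)"
proof -
  have c: "continuous_on UNIV (\<lambda>t. trig S w t * cis (- (2 * pi * of_int n * t)))"
    by (intro continuous_intros)
  have e: "trig S w t * cis (- (2 * pi * of_int n * t)) = (\<Sum>m\<in>S. w m * cis (2 * pi * of_int (m - n) * (t - 0)))" for t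
    unfolding trig_def sum_distrib_right by (intro sum.cong refl) (simp add: cis_mult algebra_simps)
  have "((\<lambda>t. trig S w t * cis (- (2 * pi * of_int n * t))) has_integral (\<Sum>m\<in>S. w m * (if m - n = 0 then 1 else 0))) {0..1}"
    unfolding e by (intro has_integral_sum assms has_integral_mult_right cis_has_integral)
  moreover have "(\<Sum>m\<in>S. w m * (if m - n = 0 then 1 else 0)) = (\<Sum>m\<in>S. if m = n then w n else 0)"
    by (intro sum.cong) auto
  ultimately show ?thesis
    unfolding fourier1_def circle_integral(2)[OF c] using assms by (simp add: integral_unique sum.delta)
qed

definition square_weight :: "nat \<Rightarrow> int \<Rightarrow> complex" where
  "square_weight N m = of_nat (card {p \<in> {..<N} \<times> {..<N}. int (fst p) + int (snd p) = m}) / of_nat N"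

text \<open>Covers the upper half of the spectrum, where the weights decrease; at the end point
  \<open>m = 2 * N - 1\<close> the weight is 0.\<close>

lemma square_weight_eq:
  assumes "int N \<le> m" "m < 2 * int N"
  shows "square_weight N m = (2 * of_nat N - 1 - of_int m) / of_nat N"
proof -
  define c where "c = nat m + 1 - N"
  have "{p \<in> {..<N} \<times> {..<N}. int (fst p) + int (snd p) = m} = (\<lambda>a. (a, nat m - a)) ` {c..<N}"
    using assms by (auto simp: image_iff c_def)
  then have "card {p \<in> {..<N} \<times> {..<N}. int (fst p) + int (snd p) = m} = N - c"
    by (simp add: card_image inj_on_def)
  moreover have "int (N - c) = 2 * int N - 1 - m" using assms by (auto simp: c_def)
  then have "(of_int (int (N - c)) :: complex) = of_int (2 * int N - 1 - m)" by (simp only:)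
  ultimately show ?thesis unfolding square_weight_def by simp
qed

definition dirichlet_square :: "nat \<Rightarrow> real \<Rightarrow> complex" where
  "dirichlet_square N t = (\<Sum>a<N. cis (2 * pi * real a * t))\<^sup>2 / of_nat N"

lemma norm_dirichlet_square: "cmod (dirichlet_square N t) = fejer N t"
  by (simp add: dirichlet_square_def fejer_def norm_divide norm_power)

lemma dirichlet_square_trig: "dirichlet_square N = trig {0..<2 * int N} (square_weight N)"
proof
  fix t
  define Q where "Q = {..<N} \<times> {..<N}"
  have "(\<Sum>a<N. cis (2 * pi * real a * t))\<^sup>2 = (\<Sum>p\<in>Q. cis (2 * pi * of_int (int (fst p) + int (snd p)) * t))"
    unfolding power2_eq_square sum_product Q_def sum.cartesian_product
    by (intro sum.cong refl) (auto simp: cis_mult algebra_simps)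
  also have "\<dots> = (\<Sum>m\<in>{0..<2 * int N}. \<Sum>p\<in>{p\<in>Q. int (fst p) + int (snd p) = m}. cis (2 * pi * of_int (int (fst p) + int (snd p)) * t))"
    by (intro sum.group[symmetric]) (auto simp: Q_def)
  also have "\<dots> = (\<Sum>m\<in>{0..<2 * int N}. of_nat (card {p\<in>Q. int (fst p) + int (snd p) = m}) * cis (2 * pi * of_int m * t))"
    by (intro sum.cong refl) simp
  finally show "dirichlet_square N t = trig {0..<2 * int N} (square_weight N) t"
    unfolding dirichlet_square_def Q_def trig_def square_weight_def by (simp add: sum_divide_distrib)
qed

lemma continuous_on_dirichlet_square: "continuous_on D (dirichlet_square N)"
  unfolding dirichlet_square_trig by (intro continuous_intros)

lemma fejer_le: "fejer N t \<le> real N"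
proof -
  have "cmod (\<Sum>a<N. cis (2 * pi * real a * t)) \<le> (\<Sum>a<N. 1)" by (intro sum_norm_le) simp
  then have "(cmod (\<Sum>a<N. cis (2 * pi * real a * t)))\<^sup>2 \<le> (real N)\<^sup>2" by (intro power_mono) auto
  then show ?thesis unfolding fejer_def by (cases "N = 0") (auto simp: field_simps power2_eq_square)
qed

text \<open>These coefficients have the same phase for all positive \<open>n\<close> and decay like
  \<open>1 / n\<close>: the source of the harmonic sum in Hardy's inequality.\<close>

lemma sawtooth_has_integral:
  assumes "n \<noteq> (0::int)"
  shows "((\<lambda>t. of_real (1 / 2 - t) * cis (2 * pi * of_int n * t)) has_integral \<i> / of_real (2 * pi * of_int n)) {0..1}"
proof -
  define w where "w = \<i> * of_real (2 * pi * of_int n)"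
  have w: "w \<noteq> 0" using assms by (simp add: w_def)
  have c: "cis (2 * pi * of_int n * t) = exp (w * of_real t)" for t
    by (simp add: cis_conv_exp w_def mult_ac)
  define G where "G = (\<lambda>z. (1 / 2 - z) * exp (w * z) / w + exp (w * z) / (w * w))"
  have "((\<lambda>t. G (of_real t)) has_vector_derivative of_real (1 / 2 - t) * exp (w * of_real t)) (at t within {0..1})" for t
  proof -
    have "(G has_field_derivative of_real (1 / 2 - t) * exp (w * of_real t)) (at (of_real t))"
      unfolding G_def using w by (auto intro!: derivative_eq_intros simp: field_simps)
    then show ?thesis by (rule has_vector_derivative_real_field)
  qed
  then have "((\<lambda>t. of_real (1 / 2 - t) * exp (w * of_real t)) has_integral G (of_real 1) - G (of_real 0)) {0..1}"
    by (intro fundamental_theorem_of_calculus) auto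
  moreover have "G (of_real 1) - G (of_real 0) = \<i> / of_real (2 * pi * of_int n)"
  proof -
    have "exp w = 1" unfolding w_def by (auto simp: exp_eq_1)
    then have "G (of_real 1) - G (of_real 0) = - (1 / w)" using w by (simp add: G_def field_simps)
    also have "\<dots> = \<i> / of_real (2 * pi * of_int n)" using assms by (simp add: w_def field_simps)
    finally show ?thesis .
  qed
  ultimately show ?thesis by (simp add: c)
qed

text \<open>For \<open>N = 2 ^ q\<close> the block of index \<open>q + 1\<close> is exactly the
  upper half of the spectrum.\<close>

lemma LP1_dirichlet_square:
  assumes N: "N = 2 ^ q"
  shows "LP1 (int (Suc q)) (dirichlet_square N) t = (\<Sum>m\<in>{int N..<2 * int N}. ((2 * of_nat N - 1 - of_int m) / of_nat N) * cis (2 * pi * of_int m * t))"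
proof -
  have "dyadic_block (int (Suc q)) = {int N..<2 * int N}"
    unfolding dyadic_block_nat by (simp add: block_lo_def N)
  then show ?thesis
    unfolding LP1_def dirichlet_square_trig
    by (auto simp: fourier1_trig square_weight_eq intro!: sum.cong)
qed

text \<open>
  Hardy's inequality for the upper half of the spectrum of \<open>dirichlet_square\<close>, obtained by
  testing against the bounded sawtooth \<open>1/2 - t\<close>.
\<close>

lemma LP1_dirichlet_square_L1:
  assumes N: "N = 2 ^ q" and q: "1 \<le> q"
  shows "(\<integral>\<^sup>+t. ennreal (cmod (LP1 (int (Suc q)) (dirichlet_square N) t)) \<partial>circle) \<ge> ennreal ((real q * ln 2 - 1) / pi)"
proof -
  define H where "H = LP1 (int (Suc q)) (dirichlet_square N)"
  have N2: "2 \<le> N" using power_increasing[OF q, of "2::nat"] by (simp add: N)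
  have cH: "continuous_on D H" for D
    unfolding H_def LP1_dirichlet_square[OF N, abs_def] by (intro continuous_intros)
  define b where "b = (\<lambda>j::nat. (of_nat N - of_nat j) / of_nat N :: complex)"
  \<comment> \<open>Shifting the frequencies down by \<open>N - 1\<close> makes them run over
    \<open>1..N\<close> with weights \<open>(N - j) / N\<close>; the one at \<open>j = N\<close>
    vanishes.\<close>
  have H_eq: "H t * cis (- (2 * pi * (real N - 1) * t)) = (\<Sum>j\<in>{1..<N}. b j * cis (2 * pi * of_int (int j) * t))" for t
  proof -
    have "H t * cis (- (2 * pi * (real N - 1) * t)) =
       (\<Sum>m\<in>{int N..<2 * int N}. ((2 * of_nat N - 1 - of_int m) / of_nat N) * cis (2 * pi * of_int (m - (int N - 1)) * t))"
      unfolding H_def LP1_dirichlet_square[OF N] sum_distrib_right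
      by (intro sum.cong refl) (simp add: cis_mult algebra_simps)
    also have "\<dots> = (\<Sum>j\<in>{1..<N + 1}. b j * cis (2 * pi * of_int (int j) * t))"
      using N2 by (intro sum.reindex_bij_witness[of _ "\<lambda>j. int j + (int N - 1)" "\<lambda>m. nat (m - (int N - 1))"])
        (auto simp: b_def)
    also have "{1..<N + 1} = insert N {1..<N}" using N2 by auto
    also have "(\<Sum>j\<in>insert N {1..<N}. b j * cis (2 * pi * of_int (int j) * t)) = (\<Sum>j\<in>{1..<N}. b j * cis (2 * pi * of_int (int j) * t))"
      by (subst sum.insert) (auto simp: b_def)
    finally show ?thesis .
  qed
  define W where "W = (\<Sum>j\<in>{1..<N}. b j * (\<i> / of_real (2 * pi * of_int (int j))))"
  have "((\<lambda>t. \<Sum>j\<in>{1..<N}. b j * (of_real (1 / 2 - t) * cis (2 * pi * of_int (int j) * t))) has_integral W) {0..1}"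
    unfolding W_def by (intro has_integral_sum has_integral_mult_right sawtooth_has_integral) auto
  then have hi: "((\<lambda>t. of_real (1 / 2 - t) * (H t * cis (- (2 * pi * (real N - 1) * t)))) has_integral W) {0..1}"
    unfolding H_eq by (simp add: sum_distrib_left mult.left_commute)
  have "cmod W = cmod (integral {0..1} (\<lambda>t. of_real (1 / 2 - t) * (H t * cis (- (2 * pi * (real N - 1) * t)))))"
    using hi by (simp add: integral_unique)
  also have "\<dots> \<le> integral {0..1} (\<lambda>t. 1 / 2 * cmod (H t))"
  proof (rule integral_norm_bound_integral)
    show "(\<lambda>t. of_real (1 / 2 - t) * (H t * cis (- (2 * pi * (real N - 1) * t)))) integrable_on {0..1}" using hi by blast
    show "(\<lambda>t. 1 / 2 * cmod (H t)) integrable_on {0..1}"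
      by (intro integrable_continuous_interval continuous_intros cH)
    fix t :: real assume "t \<in> {0..1}"
    then have "1 / 2 - t \<le> 1 / 2" "- (1 / 2 - t) \<le> 1 / 2" by auto
    then have "\<bar>1 / 2 - t\<bar> \<le> 1 / 2" by (rule abs_leI)
    then have "\<bar>1 / 2 - t\<bar> * cmod (H t) \<le> 1 / 2 * cmod (H t)" by (intro mult_right_mono) auto
    then show "cmod (of_real (1 / 2 - t) * (H t * cis (- (2 * pi * (real N - 1) * t)))) \<le> 1 / 2 * cmod (H t)"
      by (simp only: norm_mult norm_of_real norm_cis mult_1_right)
  qed
  also have "\<dots> = 1 / 2 * integral {0..1} (\<lambda>t. cmod (H t))" by (simp only: integral_mult_right)
  finally have WH: "2 * cmod W \<le> integral {0..1} (\<lambda>t. cmod (H t))" by simp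
  \<comment> \<open>All terms have the phase \<open>i\<close>, so nothing cancels in the
    modulus.\<close>
  have "W = \<i> * of_real ((\<Sum>j\<in>{1..<N}. inverse (real j) - 1 / real N) / (2 * pi))"
    unfolding W_def sum_divide_distrib of_real_sum sum_distrib_left
    using N2 by (intro sum.cong refl) (auto simp: b_def field_simps)
  then have "cmod W = \<bar>(\<Sum>j\<in>{1..<N}. inverse (real j) - 1 / real N) / (2 * pi)\<bar>"
    by (simp only: norm_mult norm_ii norm_of_real mult_1_left)
  also have "\<dots> \<ge> (\<Sum>j\<in>{1..<N}. inverse (real j) - 1 / real N) / (2 * pi)" by (rule abs_ge_self)
  also have "(\<Sum>j\<in>{1..<N}. inverse (real j) - 1 / real N) = harm (N - 1) - (real N - 1) / real N"
  proof -
    have "{1..<N} = {1..N - 1}" using N2 by auto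
    then show ?thesis using N2 by (simp add: sum_subtractf harm_def of_nat_diff)
  qed
  finally have "(harm (N - 1) - (real N - 1) / real N) / (2 * pi) \<le> cmod W" .
  moreover have "real q * ln 2 - 1 \<le> harm (N - 1) - (real N - 1) / real N"
  proof -
    have "ln (real (N - 1) + 1) \<le> harm (N - 1)" by (rule ln_le_harm)
    moreover have "real (N - 1) + 1 = 2 ^ q" using N2 by (simp add: N of_nat_diff)
    moreover have "ln (2 ^ q :: real) = real q * ln 2" by (simp add: ln_realpow)
    moreover have "(real N - 1) / real N \<le> 1" using N2 by simp
    ultimately show ?thesis by simp
  qed
  ultimately have "(real q * ln 2 - 1) / (2 * pi) \<le> cmod W"
    by (meson divide_right_mono order_trans pi_ge_zero zero_le_mult_iff zero_le_numeral)
  then have "(real q * ln 2 - 1) / pi \<le> integral {0..1} (\<lambda>t. cmod (H t))" 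
  proof -
    have "x / pi = 2 * (x / (2 * pi))" for x by simp
    then have "(real q * ln 2 - 1) / pi = 2 * ((real q * ln 2 - 1) / (2 * pi))" .
    also have "\<dots> \<le> 2 * cmod W"
      by (intro mult_left_mono \<open>(real q * ln 2 - 1) / (2 * pi) \<le> cmod W\<close>) simp
    also note WH
    finally show ?thesis .
  qed
  moreover have "(\<integral>\<^sup>+t. ennreal (cmod (H t)) \<partial>circle) = ennreal (integral {0..1} (\<lambda>t. cmod (H t)))"
    by (intro nn_integral_circle continuous_on_norm cH) auto
  ultimately show ?thesis by (simp add: H_def ennreal_leI)
qed

section \<open>Tensor products of the one-variable example\<close>

definition extremal :: "nat \<Rightarrow> nat \<Rightarrow> (nat \<Rightarrow> real) \<Rightarrow> complex" where
  "extremal d N x = (\<Prod>j<d. dirichlet_square N (x j))"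

lemma analytic_extremal: "analytic_trig_poly d (extremal d N)"
proof -
  interpret product_sigma_finite "\<lambda>_::nat. circle" by (rule product_sigma_finite_circle)
  have i: "integrable circle (dirichlet_square N)" by (rule circle_integral(1)[OF continuous_on_dirichlet_square])
  have "integrable (torus d) (extremal d N)"
    unfolding extremal_def[abs_def] torus_def by (rule product_integrable_prod) (use i in auto)
  moreover have supp: "fourier_supp d (extremal d N) \<subseteq> ({..<d} \<rightarrow>\<^sub>E {0..<2 * int N})"
  proof
    fix n assume n: "n \<in> fourier_supp d (extremal d N)"
    have "fourier d (extremal d N) n = (\<Prod>j<d. fourier1 (dirichlet_square N) (n j))"
      unfolding extremal_def[abs_def] by (rule fourier_tensor) (rule i)
    then have "\<And>j. j < d \<Longrightarrow> fourier1 (dirichlet_square N) (n j) \<noteq> 0"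
      using n by (auto simp: fourier_supp_def)
    then have "\<And>j. j < d \<Longrightarrow> n j \<in> {0..<2 * int N}"
      unfolding dirichlet_square_trig by (metis finite_atLeastLessThan_int fourier1_trig)
    then show "n \<in> {..<d} \<rightarrow>\<^sub>E {0..<2 * int N}"
      using n by (auto simp: fourier_supp_def int_vectors_def PiE_iff)
  qed
  moreover have "finite ({..<d} \<rightarrow>\<^sub>E {0..<2 * int N})" by (intro finite_PiE) auto
  ultimately show ?thesis
    unfolding analytic_trig_poly_def trig_poly_def using finite_subset[OF supp] by (auto simp: PiE_iff dest: subsetD[OF supp])
qed

text \<open>A single term of the square function, with the block of index \<open>q + 1\<close> in
  every variable, is a tensor product, and its \<open>L\<^sup>1\<close> norm factorises.\<close>

lemma extremal_L1_lower:
  assumes N: "N = 2 ^ q" and q: "2 \<le> q"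
  shows "ennreal (((real q * ln 2 - 1) / pi) ^ d) \<le> L1_norm d (LP_square d (extremal d N))"
proof -
  interpret product_sigma_finite "\<lambda>_::nat. circle" by (rule product_sigma_finite_circle)
  define H where "H = LP1 (int (Suc q)) (dirichlet_square N)"
  define k where "k = (\<lambda>j\<in>{..<d}. int (Suc q))"
  have i: "integrable circle (dirichlet_square N)" by (rule circle_integral(1)[OF continuous_on_dirichlet_square])
  have k: "k \<in> int_vectors d" by (simp add: k_def int_vectors_def)
  have LP: "LP d k (extremal d N) x = (\<Prod>j<d. H (x j))" for x
  proof -
    have "LP d k (extremal d N) x = (\<Prod>j<d. LP1 (k j) (dirichlet_square N) (x j))"
      unfolding extremal_def[abs_def] by (rule LP_tensor) (rule i)
    then show ?thesis by (simp add: k_def H_def)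
  qed
  have cH: "continuous_on UNIV (\<lambda>t. cmod (H t))"
    unfolding H_def LP1_dirichlet_square[OF N, abs_def] by (intro continuous_intros)
  have mH: "(\<lambda>t. ennreal (cmod (H t))) \<in> borel_measurable circle"
    by (intro measurable_circle measurable_compose[OF borel_measurable_continuous_onI[OF cH]]) simp
  have pt: "(\<Prod>j<d. ennreal (cmod (H (x j)))) \<le> ennreal \<bar>LP_square d (extremal d N) x\<bar>" for x
  proof -
    have fin: "finite {k \<in> int_vectors d. (cmod (LP d k (extremal d N) x))\<^sup>2 \<noteq> 0}"
      using finite_LP_nonzero[of d "extremal d N" x] analytic_extremal[of d N] by (simp add: analytic_trig_poly_def)
    have "(\<Sum>k\<in>{k}. (cmod (LP d k (extremal d N) x))\<^sup>2) \<le> (\<Sum>\<^sub>\<infinity>k\<in>int_vectors d. (cmod (LP d k (extremal d N) x))\<^sup>2)"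
      using k by (intro finite_sum_le_infsum finite_nonzero_values_imp_summable_on fin) auto
    then have "cmod (LP d k (extremal d N) x) \<le> LP_square d (extremal d N) x"
      unfolding LP_square_def by (intro real_le_rsqrt) simp
    then show ?thesis unfolding LP prod_ennreal[OF norm_ge_zero] by (intro ennreal_leI) (simp add: prod_norm)
  qed
  have "ennreal (((real q * ln 2 - 1) / pi) ^ d) = (\<Prod>j<d. ennreal ((real q * ln 2 - 1) / pi))"
  proof -
    \<comment> \<open>Nonnegativity of the factor lets \<open>ennreal\<close> commute with the
      power; it comes from \<open>q \<ge> 2\<close>.\<close>
    have "1 \<le> real q * ln 2"
    proof -
      have "2 * (1 / 2) \<le> real q * ln 2" using q ln2_ge_two_thirds by (intro mult_mono) auto
      then show ?thesis by simp
    qed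
    then show ?thesis by (simp add: ennreal_power)
  qed
  also have "\<dots> \<le> (\<Prod>j<d. (\<integral>\<^sup>+t. ennreal (cmod (H t)) \<partial>circle))"
    unfolding H_def using q by (intro prod_mono_ennreal LP1_dirichlet_square_L1 N) auto
  also have "\<dots> = (\<integral>\<^sup>+x. (\<Prod>j<d. ennreal (cmod (H (x j)))) \<partial>torus d)"
    unfolding torus_def by (rule product_nn_integral_prod[symmetric]) (use mH in auto)
  also have "\<dots> \<le> L1_norm d (LP_square d (extremal d N))"
    unfolding L1_norm_def by (intro nn_integral_mono pt)
  finally show ?thesis .
qed

text \<open>The modulus is a product of Fejer kernels, with integral 1 and maximum at most
  \<open>N ^ d\<close>. Hence the logarithm never exceeds \<open>l\<close>, and
  \<open>c = l powr r\<close> is admissible.\<close>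

lemma extremal_LlogL_upper:
  assumes d: "1 \<le> d" and N: "2 \<le> N" and r: "0 < r"
  shows "LlogL_norm d r (extremal d N) \<le> ennreal (ln (1 + real N ^ d) powr r)"
proof -
  define l where "l = ln (1 + real N ^ d)"
  define c where "c = l powr r"
  have Nd: "2 \<le> real N ^ d"
  proof -
    have "2 \<le> real N" using N by simp
    also have "real N = real N ^ 1" by simp
    also have "\<dots> \<le> real N ^ d" using d N by (intro power_increasing) auto
    finally show ?thesis .
  qed
  have l: "1 \<le> l" unfolding l_def using Nd exp_le by (subst ln_ge_iff) auto
  have c: "1 \<le> c" unfolding c_def using l r by (simp add: ge_one_powr_ge_zero)
  have g: "cmod (extremal d N x) = fejer_kernel d N x (\<lambda>_. 0)" for x
    by (simp add: extremal_def fejer_kernel_def norm_dirichlet_square flip: prod_norm)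
  have gN: "fejer_kernel d N x (\<lambda>_. 0) \<le> real N ^ d" for x
  proof -
    have "fejer_kernel d N x (\<lambda>_. 0) \<le> (\<Prod>j<d. real N)"
      unfolding fejer_kernel_def by (intro prod_mono) (auto simp: fejer_nonneg fejer_le)
    then show ?thesis by simp
  qed
  have "(\<integral>\<^sup>+x. ennreal (cmod (extremal d N x) / c * ln (1 + cmod (extremal d N x) / c) powr r) \<partial>torus d)
    \<le> (\<integral>\<^sup>+x. ennreal (fejer_kernel d N x (\<lambda>_. 0)) \<partial>torus d)"
  proof (intro nn_integral_mono ennreal_leI)
    fix x
    define v where "v = fejer_kernel d N x (\<lambda>_. 0)"
    have v: "0 \<le> v" "v \<le> real N ^ d" using gN[of x] by (simp_all add: v_def fejer_kernel_nonneg)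
    have "v / c \<le> v / 1" using v c by (intro divide_left_mono) auto
    moreover have vc: "0 \<le> v / c" using v c by simp
    ultimately have "ln (1 + v / c) \<le> l" unfolding l_def using v by (intro ln_mono) linarith+
    then have "ln (1 + v / c) powr r \<le> l powr r" using vc r by (intro powr_mono2 ln_ge_zero) auto
    then have "ln (1 + v / c) powr r \<le> c" by (simp only: c_def)
    then have "v / c * ln (1 + v / c) powr r \<le> v / c * c" using v c by (intro mult_left_mono) auto
    also have "\<dots> = v" using c by simp
    finally show "cmod (extremal d N x) / c * ln (1 + cmod (extremal d N x) / c) powr r \<le> fejer_kernel d N x (\<lambda>_. 0)"
      by (simp add: g v_def)
  qed
  also have "\<dots> = 1" using N by (intro nn_integral_fejer_kernel) auto
  finally have "ennreal c \<in> {ennreal c |c. 0 < c \<and> (\<integral>\<^sup>+x. ennreal (cmod (extremal d N x) / c * ln (1 + cmod (extremal d N x) / c) powr r) \<partial>torus d) \<le> 1}"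
    using c by auto
  then show ?thesis unfolding LlogL_norm_def c_def l_def by (rule Inf_lower)
qed

text \<open>Along \<open>N = 2 ^ q\<close> the left side grows at least like \<open>q ^ d\<close>
  and the right side at most like \<open>q powr r\<close>.\<close>

theorem LlogL_exponent_sharp:
  assumes d: "1 \<le> d" and r: "0 < r" and C: "0 < C"
    and le: "\<And>g. analytic_trig_poly d g \<Longrightarrow> L1_norm d (LP_square d g) \<le> ennreal C * LlogL_norm d r g"
  shows "real d \<le> r"
proof (rule ccontr)
  assume "\<not> real d \<le> r"
  then have rd: "0 < real d - r" by simp
  \<comment> \<open>Half of \<open>ln 2 / \<pi>\<close>: for \<open>q \<ge> 3\<close> the other half
    pays for the \<open>- 1\<close> in the lower bound.\<close>
  define b where "b = ln 2 / (2 * pi)"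
  have b: "0 < b" by (simp add: b_def)
  define M where "M = C * real (d + 1) powr r / b ^ d"
  have q_le: "real q powr (real d - r) \<le> M" if q: "3 \<le> q" for q
  proof -
    define N where "N = (2::nat) ^ q"
    have N2: "2 \<le> N" using power_increasing[of 1 q "2::nat"] q by (simp add: N_def)
    have "1 \<le> real q * (ln 2 / 2)"
    proof -
      have "3 * (1 / 3) \<le> real q * (ln 2 / 2)" using q ln2_ge_two_thirds by (intro mult_mono) auto
      then show ?thesis by simp
    qed
    then have "b * real q \<le> (real q * ln 2 - 1) / pi" by (simp add: b_def field_simps)
    then have 1: "(b * real q) ^ d \<le> ((real q * ln 2 - 1) / pi) ^ d" using b by (intro power_mono) auto
    have "ennreal (((real q * ln 2 - 1) / pi) ^ d) \<le> L1_norm d (LP_square d (extremal d N))"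
      using q by (intro extremal_L1_lower N_def) auto
    also have "\<dots> \<le> ennreal C * LlogL_norm d r (extremal d N)" by (rule le[OF analytic_extremal])
    also have "\<dots> \<le> ennreal C * ennreal (ln (1 + real N ^ d) powr r)"
      by (intro mult_left_mono extremal_LlogL_upper d N2 r) auto
    also have "\<dots> = ennreal (C * ln (1 + real N ^ d) powr r)" using C by (intro ennreal_mult[symmetric]) auto
    finally have 2: "((real q * ln 2 - 1) / pi) ^ d \<le> C * ln (1 + real N ^ d) powr r"
      using C by (subst (asm) ennreal_le_iff) auto
    have 3: "ln (1 + real N ^ d) \<le> real (d + 1) * real q"
    proof -
      have "1 + real N ^ d \<le> 2 * 2 ^ (q * d)" by (simp add: N_def power_mult)
      then have "ln (1 + real N ^ d) \<le> ln (2 ^ Suc (q * d))"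
        by (intro ln_mono) (auto intro: add_pos_nonneg)
      also have "\<dots> = real (Suc (q * d)) * ln 2" by (rule ln_realpow)
      also have "\<dots> \<le> real (Suc (q * d)) * 1" using ln_2_less_1 by (intro mult_left_mono) auto
      also have "\<dots> \<le> real (d + 1) * real q" using q by (simp add: algebra_simps)
      finally show ?thesis .
    qed
    have "0 \<le> ln (1 + real N ^ d)" by (intro ln_ge_zero) simp
    then have "ln (1 + real N ^ d) powr r \<le> (real (d + 1) * real q) powr r"
      using 3 r by (intro powr_mono2) auto
    also have "\<dots> = real (d + 1) powr r * real q powr r" by (rule powr_mult)
    finally have "(b * real q) ^ d \<le> C * (real (d + 1) powr r * real q powr r)"
      using 1 2 C by (meson less_imp_le mult_left_mono order_trans)
    then have "b ^ d * real q powr real d \<le> C * real (d + 1) powr r * real q powr r"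
      using q by (simp add: power_mult_distrib powr_realpow mult.assoc)
    then have "real q powr real d \<le> M * real q powr r"
      using b by (simp add: M_def field_simps)
    then show ?thesis using q by (simp add: powr_diff field_simps)
  qed
  \<comment> \<open>Chosen so that \<open>q powr (d - r)\<close> is at least \<open>|M| + 1\<close>;
    the maximum with 3 meets the hypothesis of \<open>q_le\<close>.\<close>
  define q where "q = max 3 (nat \<lceil>(\<bar>M\<bar> + 1) powr (1 / (real d - r))\<rceil>)"
  have "(\<bar>M\<bar> + 1) powr (1 / (real d - r)) \<le> real (nat \<lceil>(\<bar>M\<bar> + 1) powr (1 / (real d - r))\<rceil>)"
    by (rule real_nat_ceiling_ge)
  also have "\<dots> \<le> real q" by (simp add: q_def)
  finally have "(\<bar>M\<bar> + 1) powr (1 / (real d - r)) \<le> real q" .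
  then have "((\<bar>M\<bar> + 1) powr (1 / (real d - r))) powr (real d - r) \<le> real q powr (real d - r)"
    using rd by (intro powr_mono2) auto
  then have "\<bar>M\<bar> + 1 \<le> real q powr (real d - r)"
    using rd by (simp add: powr_powr)
  moreover have "real q powr (real d - r) \<le> M" by (rule q_le) (simp add: q_def)
  ultimately show False by linarith
qed

theorem proposition6:
  fixes d :: nat
  assumes "d \<ge> 1"
  shows
    "(\<exists>C::real. C > 0 \<and>
        (\<forall>g. analytic_trig_poly d g \<longrightarrow>
          L1_norm d (LP_square d g) \<le> ennreal C * LlogL_norm d (real d) g)) \<and>
     (\<forall>r::real. r > 0 \<longrightarrow>
        (\<exists>C::real. C > 0 \<and>
          (\<forall>g. analytic_trig_poly d g \<longrightarrow>
            L1_norm d (LP_square d g) \<le> ennreal C * LlogL_norm d r g)) \<longrightarrow>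
        r \<ge> real d)"
  using LP_square_L1_le_LlogL[of d] LlogL_exponent_sharp[OF assms] by blast

end
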